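(* Suppose that $\phi^0:\Omega\to\mathbb{R}$ satisfies $\phi^0>0$ on $\Omega^+(0)$, $\phi^0<0$ on $\Omega^-(0)$, $\{x\in\Omega\mid\phi^0(x)=0\}=\Sigma(0)$ and $\nabla\phi^0\neq0$ on $\Sigma(0)$, and that $\phi^0$ is $C^2$-smooth in a neighborhood of $\Sigma(0)$. Then there exist a ($t$-global) tubular neighborhood $\Theta$ of $\{\Sigma(t)\}_{t\ge0}$ and a $C^2$-function $\phi:\Theta\to\mathbb{R}$ solving $$\frac{\partial\phi}{\partial t}(t,x)+v\Big(t,\,x-\frac{\phi(t,x)\nabla\phi(t,x)}{|\nabla\phi(t,x)|^2}\Big)\cdot\nabla\phi(t,x)=0\ \text{ in }\Theta|_{t>0},\qquad\phi=\phi^0\ \text{ on }\Theta|_{t=0}.$$ Furthermore, it holds that - $\phi(t,\cdot)>0$ in $\Theta\cap\Omega^+(t)$ and $\phi(t,\cdot)<0$ in $\Theta\cap\Omega^-(t)$ for each $t\ge0$; - for every $(t,x)\in\Theta$ there exists $\xi$ such that $(0,\xi)\in\Theta$ and $|\nabla\phi(t,x)|=|\nabla\phi^0(\xi)|\neq0$.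
   Context: Setting. $\Omega\subset\mathbb{R}^3$ is a bounded connected open set and $v=v(t,x):[0,\infty)\times\bar\Omega\to\mathbb{R}^3$ is a given function satisfying: (H1) $v\in C^0([0,\infty)\times\bar\Omega;\mathbb{R}^3)\cap C^1([0,\infty)\times\Omega;\mathbb{R}^3)$; $v$ is Lipschitz continuous in $x$ on $[0,\infty)\times\bar\Omega$; $v$ is twice partially differentiable in $x$; all of these partial derivatives of $v$ belong to $C^0([0,\infty)\times\Omega;\mathbb{R}^3)$. (H2) $\pm v(s,x)\in T_{\partial\Omega}(x)$ for all $(s,x)\in[0,\infty)\times\partial\Omega$, where $T_{\partial\Omega}(x):=\{z\in\mathbb{R}^3\mid\liminf_{h\to0+}\mathrm{dist}(x+hz,\partial\Omega)/h=0\}$. No regularity of $\partial\Omega$ is assumed. $X(s,\tau,\xi)$ denotes the flow of $x'(s)=v(s,x(s))$, i.e. $s\mapsto X(s,\tau,\xi)$ is the unique solution with $x(\tau)=\xi$; by (H1), (H2), $\Omega$ and $\partial\Omega$ are forward and backward flow invariant for times in $[0,\infty)$. $\Omega^+(0)\subset\Omega$ is a subdomain such that $\Sigma(0):=\partial\Omega^+(0)$ is a closed $C^2$-smooth surface with $\Sigma(0)\cap\partial\Omega=\emptyset$, and $\Omega^-(0):=\Omega\setminus(\Omega^+(0)\cup\Sigma(0))$. For $t\ge0$, $\Omega^\pm(t):=X(t,0,\Omega^\pm(0))$ and $\Sigma(t):=X(t,0,\Sigma(0))$ (the moving interface). For $\varepsilon>0$, $\Sigma_\varepsilon(t):=\bigcup_{x\in\Sigma(t)}\{y\in\mathbb{R}^3\mid|x-y|<\varepsilon\}$.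 A set $\Theta\subset[0,\infty)\times\Omega$ is a ($t$-global) tubular neighborhood of $\{\Sigma(t)\}_{t\ge0}$ if $\Theta\supset\bigcup_{t\ge0}(\{t\}\times\Sigma(t))$, the set $\{x\in\Omega\mid(t,x)\in\Theta\}$ is open for each $t\ge0$, and there is a nonincreasing function $\varepsilon:[0,\infty)\to\mathbb{R}_{>0}$ with $\{t\}\times\Sigma_{\varepsilon(t)}(t)\subset\Theta$ for all $t\ge0$. $\Theta|_{t>0}$ and $\Theta|_{t=0}$ denote the parts of $\Theta$ with $t>0$ and $t=0$; "in $\Theta\cap\Omega^\pm(t)$" refers to points $x\in\Omega^\pm(t)$ with $(t,x)\in\Theta$. $\nabla$ is the gradient in $x$. Solving the PDE includes that the spatial argument at which $v$ is evaluated lies where $v$ is defined. *)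

theory Defs
  imports "HOL-Analysis.Analysis"
begin

text \<open>
  Classes of continuously (Frechet) differentiable maps. They are used on open sets and on
  relatively open subsets of \<open>[0,\<infinity>) \<times> \<real>\<^sup>3\<close>; on the latter, the derivatives within the set are
  unique, and at \<open>t = 0\<close> they are the one-sided ones.
\<close>

definition C1_on :: "'a::real_normed_vector set \<Rightarrow> ('a \<Rightarrow> 'b::real_normed_vector) \<Rightarrow> bool" where
  "C1_on S f \<longleftrightarrow> (\<exists>f' :: 'a \<Rightarrow> 'a \<Rightarrow>\<^sub>L 'b.
     (\<forall>x\<in>S. (f has_derivative blinfun_apply (f' x)) (at x within S)) \<and> continuous_on S f')"

definition C2_on :: "'a::real_normed_vector set \<Rightarrow> ('a \<Rightarrow> 'b::real_normed_vector) \<Rightarrow> bool" where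
  "C2_on S f \<longleftrightarrow> (\<exists>f' :: 'a \<Rightarrow> 'a \<Rightarrow>\<^sub>L 'b.
     (\<forall>x\<in>S. (f has_derivative blinfun_apply (f' x)) (at x within S)) \<and> C1_on S f')"

text \<open>
  The time slices of a tubular neighborhood \<open>\<Theta>\<close> are open, but \<open>\<Theta>\<close> itself need not be relatively
  open in \<open>[0,\<infinity>) \<times> \<real>\<^sup>3\<close>. As usual for sets that are not open, a function on \<open>\<Theta>\<close> is C2 if it is the
  restriction of a C2 function on a (relatively) open superset. The total function \<open>\<phi>\<close> is itself
  that extension; its values off the superset are irrelevant.
\<close>

definition C2_on_spacetime :: "(real \<times> (real^3)) set \<Rightarrow> (real \<Rightarrow> real^3 \<Rightarrow> real) \<Rightarrow> bool" where
  "C2_on_spacetime \<Theta> \<phi> \<longleftrightarrow>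
     (\<exists>U. openin (top_of_set ({0..} \<times> UNIV)) U \<and> \<Theta> \<subseteq> U \<and> C2_on U (\<lambda>(t, x). \<phi> t x))"

definition grad :: "(real^3 \<Rightarrow> real) \<Rightarrow> real^3 \<Rightarrow> real^3" where
  "grad f x = (THE D. GDERIV f x :> D)"

text \<open>
  Compact C2 surface without boundary, given by local parametrizations. It is not required to be
  connected (the boundary of a domain may have several components).
\<close>

definition closed_C2_surface :: "(real^3) set \<Rightarrow> bool" where
  "closed_C2_surface S \<longleftrightarrow> compact S \<and>
     (\<forall>p\<in>S. \<exists>V W (\<psi> :: real^2 \<Rightarrow> real^3) \<psi>'.
        open V \<and> p \<in> V \<and> open W \<and> C2_on W \<psi> \<and> homeomorphism W (S \<inter> V) \<psi> \<psi>' \<and>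
        (\<forall>u\<in>W. inj (frechet_derivative \<psi> (at u))))"

definition tangent_cone :: "(real^3) set \<Rightarrow> real^3 \<Rightarrow> (real^3) set" where
  "tangent_cone S x = {z. Liminf (at_right 0) (\<lambda>h. ereal (infdist (x + h *\<^sub>R z) S / h)) = 0}"

text \<open>
  Existence and continuity of all first and second order partial derivatives in \<open>x\<close>:
  \<open>d1 i\<close> is the derivative in direction \<open>i\<close>, and \<open>d2 i j\<close> that of \<open>d1 i\<close> in direction \<open>j\<close>.
\<close>

definition twice_partially_C_x :: "(real^3) set \<Rightarrow> (real \<Rightarrow> real^3 \<Rightarrow> real^3) \<Rightarrow> bool" where
  "twice_partially_C_x \<Omega> v \<longleftrightarrow>
     (\<exists>(d1 :: 3 \<Rightarrow> real \<Rightarrow> real^3 \<Rightarrow> real^3) (d2 :: 3 \<Rightarrow> 3 \<Rightarrow> real \<Rightarrow> real^3 \<Rightarrow> real^3).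
        (\<forall>i. \<forall>t\<ge>0. \<forall>x\<in>\<Omega>.
           ((\<lambda>h. v t (x + h *\<^sub>R axis i 1)) has_vector_derivative d1 i t x) (at 0)) \<and>
        (\<forall>i j. \<forall>t\<ge>0. \<forall>x\<in>\<Omega>.
           ((\<lambda>h. d1 i t (x + h *\<^sub>R axis j 1)) has_vector_derivative d2 i j t x) (at 0)) \<and>
        (\<forall>i. continuous_on ({0..} \<times> \<Omega>) (\<lambda>(t, x). d1 i t x)) \<and>
        (\<forall>i j. continuous_on ({0..} \<times> \<Omega>) (\<lambda>(t, x). d2 i j t x)))"

definition H1 :: "(real^3) set \<Rightarrow> (real \<Rightarrow> real^3 \<Rightarrow> real^3) \<Rightarrow> bool" where
  "H1 \<Omega> v \<longleftrightarrow>
     continuous_on ({0..} \<times> closure \<Omega>) (\<lambda>(t, x). v t x) \<and>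
     C1_on ({0..} \<times> \<Omega>) (\<lambda>(t, x). v t x) \<and>
     (\<exists>L. \<forall>t\<ge>0. L-lipschitz_on (closure \<Omega>) (v t)) \<and>
     twice_partially_C_x \<Omega> v"

definition H2 :: "(real^3) set \<Rightarrow> (real \<Rightarrow> real^3 \<Rightarrow> real^3) \<Rightarrow> bool" where
  "H2 \<Omega> v \<longleftrightarrow> (\<forall>s\<ge>0. \<forall>x\<in>frontier \<Omega>.
     v s x \<in> tangent_cone (frontier \<Omega>) x \<and> - v s x \<in> tangent_cone (frontier \<Omega>) x)"

text \<open>
  Solutions live on \<open>[0,\<infinity>)\<close> and stay in the closure of \<open>\<Omega>\<close>, where \<open>v\<close> is given. Under
  \<open>H1\<close> and \<open>H2\<close> they exist and are unique for \<open>\<tau> \<ge> 0\<close> and \<open>\<xi>\<close> in the closure of \<open>\<Omega>\<close>, which makes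
  the definite description below meaningful.
\<close>

definition solution :: "(real^3) set \<Rightarrow> (real \<Rightarrow> real^3 \<Rightarrow> real^3) \<Rightarrow> (real \<Rightarrow> real^3) \<Rightarrow> bool" where
  "solution \<Omega> v x \<longleftrightarrow>
     (\<forall>s\<ge>0. x s \<in> closure \<Omega> \<and> (x has_vector_derivative v s (x s)) (at s within {0..}))"

definition flow ::
  "(real^3) set \<Rightarrow> (real \<Rightarrow> real^3 \<Rightarrow> real^3) \<Rightarrow> real \<Rightarrow> real \<Rightarrow> real^3 \<Rightarrow> real^3" where
  "flow \<Omega> v s \<tau> \<xi> = (THE y. \<exists>x. solution \<Omega> v x \<and> x \<tau> = \<xi> \<and> x s = y)"

definition transported ::
  "(real^3) set \<Rightarrow> (real \<Rightarrow> real^3 \<Rightarrow> real^3) \<Rightarrow> (real^3) set \<Rightarrow> real \<Rightarrow> (real^3) set" where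
  "transported \<Omega> v A t = flow \<Omega> v t 0 ` A"

definition tubular_neighborhood ::
  "(real^3) set \<Rightarrow> (real \<Rightarrow> (real^3) set) \<Rightarrow> (real \<times> (real^3)) set \<Rightarrow> bool" where
  "tubular_neighborhood \<Omega> \<Sigma> \<Theta> \<longleftrightarrow>
     \<Theta> \<subseteq> {0..} \<times> \<Omega> \<and>
     (\<Union>t\<in>{0..}. {t} \<times> \<Sigma> t) \<subseteq> \<Theta> \<and>
     (\<forall>t\<ge>0. open {x\<in>\<Omega>. (t, x) \<in> \<Theta>}) \<and>
     (\<exists>\<epsilon> :: real \<Rightarrow> real. antimono_on {0..} \<epsilon> \<and> (\<forall>t\<ge>0. 0 < \<epsilon> t) \<and>
        (\<forall>t\<ge>0. {t} \<times> (\<Union>x\<in>\<Sigma> t. ball x (\<epsilon> t)) \<subseteq> \<Theta>))"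

end

theory Submission
  imports Defs
begin

text \<open>
  The characteristics of the equation are explicit. Let \<open>Y t\<close> be the flow of \<open>v\<close>, \<open>p = grad \<phi>0\<close> and
  \<open>\<eta>(\<xi>) = \<xi> - \<phi>0(\<xi>) p(\<xi>) / |p(\<xi>)|\<^sup>2\<close>, and let \<open>w\<close> solve the conormal equation \<open>w' = - (Dv)\<^sup>T w\<close> along
  \<open>Y t (\<eta>(\<xi>))\<close> with \<open>w = p(\<xi>)\<close> at time \<open>0\<close>, so that \<open>w \<bullet> DY k = p \<bullet> k\<close>. Then
  \<open>Z t \<xi> = Y t (\<eta>(\<xi>)) + \<phi>0(\<xi>) w / |w|\<^sup>2\<close> is the characteristic through \<open>\<xi>\<close>; along it the solution is
  \<open>\<phi>0(\<xi>) |p| / |w|\<close>, its gradient is \<open>|p| w / |w|\<close>, and the projected point at which \<open>v\<close> is evaluated is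
  \<open>Y t (\<eta>(\<xi>))\<close>. On the initial interface \<open>Z t = Y t\<close>, and there \<open>DZ\<close> is invertible. By compactness
  \<open>Z t\<close> is injective on a neighborhood of the initial interface whose size depends on a bound for \<open>t\<close>,
  and the even reflection in time together with invariance of domain shows that the image of the
  corresponding space-time set is relatively open and carries a C1 inverse.
  The flow stays in \<open>\<Omega>\<close> because the distance to the boundary satisfies a Dini differential inequality.
\<close>

section \<open>Differential inequalities and Picard iteration\<close>

text \<open>With \<open>H = v(t, y) \<bullet> P\<close> and
  \<open>y = x - u P / |P|\<^sup>2\<close>, the characteristic system of the equation gives
  \<open>P' = - (Dv)\<^sup>T P + (P \<bullet> Dv P / |P|\<^sup>2) P\<close> and
  \<open>y' = v(t, y)\<close>. The \<open>u\<close>-derivative of \<open>H\<close> cancels the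
  radial growth of \<open>P\<close>, so \<open>|P|\<close> is conserved and \<open>P\<close> keeps
  the direction of the conormal \<open>w\<close>. This is the origin of the closed formulas, and of
  the gradient norm being that of \<open>\<phi>0\<close> at the foot point of the characteristic.
  The obstacle is regularity: \<open>grad \<phi>0\<close> is only C1, hence so are \<open>Z\<close>
  and \<open>u\<close>, and composing \<open>u\<close> with the inverse of \<open>Z\<close> shows no
  more than C1. The missing order comes from the derivative of the solution, which consists of
  \<open>P\<close> and \<open>P \<bullet> v\<close> at the projected point, both C1 functions. A
  second point is the sign. The two phases are transported by \<open>Y\<close>, whereas the solution
  is carried by \<open>Z\<close>; a point of a phase at time \<open>t\<close> therefore has to be
  shown to lie on a characteristic that started in the same phase.\<close>

text \<open>A touching argument against the barrier \<open>m\<close>, whose source term is enlarged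
  by \<rho>; afterwards \<rho> tends to 0. The hypothesis asks for some small step \<open>h\<close>
  instead of all small steps, because the tangency condition on the boundary is a liminf and
  delivers no more.\<close>

lemma dini_gronwall:
  fixes g :: "real \<Rightarrow> real"
  assumes cont: "continuous_on {0..T} g" and L: "0 \<le> L" and eps: "0 \<le> \<epsilon>"
    and nonneg: "\<And>t. 0 \<le> t \<Longrightarrow> t \<le> T \<Longrightarrow> 0 \<le> g t"
    and step: "\<And>t e. 0 \<le> t \<Longrightarrow> t < T \<Longrightarrow> 0 < e \<Longrightarrow>
      \<exists>h>0. h < e \<and> g (t + h) \<le> g t + h * (L * g t + \<epsilon> + e)"
    and t: "0 \<le> t" "t \<le> T"
  shows "g t \<le> (g 0 + \<epsilon> * t) * exp (L * t)"
proof -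
  have main: "g t \<le> (g 0 + (\<epsilon> + \<rho>) * t) * exp (L * t)" if \<rho>: "0 < \<rho>" for \<rho>
  proof (rule ccontr)
    assume neg: "\<not> ?thesis"
    define m where "m = (\<lambda>s. (g 0 + (\<epsilon> + \<rho>) * s) * exp (L * s))"
    \<comment> \<open>Only the last point of \<open>A\<close> matters, so \<open>A\<close> need not
      be an interval. A step beyond that point which stays below the barrier is the
      contradiction.\<close>
    define A where "A = {s \<in> {0..t}. g s \<le> m s}"
    have "continuous_on {0..t} (\<lambda>s. m s - g s)"
    unfolding m_def using cont t by (intro continuous_intros) (auto intro: continuous_on_subset)
  then have "closed ({0..t} \<inter> (\<lambda>s. m s - g s) -` {0..})"
    by (intro continuous_closed_preimage) auto
  also have "{0..t} \<inter> (\<lambda>s. m s - g s) -` {0..} = A" by (auto simp: A_def)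
  finally have "closed A" .
  then have "compact A"
      by (auto simp: compact_eq_bounded_closed A_def intro: bounded_subset[OF bounded_closed_interval[of 0 t]])
    moreover have "0 \<in> A" using t by (auto simp: A_def m_def)
    ultimately obtain c where c: "c \<in> A" "\<And>s. s \<in> A \<Longrightarrow> s \<le> c"
      using compact_attains_sup[of A] by blast
    have "c \<noteq> t" using c(1) neg by (auto simp: A_def m_def)
    then have c': "0 \<le> c" "c < t" "g c \<le> m c" using c(1) by (auto simp: A_def)
    \<comment> \<open>The error \<open>min \<rho> (t - c)\<close> serves twice: it is absorbed by
      the extra source \<rho>, and it keeps \<open>c + h\<close> inside
      \<open>{0..t}\<close>.\<close>
    obtain h where h: "h > 0" "h < min \<rho> (t - c)"
        and gh: "g (c + h) \<le> g c + h * (L * g c + \<epsilon> + min \<rho> (t - c))"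
      using step[of c "min \<rho> (t - c)"] c' t \<rho> by auto
    have a: "0 \<le> g 0 + (\<epsilon> + \<rho>) * (c + h)"
      using nonneg[of 0] t eps \<rho> c' h by (auto intro!: add_nonneg_nonneg mult_nonneg_nonneg)
    have "g (c + h) \<le> m c + h * (L * m c + \<epsilon> + \<rho>)"
      using gh c'(3) L h(1)
      by (smt (verit, best) mult_left_mono)
    \<comment> \<open>The source is inflated by a factor that is at least 1, so that
      \<open>1 + L * h\<close> factors out and can be replaced by
      \<open>exp (L * h)\<close>.\<close>
    also have "\<dots> \<le> m c + h * (L * m c) + h * (\<epsilon> + \<rho>) * (exp (L * c) * (1 + L * h))"
    proof -
      have "1 * 1 \<le> exp (L * c) * (1 + L * h)" using L c' h by (intro mult_mono) auto
      then have "h * (\<epsilon> + \<rho>) * 1 \<le> h * (\<epsilon> + \<rho>) * (exp (L * c) * (1 + L * h))"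
        using h eps \<rho> by (intro mult_left_mono) auto
      then show ?thesis by (simp add: algebra_simps)
    qed
    also have "\<dots> = (g 0 + (\<epsilon> + \<rho>) * (c + h)) * (exp (L * c) * (1 + L * h))"
      by (simp add: m_def algebra_simps)
    also have "\<dots> \<le> (g 0 + (\<epsilon> + \<rho>) * (c + h)) * (exp (L * c) * exp (L * h))"
      using a exp_ge_add_one_self[of "L * h"] by (intro mult_left_mono) auto
    also have "\<dots> = m (c + h)" by (simp add: m_def exp_add[symmetric] algebra_simps)
    finally have "c + h \<in> A" using c' h by (auto simp: A_def)
    then show False using c(2) h by fastforce
  qed
  have "((\<lambda>\<rho>. (g 0 + (\<epsilon> + \<rho>) * t) * exp (L * t)) \<longlongrightarrow> (g 0 + (\<epsilon> + 0) * t) * exp (L * t)) (at_right 0)"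
    by (intro tendsto_intros)
  moreover have "\<forall>\<^sub>F \<rho> in at_right 0. g t \<le> (g 0 + (\<epsilon> + \<rho>) * t) * exp (L * t)"
    using main by (auto simp: eventually_at_filter)
  ultimately show ?thesis
    using tendsto_lowerbound[of _ _ "at_right (0::real)"] by fastforce
qed

text \<open>The norm need not be differentiable where \<open>w\<close> vanishes, but its forward
  increments are controlled by those of \<open>w\<close>, which is what the Dini form asks
  for.\<close>

lemma gronwall:
  fixes w :: "real \<Rightarrow> 'a::real_normed_vector"
  assumes deriv: "\<And>t. 0 \<le> t \<Longrightarrow> t \<le> T \<Longrightarrow> (w has_vector_derivative w' t) (at t within {0..T})"
    and bound: "\<And>t. 0 \<le> t \<Longrightarrow> t \<le> T \<Longrightarrow> norm (w' t) \<le> L * norm (w t) + \<epsilon>"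
    and L: "0 \<le> L" and eps: "0 \<le> \<epsilon>" and t: "0 \<le> t" "t \<le> T"
  shows "norm (w t) \<le> (norm (w 0) + \<epsilon> * t) * exp (L * t)"
proof (rule dini_gronwall[where T = T and g = "\<lambda>t. norm (w t)"])
  show "continuous_on {0..T} (\<lambda>t. norm (w t))"
    using deriv by (intro continuous_on_norm continuous_on_vector_derivative) auto
  fix s e :: real
  assume s: "0 \<le> s" "s < T" and e: "0 < e"
  obtain d where d: "d > 0" "\<And>y. y \<in> {0..T} \<Longrightarrow> norm (y - s) < d \<Longrightarrow>
      norm (w y - w s - (y - s) *\<^sub>R w' s) \<le> e * norm (y - s)"
    using deriv[of s] s e unfolding has_vector_derivative_def has_derivative_within_alt by force
  define h where "h = Min {e/2, d/2, T - s}"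
  have h: "0 < h" "h < e" "h < d" "s + h \<le> T" using e d s by (auto simp: h_def min_def)
  have "norm (w (s + h) - w s - h *\<^sub>R w' s) \<le> e * h"
    using d(2)[of "s + h"] h s by simp
  moreover have "norm (w (s + h)) \<le> norm (w (s + h) - w s - h *\<^sub>R w' s) + norm (w s) + norm (h *\<^sub>R w' s)"
    using norm_triangle_ineq[of "w (s + h) - w s - h *\<^sub>R w' s" "w s + h *\<^sub>R w' s"]
      norm_triangle_ineq[of "w s" "h *\<^sub>R w' s"] by simp
  ultimately have "norm (w (s + h)) \<le> norm (w s) + h * norm (w' s) + e * h" using h by simp
  also have "\<dots> \<le> norm (w s) + h * (L * norm (w s) + \<epsilon>) + e * h"
    using bound[of s] s h by (simp add: mult_left_mono)
  finally show "\<exists>h>0. h < e \<and> norm (w (s + h)) \<le> norm (w s) + h * (L * norm (w s) + \<epsilon> + e)"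
    using h by (intro exI[of _ h]) (simp add: algebra_simps)
qed (use assms in auto)

section \<open>Global solutions of Lipschitz equations\<close>

text \<open>Banach's fixed point theorem on the whole interval at once. The unknown is
  \<open>b s = exp (- k * s) *\<^sub>R x s\<close>, which turns the sup metric of bounded continuous
  functions into Bielecki's weighted metric on \<open>x\<close>, so that no short intervals have to
  be glued.\<close>

lemma picard_interval:
  fixes F :: "real \<Rightarrow> 'a::banach \<Rightarrow> 'a"
  assumes T: "0 \<le> T" and L: "0 \<le> L"
    and cont: "continuous_on ({0..T} \<times> UNIV) (\<lambda>(t, x). F t x)"
    and lip: "\<And>t x y. 0 \<le> t \<Longrightarrow> t \<le> T \<Longrightarrow> norm (F t x - F t y) \<le> L * norm (x - y)"
  shows "\<exists>x. x 0 = x0 \<and> (\<forall>t\<in>{0..T}. (x has_vector_derivative F t (x t)) (at t within {0..T}))"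
proof -
  \<comment> \<open>This weight makes \<open>L / k\<close> at most 1/2, the contraction
    constant.\<close>
  define k where "k = 2 * L + 1"
  have k: "0 < k" "L / k \<le> 1/2" using L by (auto simp: k_def field_simps)
  \<comment> \<open>Clamping time to \<open>{0..T}\<close> makes every iterate bounded and
    continuous on the whole line, as the elements of the function space have to be.\<close>
  define c where "c = (\<lambda>t. max 0 (min T t))"
  have c: "c t \<in> {0..T}" for t using T by (auto simp: c_def)
  have cc: "continuous_on UNIV c" unfolding c_def by (intro continuous_intros)
  define I where "I = (\<lambda>(b::real \<Rightarrow>\<^sub>C 'a) s. F s (exp (k * s) *\<^sub>R b s))"
  define H where "H = (\<lambda>b u. exp (- k * u) *\<^sub>R (x0 + integral {0..u} (I b)))"
  have Ic: "continuous_on {0..T} (I b)" for b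
    unfolding I_def
    by (rule continuous_on_compose2[OF cont, of _ "\<lambda>s. (s, exp (k * s) *\<^sub>R b s)", simplified])
       (auto intro!: continuous_intros)
  have Id: "((\<lambda>u. integral {0..u} (I b)) has_vector_derivative I b u) (at u within {0..T})"
    if "u \<in> {0..T}" for b u
    using integral_has_vector_derivative[OF Ic that] .
  have Hc: "continuous_on {0..T} (H b)" for b
    unfolding H_def using Id
    by (intro continuous_intros) (blast intro: continuous_on_vector_derivative)
  define G where "G = (\<lambda>b. H b \<circ> c)"
  have Gb: "G b \<in> bcontfun" for b
  unfolding bcontfun_def
  proof (intro CollectI conjI)
    show "continuous_on UNIV (G b)" unfolding G_def
      using continuous_on_compose[OF cc] Hc[of b] continuous_on_subset c
      by (metis image_subsetI)
    have "G b ` UNIV \<subseteq> H b ` {0..T}" using c by (auto simp: G_def)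
    then show "bounded (range (G b))"
      using compact_imp_bounded[OF compact_continuous_image[OF Hc compact_Icc]] bounded_subset by blast
  qed
  have bound: "dist (Bcontfun (G b)) (Bcontfun (G b')) \<le> (1/2) * dist b b'" for b b'
  proof (rule dist_bound)
    fix t :: real
    define u where "u = c t"
    have u: "0 \<le> u" "u \<le> T" using c[of t] by (auto simp: u_def)
    define D where "D = dist b b'"
    have D: "norm (b s - b' s) \<le> D" for s
      using dist_bounded[of b s b'] by (simp add: D_def dist_norm)
    have sub: "continuous_on {0..u} (I b)" for b by (rule continuous_on_subset[OF Ic]) (use u in auto)
    have "norm (integral {0..u} (I b) - integral {0..u} (I b'))
        = norm (integral {0..u} (\<lambda>s. I b s - I b' s))"
      using sub by (simp add: integral_diff integrable_continuous_real)
    also have "\<dots> \<le> integral {0..u} (\<lambda>s. L * D * exp (k * s))"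
    proof (rule integral_norm_bound_integral)
      fix s assume s: "s \<in> {0..u}"
      have "norm (I b s - I b' s) \<le> L * norm (exp (k * s) *\<^sub>R (b s - b' s))"
        using lip[of s "exp (k * s) *\<^sub>R b s" "exp (k * s) *\<^sub>R b' s"] s u
        by (simp add: I_def scaleR_diff_right)
      also have "\<dots> \<le> L * (exp (k * s) * D)"
        using L D[of s] by (intro mult_left_mono) auto
      finally show "norm (I b s - I b' s) \<le> L * D * exp (k * s)" by (simp add: mult.commute mult.left_commute)
    qed (use sub in \<open>auto intro!: integrable_continuous_real continuous_intros\<close>)
    also have "\<dots> = L * D / k * exp (k * u) - L * D / k"
    proof -
      have "((\<lambda>s. L * D * exp (k * s)) has_integral L * D / k * exp (k * u) - L * D / k * exp (k * 0)) {0..u}"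
        using u k
        by (intro fundamental_theorem_of_calculus)
           (auto intro!: derivative_eq_intros simp flip: has_real_derivative_iff_has_vector_derivative)
      from integral_unique[OF this] show ?thesis by simp
    qed
    also have "\<dots> \<le> L * D / k * exp (k * u)" using L k by (simp add: D_def)
    finally have i: "norm (integral {0..u} (I b) - integral {0..u} (I b')) \<le> L / k * D * exp (k * u)"
      by simp
    have "dist (G b t) (G b' t) = exp (- k * u) * norm (integral {0..u} (I b) - integral {0..u} (I b'))"
      by (simp add: dist_norm G_def H_def u_def scaleR_add_right flip: scaleR_diff_right)
    also have "\<dots> \<le> exp (- k * u) * (L / k * D * exp (k * u))"
      using i by (intro mult_left_mono) auto
    also have "\<dots> = L / k * D" by (simp add: exp_minus field_simps)
    also have "\<dots> \<le> 1/2 * D" using k by (intro mult_right_mono) (auto simp: D_def)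
    finally show "dist (Bcontfun (G b) t) (Bcontfun (G b') t) \<le> (1/2) * dist b b'"
      by (simp add: Bcontfun_inverse Gb D_def)
  qed
  obtain b where b: "Bcontfun (G b) = b"
    using banach_fix_type[of "1/2" "\<lambda>b. Bcontfun (G b)"] bound by auto
  have bH: "b s = H b s" if "s \<in> {0..T}" for s
  proof -
    have "b s = G b s" using b Gb Bcontfun_inverse by metis
    then show ?thesis using that by (auto simp: G_def c_def)
  qed
  define x where "x = (\<lambda>t. x0 + integral {0..t} (I b))"
  have "F t (x t) = I b t" if "t \<in> {0..T}" for t
    using bH[OF that] by (simp add: I_def x_def H_def exp_minus)
  then have "(x has_vector_derivative F t (x t)) (at t within {0..T})" if "t \<in> {0..T}" for t
    using that Id[of t b] unfolding x_def by (auto intro!: derivative_eq_intros)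
  then show ?thesis by (intro exI[of _ x]) (auto simp: x_def)
qed

lemma ode_unique:
  fixes x y :: "real \<Rightarrow> 'a::real_normed_vector"
  assumes x: "\<And>t. 0 \<le> t \<Longrightarrow> t \<le> T \<Longrightarrow> (x has_vector_derivative F t (x t)) (at t within {0..T})"
    and y: "\<And>t. 0 \<le> t \<Longrightarrow> t \<le> T \<Longrightarrow> (y has_vector_derivative F t (y t)) (at t within {0..T})"
    and lip: "\<And>t. 0 \<le> t \<Longrightarrow> t \<le> T \<Longrightarrow> norm (F t (x t) - F t (y t)) \<le> L * norm (x t - y t)"
    and L: "0 \<le> L" and t: "0 \<le> t" "t \<le> T"
  shows "norm (x t - y t) \<le> norm (x 0 - y 0) * exp (L * t)"
  using gronwall[where w = "\<lambda>t. x t - y t" and w' = "\<lambda>t. F t (x t) - F t (y t)" and T = T and L = L and \<epsilon> = 0 and t = t]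
    assms by (auto intro: has_vector_derivative_diff)

lemma picard_global:
  fixes F :: "real \<Rightarrow> 'a::banach \<Rightarrow> 'a"
  assumes cont: "continuous_on ({0..} \<times> UNIV) (\<lambda>(t, x). F t x)"
    and lip: "\<And>T. \<exists>L. \<forall>t\<in>{0..T}. \<forall>x y. norm (F t x - F t y) \<le> L * norm (x - y)"
  shows "\<exists>x. x 0 = x0 \<and> (\<forall>t\<ge>0. (x has_vector_derivative F t (x t)) (at t within {0..}))"
proof -
  have lip': "\<exists>L\<ge>0. \<forall>t\<in>{0..T}. \<forall>x y. norm (F t x - F t y) \<le> L * norm (x - y)" for T
  proof -
    obtain L where L: "\<forall>t\<in>{0..T}. \<forall>x y. norm (F t x - F t y) \<le> L * norm (x - y)" using lip by blast
    show ?thesis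
    proof (intro exI[of _ "max 0 L"] conjI ballI allI)
      fix t x y assume "t \<in> {0..T}"
      then have "norm (F t x - F t y) \<le> L * norm (x - y)" using L by blast
      also have "\<dots> \<le> max 0 L * norm (x - y)" by (intro mult_right_mono) auto
      finally show "norm (F t x - F t y) \<le> max 0 L * norm (x - y)" .
    qed auto
  qed
  have "\<exists>x. x 0 = x0 \<and> (\<forall>t\<in>{0..T}. (x has_vector_derivative F t (x t)) (at t within {0..T}))"
    if T: "T \<ge> 0" for T
  proof -
    obtain L where "L \<ge> 0" "\<forall>t\<in>{0..T}. \<forall>x y. norm (F t x - F t y) \<le> L * norm (x - y)"
      using lip' by blast
    then show ?thesis
      using T by (intro picard_interval[of T L]) (auto intro: continuous_on_subset[OF cont])
  qed
  then obtain X where X: "\<And>T. T \<ge> 0 \<Longrightarrow> X T 0 = x0"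
    "\<And>T t. T \<ge> 0 \<Longrightarrow> t \<in> {0..T} \<Longrightarrow> (X T has_vector_derivative F t (X T t)) (at t within {0..T})"
    by metis
  have eq: "X T t = X T' t" if "0 \<le> t" "t \<le> T" "T \<le> T'" for T T' t
  proof -
    obtain L where L: "L \<ge> 0" "\<forall>t\<in>{0..T}. \<forall>x y. norm (F t x - F t y) \<le> L * norm (x - y)"
      using lip' by blast
    have "norm (X T t - X T' t) \<le> norm (X T 0 - X T' 0) * exp (L * t)"
      using that L X(2)[of T] has_vector_derivative_within_subset[OF X(2)[of T'], of _ "{0..T}"]
      by (intro ode_unique[where F = F and T = T]) auto
    then show ?thesis using X(1) that by simp
  qed
  \<comment> \<open>Any solution on an interval reaching past \<open>t\<close> would give the same
    value. For the derivative at \<open>t\<close> the single function \<open>X (t + 2)\<close> is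
    used: it coincides with \<open>x\<close> at all nonnegative times within distance 1 of
    \<open>t\<close>.\<close>
  define x where "x = (\<lambda>t. X (t + 1) t)"
  have "(x has_vector_derivative F t (x t)) (at t within {0..})" if t: "t \<ge> 0" for t
  proof -
    have "(X (t + 2) has_vector_derivative F t (X (t + 2) t)) (at t within {0..t + 2})"
      using X(2) t by auto
    moreover have "at t within {0..t + 2} = at t within {0..}"
      by (rule at_within_nhd[of _ "{..<t + 2}"]) auto
    ultimately have "(X (t + 2) has_vector_derivative F t (x t)) (at t within {0..})"
      using eq[of t "t + 1" "t + 2"] t by (simp add: x_def)
    then show ?thesis
    proof (rule has_vector_derivative_transform_within[of _ _ _ _ 1])
      fix s assume "s \<in> {0..}" "dist s t < 1"
      then show "X (t + 2) s = x s" unfolding x_def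
        by (intro eq[symmetric]) (auto simp: dist_real_def)
    qed (use t in auto)
  qed
  then show ?thesis using X(1) by (intro exI[of _ x]) (auto simp: x_def)
qed

section \<open>Dependence on parameters and initial data\<close>

lemma continuous_on_tube:
  fixes A :: "real \<Rightarrow> 'z::metric_space \<Rightarrow> 'b::metric_space"
  assumes "continuous_on ({a..b} \<times> W) (\<lambda>(t, z). A t z)" "z0 \<in> W" "0 < e"
  obtains d where "0 < d" "\<And>z s. z \<in> W \<Longrightarrow> dist z z0 < d \<Longrightarrow> s \<in> {a..b} \<Longrightarrow> dist (A s z) (A s z0) \<le> e"
proof -
  have "continuous_on (W \<times> {a..b}) (\<lambda>(z, t). A t z)"
    unfolding case_prod_unfold
    by (rule continuous_on_compose_Pair[OF assms(1)]) (auto intro!: continuous_intros)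
  then obtain X where X: "z0 \<in> X" "open X" "\<forall>x\<in>X \<inter> W. \<forall>t\<in>{a..b}. dist (A t x) (A t z0) \<le> e"
    by (rule continuous_on_prod_compactE[OF _ compact_Icc assms(2,3)]) simp
  then obtain d where "0 < d" "\<And>z. dist z z0 < d \<Longrightarrow> z \<in> X"
    by (auto simp: open_dist)
  then show ?thesis using X(3) that by blast
qed

text \<open>Solutions are constructed separately for each parameter. Gronwall yields continuity in
  the parameter uniformly over bounded times, and together with continuity in time for a fixed
  parameter this gives joint continuity.\<close>

lemma continuous_on_tubeI:
  fixes w :: "real \<Rightarrow> 'z::metric_space \<Rightarrow> 'b::metric_space"
  assumes tube: "\<And>z0 T e. z0 \<in> W \<Longrightarrow> 0 \<le> T \<Longrightarrow> 0 < e \<Longrightarrow>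
      \<exists>d>0. \<forall>z\<in>W. dist z z0 < d \<longrightarrow> (\<forall>s\<in>{0..T}. dist (w s z) (w s z0) \<le> e)"
    and cont: "\<And>z. z \<in> W \<Longrightarrow> continuous_on {0..} (\<lambda>t. w t z)"
  shows "continuous_on ({0..} \<times> W) (\<lambda>(t, z). w t z)"
  unfolding continuous_on_iff
proof (intro ballI allI impI)
  fix x0 :: "real \<times> 'z" and e :: real
  assume "x0 \<in> {0..} \<times> W" and e: "0 < e"
  then obtain t0 z0 where t0: "0 \<le> t0" and z0: "z0 \<in> W" and x0: "x0 = (t0, z0)" by auto
  obtain d1 where d1: "0 < d1" "\<forall>z\<in>W. dist z z0 < d1 \<longrightarrow> (\<forall>s\<in>{0..t0+1}. dist (w s z) (w s z0) \<le> e/2)"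
    using tube[OF z0, of "t0 + 1" "e/2"] t0 e by auto
  obtain d2 where d2: "0 < d2" "\<forall>t\<in>{0..}. dist t t0 < d2 \<longrightarrow> dist (w t z0) (w t0 z0) < e/2"
    using cont[OF z0] t0 e unfolding continuous_on_iff
    by (meson atLeast_iff half_gt_zero_iff)
  show "\<exists>d>0. \<forall>x\<in>{0..} \<times> W. dist x x0 < d \<longrightarrow> dist ((\<lambda>(t, z). w t z) x) ((\<lambda>(t, z). w t z) x0) < e"
  proof (intro exI[of _ "min 1 (min d1 d2)"] conjI impI ballI)
    fix x assume "x \<in> {0..} \<times> W" and "dist x x0 < min 1 (min d1 d2)"
    then obtain t z where x: "x = (t, z)" and t: "0 \<le> t" and z: "z \<in> W"
      and d: "dist (t, z) (t0, z0) < min 1 (min d1 d2)" using x0 by auto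
    have "dist t t0 < min 1 d2" "dist z z0 < d1"
      using d dist_fst_le[of "(t, z)" "(t0, z0)"] dist_snd_le[of "(t, z)" "(t0, z0)"] by auto
    then have "dist (w t z) (w t z0) \<le> e/2" "dist (w t z0) (w t0 z0) < e/2"
      using d1 d2 z t by (auto simp: dist_real_def)
    then have "dist (w t z) (w t0 z0) < e"
      using dist_triangle[of "w t z" "w t0 z0" "w t z0"] by linarith
    then show "dist ((\<lambda>(t, z). w t z) x) ((\<lambda>(t, z). w t z) x0) < e"
      by (simp add: x x0)
  qed (use d1 d2 in auto)
qed

lemma compact_norm_bound:
  fixes f :: "real \<Rightarrow> 'a::real_normed_vector"
  assumes "continuous_on {a..b} f"
  obtains B where "0 < B" "\<And>s. s \<in> {a..b} \<Longrightarrow> norm (f s) \<le> B"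
  using compact_imp_bounded[OF compact_continuous_image[OF assms compact_Icc]]
  by (auto simp: bounded_pos)

text \<open>\<open>prod\<close> is abstract because the lemma serves twice: with composition of
  operators for the variational equation of a flow, and with application of an operator to a vector
  for the conormal equation. Linearity gives a Lipschitz bound on bounded times, hence global
  solutions; Gronwall for the difference of two solutions gives continuity in the parameter.\<close>

lemma linear_ode_param:
  fixes A :: "real \<Rightarrow> 'z::metric_space \<Rightarrow> 'b::real_normed_vector"
    and prod :: "'b \<Rightarrow> 'a::banach \<Rightarrow> 'a"
  assumes prod: "bounded_bilinear prod"
    and cont: "continuous_on ({0..} \<times> W) (\<lambda>(t, z). A t z)"
    and w0: "continuous_on W w0"
  obtains w where "continuous_on ({0..} \<times> W) (\<lambda>(t, z). w t z)" "\<And>z. z \<in> W \<Longrightarrow> w 0 z = w0 z"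
    "\<And>t z. 0 \<le> t \<Longrightarrow> z \<in> W \<Longrightarrow>
       ((\<lambda>s. w s z) has_vector_derivative prod (A t z) (w t z)) (at t within {0..})"
proof -
  interpret prod: bounded_bilinear prod by fact
  obtain K where K: "0 < K" "\<And>a b. norm (prod a b) \<le> norm a * norm b * K"
    using prod.pos_bounded by blast
  have Ac: "continuous_on {0..} (\<lambda>t. A t z)" if "z \<in> W" for z
    by (rule continuous_on_compose2[OF cont, of _ "\<lambda>t. (t, z)", simplified])
       (use that in \<open>auto intro!: continuous_intros\<close>)
  have "\<exists>x. x 0 = w0 z \<and> (\<forall>t\<ge>0. (x has_vector_derivative prod (A t z) (x t)) (at t within {0..}))"
    if z: "z \<in> W" for z
  proof (rule picard_global)
    show "continuous_on ({0..} \<times> UNIV) (\<lambda>(t, x). prod (A t z) x)"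
      unfolding case_prod_unfold using continuous_on_compose2[OF Ac[OF z], of "{0..} \<times> UNIV" fst]
      by (intro prod.continuous_on continuous_on_snd continuous_on_id)
         (simp add: continuous_on_fst image_subset_iff)
    fix T :: real
    obtain B where B: "0 < B" "\<And>s. s \<in> {0..T} \<Longrightarrow> norm (A s z) \<le> B"
      using compact_norm_bound[of 0 T "\<lambda>t. A t z"] continuous_on_subset[OF Ac[OF z]]
      by (metis atLeast_iff atLeastAtMost_iff subsetI)
    show "\<exists>L. \<forall>t\<in>{0..T}. \<forall>x y. norm (prod (A t z) x - prod (A t z) y) \<le> L * norm (x - y)"
    proof (intro exI[of _ "B * K"] ballI allI)
      fix t x y assume t: "t \<in> {0..T}"
      have "norm (prod (A t z) x - prod (A t z) y) \<le> norm (A t z) * norm (x - y) * K"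
        using K(2)[of "A t z" "x - y"] by (simp add: prod.diff_right)
      also have "\<dots> \<le> B * norm (x - y) * K"
        using B t K by (intro mult_right_mono) auto
      finally show "norm (prod (A t z) x - prod (A t z) y) \<le> B * K * norm (x - y)"
        by (simp add: mult_ac)
    qed
  qed
  then obtain x where x: "\<And>z. z \<in> W \<Longrightarrow> x z 0 = w0 z \<and>
      (\<forall>t\<ge>0. (x z has_vector_derivative prod (A t z) (x z t)) (at t within {0..}))"
    by metis
  define w where "w = (\<lambda>t z. x z t)"
  have w: "\<And>z. z \<in> W \<Longrightarrow> w 0 z = w0 z"
    "\<And>t z. 0 \<le> t \<Longrightarrow> z \<in> W \<Longrightarrow>
       ((\<lambda>s. w s z) has_vector_derivative prod (A t z) (w t z)) (at t within {0..})"
    using x by (auto simp: w_def)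
  have wc: "continuous_on {0..} (\<lambda>t. w t z)" if "z \<in> W" for z
    by (rule continuous_on_vector_derivative) (use w that in auto)
  have "continuous_on ({0..} \<times> W) (\<lambda>(t, z). w t z)"
  proof (rule continuous_on_tubeI[OF _ wc])
    fix z0 and T e :: real
    assume z0: "z0 \<in> W" and T: "0 \<le> T" and e: "0 < e"
    obtain B where B: "0 < B" "\<And>s. s \<in> {0..T} \<Longrightarrow> norm (A s z0) \<le> B"
      using compact_norm_bound[of 0 T "\<lambda>t. A t z0"] continuous_on_subset[OF Ac[OF z0]]
      by (metis atLeast_iff atLeastAtMost_iff subsetI)
    obtain C where C: "0 < C" "\<And>s. s \<in> {0..T} \<Longrightarrow> norm (w s z0) \<le> C"
      using compact_norm_bound[of 0 T "\<lambda>t. w t z0"] continuous_on_subset[OF wc[OF z0]]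
      by (metis atLeast_iff atLeastAtMost_iff subsetI)
    define E where "E = exp ((B + 1) * K * T)"
    \<comment> \<open>Chosen so that the Gronwall bound
      \<open>(\<delta> + \<delta> * C * K * T) * E\<close> does not exceed \<open>e\<close>. The cap
      at 1 allows \<open>B + 1\<close> as a bound for the perturbed coefficient.\<close>
    define \<delta> where "\<delta> = min 1 (e / ((1 + C * K * T) * E))"
    have pos: "0 < (1 + C * K * T) * E" using C K T by (auto simp: E_def intro!: mult_pos_pos add_pos_nonneg)
    have \<delta>: "0 < \<delta>" "\<delta> \<le> 1" "\<delta> * ((1 + C * K * T) * E) \<le> e"
    proof -
      have "e / Q * Q = e" if "0 < Q" for Q :: real using that by simp
      from this[OF pos] have "e / ((1 + C * K * T) * E) * ((1 + C * K * T) * E) = e" .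
      moreover have "\<delta> * ((1 + C * K * T) * E) \<le> e / ((1 + C * K * T) * E) * ((1 + C * K * T) * E)"
        using pos by (intro mult_right_mono) (auto simp: \<delta>_def)
      ultimately show "\<delta> * ((1 + C * K * T) * E) \<le> e" by linarith
    qed (use e pos in \<open>auto simp: \<delta>_def\<close>)
    obtain d1 where d1: "0 < d1"
      "\<And>z s. z \<in> W \<Longrightarrow> dist z z0 < d1 \<Longrightarrow> s \<in> {0..T} \<Longrightarrow> dist (A s z) (A s z0) \<le> \<delta>"
      by (rule continuous_on_tube[OF continuous_on_subset[OF cont] z0 \<delta>(1), of 0 T]) auto
    obtain d2 where d2: "0 < d2" "\<And>z. z \<in> W \<Longrightarrow> dist z z0 < d2 \<Longrightarrow> dist (w0 z) (w0 z0) < \<delta>"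
      using w0 z0 \<delta>(1) unfolding continuous_on_iff by metis
    show "\<exists>d>0. \<forall>z\<in>W. dist z z0 < d \<longrightarrow> (\<forall>s\<in>{0..T}. dist (w s z) (w s z0) \<le> e)"
    proof (intro exI[of _ "min d1 d2"] conjI ballI impI)
      fix z s assume z: "z \<in> W" "dist z z0 < min d1 d2" and s: "s \<in> {0..T}"
      have "norm (w s z - w s z0) \<le> (norm (w 0 z - w 0 z0) + \<delta> * C * K * s) * exp ((B + 1) * K * s)"
      proof (rule gronwall[where T = T and w = "\<lambda>s. w s z - w s z0"
            and w' = "\<lambda>s. prod (A s z) (w s z) - prod (A s z0) (w s z0)"])
        fix t assume t: "0 \<le> t" "t \<le> T"
        show "((\<lambda>s. w s z - w s z0) has_vector_derivative prod (A t z) (w t z) - prod (A t z0) (w t z0))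
            (at t within {0..T})"
          using t z z0
          by (intro has_vector_derivative_diff has_vector_derivative_within_subset[OF w(2)]) auto
        have nd: "norm (A t z - A t z0) \<le> \<delta>" using d1(2)[of z t] z t by (simp add: dist_norm)
        have nA: "norm (A t z) \<le> B + 1"
          using nd \<delta> B(2)[of t] t norm_triangle_sub[of "A t z" "A t z0"] by auto
        have "prod (A t z) (w t z) - prod (A t z0) (w t z0)
            = prod (A t z) (w t z - w t z0) + prod (A t z - A t z0) (w t z0)"
          by (simp add: prod.diff_left prod.diff_right)
        then have "norm (prod (A t z) (w t z) - prod (A t z0) (w t z0))
            \<le> norm (A t z) * norm (w t z - w t z0) * K + norm (A t z - A t z0) * norm (w t z0) * K"
          using K(2) norm_triangle_mono by metis
        also have "\<dots> \<le> (B + 1) * norm (w t z - w t z0) * K + \<delta> * C * K"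
          using nA nd C(2)[of t] t K B \<delta>
          by (intro add_mono mult_right_mono mult_mono) auto
        finally show "norm (prod (A t z) (w t z) - prod (A t z0) (w t z0))
            \<le> (B + 1) * K * norm (w t z - w t z0) + \<delta> * C * K"
          by (simp add: mult_ac)
      qed (use B K C \<delta> s in auto)
      also have "\<dots> \<le> (\<delta> + \<delta> * C * K * T) * E"
        using d2(2)[of z] z z0 w(1) s B K C \<delta> T unfolding E_def
        by (intro mult_mono add_mono) (auto simp: dist_norm intro!: add_nonneg_nonneg)
      also have "\<dots> = \<delta> * ((1 + C * K * T) * E)" by (simp add: algebra_simps)
      finally show "dist (w s z) (w s z0) \<le> e" using \<delta> by (simp add: dist_norm)
    qed (use d1 d2 in auto)
  qed auto
  then show ?thesis using that w by blast
qed

section \<open>Differentiability of a flow in its initial value\<close>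

text \<open>The candidate \<open>M\<close> solves the variational equation. The remainder \<theta>
  of the first-order expansion starts at 0 and satisfies a linear differential inequality whose
  source is proportional to \<open>\<omega> * norm (z - z0)\<close> with \<omega> as small as
  desired, so Gronwall makes it of smaller order than \<open>norm (z - z0)\<close>.\<close>

lemma flow_has_derivative:
  fixes f :: "real \<Rightarrow> 'e::banach \<Rightarrow> 'e" and f' :: "real \<Rightarrow> 'e \<Rightarrow> 'e \<Rightarrow>\<^sub>L 'e"
  assumes D: "open D" and W: "open W"
    and deriv: "\<And>t z. 0 \<le> t \<Longrightarrow> z \<in> D \<Longrightarrow> (f t has_derivative f' t z) (at z)"
    and f'c: "continuous_on ({0..} \<times> D) (\<lambda>(t, z). f' t z)"
    and \<Phi>c: "continuous_on ({0..} \<times> W) (\<lambda>(t, z). \<Phi> t z)"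
    and \<Phi>0: "\<And>z. z \<in> W \<Longrightarrow> \<Phi> 0 z = z"
    and \<Phi>D: "\<And>t z. 0 \<le> t \<Longrightarrow> z \<in> W \<Longrightarrow> \<Phi> t z \<in> D"
    and \<Phi>': "\<And>t z. 0 \<le> t \<Longrightarrow> z \<in> W \<Longrightarrow>
        ((\<lambda>s. \<Phi> s z) has_vector_derivative f t (\<Phi> t z)) (at t within {0..})"
  obtains M where "continuous_on ({0..} \<times> W) (\<lambda>(t, z). M t z)"
    "\<And>z. z \<in> W \<Longrightarrow> M 0 z = id_blinfun"
    "\<And>t z. 0 \<le> t \<Longrightarrow> z \<in> W \<Longrightarrow>
        ((\<lambda>s. M s z) has_vector_derivative f' t (\<Phi> t z) o\<^sub>L M t z) (at t within {0..})"
    "\<And>t z. 0 \<le> t \<Longrightarrow> z \<in> W \<Longrightarrow> (\<Phi> t has_derivative blinfun_apply (M t z)) (at z)"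
proof -
  have Ac: "continuous_on ({0..} \<times> W) (\<lambda>(t, z). f' t (\<Phi> t z))"
    unfolding case_prod_unfold using \<Phi>c \<Phi>D
    by (intro continuous_on_compose_Pair[OF f'c]) (auto simp: case_prod_unfold intro!: continuous_intros)
  obtain M where Mc: "continuous_on ({0..} \<times> W) (\<lambda>(t, z). M t z)"
    and M0: "\<And>z. z \<in> W \<Longrightarrow> M 0 z = id_blinfun"
    and M': "\<And>t z. 0 \<le> t \<Longrightarrow> z \<in> W \<Longrightarrow>
        ((\<lambda>s. M s z) has_vector_derivative f' t (\<Phi> t z) o\<^sub>L M t z) (at t within {0..})"
    by (rule linear_ode_param[OF bounded_bilinear_blinfun_compose Ac, of "\<lambda>_. id_blinfun"])
       (auto intro: continuous_intros)
  have "(\<Phi> T has_derivative blinfun_apply (M T z0)) (at z0)" if T: "0 \<le> T" and z0: "z0 \<in> W" for T z0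
    unfolding has_derivative_at_alt
  proof (intro conjI allI impI)
    fix e :: real assume e: "0 < e"
    have c1: "continuous_on {0..} (\<lambda>t. \<Phi> t z0)" "continuous_on {0..} (\<lambda>t. M t z0)"
      by (rule continuous_on_vector_derivative; use \<Phi>' M' z0 in fastforce)+
    have c2: "continuous_on {0..} (\<lambda>t. f' t (\<Phi> t z0))"
      by (rule continuous_on_compose2[OF Ac, of _ "\<lambda>t. (t, z0)", simplified])
         (use z0 in \<open>auto intro!: continuous_intros\<close>)
    obtain B where B: "0 < B" "\<And>s. s \<in> {0..T} \<Longrightarrow> norm (f' s (\<Phi> s z0)) \<le> B"
      using compact_norm_bound[OF continuous_on_subset[OF c2], of 0 T] by auto
    obtain C where C: "0 < C" "\<And>s. s \<in> {0..T} \<Longrightarrow> norm (M s z0) \<le> C"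
      using compact_norm_bound[OF continuous_on_subset[OF c1(2)], of 0 T] by auto
    \<comment> \<open>The factor that Gronwall puts in front of
      \<open>\<omega> * norm (z - z0)\<close>; \<omega> is then taken so small that
      \<open>\<omega> * E \<le> e\<close>.\<close>
    define E where "E = C * T * exp ((B + 1) * T)"
    have E: "0 \<le> E" using C T by (auto simp: E_def)
    define \<omega> where "\<omega> = min 1 (e / (E + 1))"
    have "e / (E + 1) * E \<le> e" using e E by (simp add: field_simps)
    moreover have "\<omega> * E \<le> e / (E + 1) * E" using E by (intro mult_right_mono) (auto simp: \<omega>_def)
    ultimately have \<omega>: "0 < \<omega>" "\<omega> \<le> 1" "\<omega> * E \<le> e" using e E by (auto simp: \<omega>_def)
    \<comment> \<open>The reference trajectory up to time \<open>T\<close> is compact, so one radius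
      \<open>r\<close> keeps all its perturbations inside \<open>D\<close>.\<close>
    have "compact ((\<lambda>t. \<Phi> t z0) ` {0..T})"
      by (intro compact_continuous_image continuous_on_subset[OF c1(1)]) auto
    moreover have "(\<lambda>t. \<Phi> t z0) ` {0..T} \<subseteq> D" using \<Phi>D z0 by auto
    ultimately obtain r where r: "0 < r" "(\<Union>x\<in>(\<lambda>t. \<Phi> t z0) ` {0..T}. ball x r) \<subseteq> D"
      using compact_subset_open_imp_ball_epsilon_subset D by blast
    have inD: "\<Phi> s z0 + k \<in> D" if "s \<in> {0..T}" "norm k < r" for s k
    proof -
      have "\<Phi> s z0 + k \<in> ball (\<Phi> s z0) r" using that by (simp add: dist_norm)
      then show ?thesis using r(2) that by blast
    qed
    have "continuous_on ({0..T} \<times> ball 0 r) (\<lambda>x. \<Phi> (fst x) z0)"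
      by (rule continuous_on_compose2[OF c1(1)]) (auto intro!: continuous_intros)
    then have "continuous_on ({0..T} \<times> ball 0 r) (\<lambda>(s, k). f' s (\<Phi> s z0 + k))"
      unfolding case_prod_unfold using inD
      by (intro continuous_on_compose_Pair[OF f'c]) (auto intro!: continuous_intros)
    then obtain d where d: "0 < d" "\<And>k s. norm k < r \<Longrightarrow> norm k < d \<Longrightarrow> s \<in> {0..T} \<Longrightarrow>
        norm (f' s (\<Phi> s z0 + k) - f' s (\<Phi> s z0)) \<le> \<omega>"
      by (rule continuous_on_tube[of 0 T "ball 0 r" "\<lambda>s k. f' s (\<Phi> s z0 + k)" 0 \<omega>])
         (use r \<omega> in \<open>simp_all add: dist_norm\<close>)
    obtain d' where d': "0 < d'"
      "\<And>z s. z \<in> W \<Longrightarrow> dist z z0 < d' \<Longrightarrow> s \<in> {0..T} \<Longrightarrow> dist (\<Phi> s z) (\<Phi> s z0) \<le> min r d / 2"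
      by (rule continuous_on_tube[OF continuous_on_subset[OF \<Phi>c] z0, of 0 T "min r d / 2"])
         (use r d in auto)
    obtain d'' where d'': "0 < d''" "\<And>z. dist z z0 < d'' \<Longrightarrow> z \<in> W"
      using W z0 by (auto simp: open_dist)
    show "\<exists>d>0. \<forall>z. norm (z - z0) < d \<longrightarrow> norm (\<Phi> T z - \<Phi> T z0 - M T z0 (z - z0)) \<le> e * norm (z - z0)"
    proof (intro exI[of _ "min d' d''"] conjI allI impI)
      fix z assume "norm (z - z0) < min d' d''"
      then have z: "z \<in> W" "dist z z0 < d'" using d'' by (auto simp: dist_norm)
      define \<theta> where "\<theta> = (\<lambda>s. \<Phi> s z - \<Phi> s z0 - M s z0 (z - z0))"
      have "norm (\<theta> T) \<le> (norm (\<theta> 0) + \<omega> * C * norm (z - z0) * T) * exp ((B + 1) * T)"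
      proof (rule gronwall[where T = T and w' =
            "\<lambda>s. f s (\<Phi> s z) - f s (\<Phi> s z0) - f' s (\<Phi> s z0) (M s z0 (z - z0))"])
        fix s assume s: "0 \<le> s" "s \<le> T"
        have "((\<lambda>s. M s z0 (z - z0)) has_vector_derivative (f' s (\<Phi> s z0) o\<^sub>L M s z0) (z - z0))
            (at s within {0..T})"
          by (rule bounded_linear.has_vector_derivative[OF blinfun.bounded_linear_left])
             (rule has_vector_derivative_within_subset[OF M'], use s z0 in auto)
        then show "(\<theta> has_vector_derivative f s (\<Phi> s z) - f s (\<Phi> s z0) - f' s (\<Phi> s z0) (M s z0 (z - z0)))
            (at s within {0..T})"
          unfolding \<theta>_def using s z z0
          by (intro has_vector_derivative_diff has_vector_derivative_within_subset[OF \<Phi>']) auto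
        define k where "k = \<Phi> s z - \<Phi> s z0"
        have k: "norm k < min r d"
          using d'(2)[OF z, of s] s r d by (simp add: k_def dist_norm)
        \<comment> \<open>The mean value inequality on a ball around the reference point: the ball
          is convex even if \<open>D\<close> is not, and on it \<open>f' s\<close> differs from its
          value at the centre by at most \<omega>.\<close>
        have Z: "norm (f s (\<Phi> s z) - f s (\<Phi> s z0) - f' s (\<Phi> s z0) (\<Phi> s z - \<Phi> s z0))
            \<le> norm (\<Phi> s z - \<Phi> s z0) * \<omega>"
        proof (rule differentiable_bound_linearization[where S = "ball (\<Phi> s z0) (min r d)"
              and f' = "\<lambda>x. blinfun_apply (f' s x)" and ?x0.0 = "\<Phi> s z0"])
          fix t :: real assume t: "t \<in> {0..1}"
          have "norm (t *\<^sub>R k) \<le> norm k" using t by (auto intro: mult_left_le_one_le)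
          then show "\<Phi> s z0 + t *\<^sub>R (\<Phi> s z - \<Phi> s z0) \<in> ball (\<Phi> s z0) (min r d)"
            using k by (simp add: k_def dist_norm)
        next
          fix x assume x: "x \<in> ball (\<Phi> s z0) (min r d)"
          then have *: "norm (x - \<Phi> s z0) < min r d" by (simp add: dist_norm norm_minus_commute)
          then have "x \<in> D" using inD[of s "x - \<Phi> s z0"] s by simp
          then show "(f s has_derivative f' s x) (at x within ball (\<Phi> s z0) (min r d))"
            using deriv s has_derivative_at_withinI by blast
          have eq: "blinfun_apply (f' s x) - blinfun_apply (f' s (\<Phi> s z0)) = blinfun_apply (f' s x - f' s (\<Phi> s z0))"
            by (simp add: fun_eq_iff blinfun.diff_left)
          show "onorm (blinfun_apply (f' s x) - blinfun_apply (f' s (\<Phi> s z0))) \<le> \<omega>"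
            unfolding eq norm_blinfun.rep_eq[symmetric] using d(2)[of "x - \<Phi> s z0" s] * s by simp
        qed (use r d in auto)
        have k_le: "norm k \<le> norm (\<theta> s) + C * norm (z - z0)"
        proof -
          have "norm k \<le> norm (\<theta> s) + norm (M s z0 (z - z0))"
            using norm_triangle_ineq[of "\<theta> s" "M s z0 (z - z0)"] by (simp add: \<theta>_def k_def)
          also have "norm (M s z0 (z - z0)) \<le> C * norm (z - z0)"
            by (rule order_trans[OF norm_blinfun mult_right_mono]) (use C(2)[of s] s in auto)
          finally show ?thesis by simp
        qed
        have "f s (\<Phi> s z) - f s (\<Phi> s z0) - f' s (\<Phi> s z0) (M s z0 (z - z0))
            = (f s (\<Phi> s z) - f s (\<Phi> s z0) - f' s (\<Phi> s z0) k) + f' s (\<Phi> s z0) (\<theta> s)"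
          by (simp add: \<theta>_def k_def blinfun.diff_right)
        then have "norm (f s (\<Phi> s z) - f s (\<Phi> s z0) - f' s (\<Phi> s z0) (M s z0 (z - z0)))
            \<le> norm (f s (\<Phi> s z) - f s (\<Phi> s z0) - f' s (\<Phi> s z0) k) + norm (f' s (\<Phi> s z0) (\<theta> s))"
          by (metis norm_triangle_ineq)
        also have "\<dots> \<le> norm k * \<omega> + B * norm (\<theta> s)"
        proof (rule add_mono)
          show "norm (f' s (\<Phi> s z0) (\<theta> s)) \<le> B * norm (\<theta> s)"
            by (rule order_trans[OF norm_blinfun mult_right_mono]) (use B(2)[of s] s in auto)
        qed (use Z in \<open>simp add: k_def\<close>)
        also have "\<dots> \<le> (norm (\<theta> s) + C * norm (z - z0)) * \<omega> + B * norm (\<theta> s)"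
          using k_le \<omega> by (intro add_mono mult_right_mono) auto
        also have "\<dots> \<le> norm (\<theta> s) * 1 + C * norm (z - z0) * \<omega> + B * norm (\<theta> s)"
          using \<omega> mult_left_mono[of \<omega> 1 "norm (\<theta> s)"] by (simp add: algebra_simps)
        finally show "norm (f s (\<Phi> s z) - f s (\<Phi> s z0) - f' s (\<Phi> s z0) (M s z0 (z - z0)))
            \<le> (B + 1) * norm (\<theta> s) + \<omega> * C * norm (z - z0)"
          by (simp add: algebra_simps)
      qed (use B C \<omega> T in auto)
      also have "\<theta> 0 = 0" using \<Phi>0 M0 z z0 by (simp add: \<theta>_def)
      also have "(norm (0::'e) + \<omega> * C * norm (z - z0) * T) * exp ((B + 1) * T) = \<omega> * E * norm (z - z0)"
        by (simp add: E_def)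
      also have "\<dots> \<le> e * norm (z - z0)" using \<omega> by (intro mult_right_mono) auto
      finally show "norm (\<Phi> T z - \<Phi> T z0 - M T z0 (z - z0)) \<le> e * norm (z - z0)"
        by (simp add: \<theta>_def)
    qed (use d' d'' in auto)
  qed (rule blinfun.bounded_linear_right)
  from that[OF Mc M0 M' this] show ?thesis .
qed

text \<open>Partial derivatives in time and space combine to a total one once the spatial derivative
  is jointly continuous. The criterion wants a convex spatial set, so \<open>W\<close> is first
  replaced by a ball, which does not change the filter at the point.\<close>

lemma has_derivative_time_space:
  fixes \<Phi> :: "real \<Rightarrow> 'e::real_normed_vector \<Rightarrow> 'f::real_normed_vector"
  assumes W: "open W" and t: "0 \<le> t" and z: "z \<in> W"
    and \<Phi>': "((\<lambda>s. \<Phi> s z) has_vector_derivative \<Phi>t) (at t within {0..})"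
    and M: "\<And>t z. 0 \<le> t \<Longrightarrow> z \<in> W \<Longrightarrow> (\<Phi> t has_derivative blinfun_apply (M t z)) (at z)"
    and Mc: "continuous_on ({0..} \<times> W) (\<lambda>(t, z). M t z)"
  shows "((\<lambda>(t, z). \<Phi> t z) has_derivative (\<lambda>(a, h). a *\<^sub>R \<Phi>t + M t z h)) (at (t, z) within {0..} \<times> W)"
proof -
  obtain r where r: "0 < r" "ball z r \<subseteq> W" using W z by (auto simp: open_contains_ball)
  have "((\<lambda>(t, z). \<Phi> t z) has_derivative (\<lambda>(a, h). a *\<^sub>R \<Phi>t + M t z h)) (at (t, z) within {0..} \<times> ball z r)"
  proof (rule has_derivative_partialsI)
    show "((\<lambda>s. \<Phi> s z) has_derivative (\<lambda>a. a *\<^sub>R \<Phi>t)) (at t within {0..})"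
      using \<Phi>' by (simp add: has_vector_derivative_def)
    show "(\<Phi> s has_derivative blinfun_apply (M s y)) (at y within ball z r)" if "s \<in> {0..}" "y \<in> ball z r" for s y
      using that r by (intro has_derivative_at_withinI[OF M]) auto
    have "continuous_on ({0..} \<times> ball z r) (\<lambda>(t, z). M t z)"
      using r by (intro continuous_on_subset[OF Mc]) auto
    then show "continuous (at (t, z) within {0..} \<times> ball z r) (\<lambda>(t, z). M t z)"
      using t r by (auto simp: continuous_on_eq_continuous_within)
  qed (use r in auto)
  moreover have "at (t, z) within {0..} \<times> ball z r = at (t, z) within {0..} \<times> W"
    using r by (intro at_within_nhd[of _ "UNIV \<times> ball z r"]) (auto intro: open_Times)
  ultimately show ?thesis by simp
qed

section \<open>The flow inside the domain\<close>

text \<open>McShane's formula \<open>INF y\<in>K. f t y + L * dist x y\<close> keeps the constant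
  \<open>L\<close>. Compactness of \<open>K\<close> gives continuity in time, since \<open>f\<close>
  then changes uniformly over \<open>K\<close>. The extension lets Picard iteration run before it is
  known that solutions stay where the velocity is given.\<close>

lemma lipschitz_time_extension:
  fixes f :: "real \<Rightarrow> 'a::metric_space \<Rightarrow> real"
  assumes K: "compact K" "K \<noteq> {}"
    and cont: "continuous_on ({0..} \<times> K) (\<lambda>(t, x). f t x)"
    and lip: "\<And>t. 0 \<le> t \<Longrightarrow> L-lipschitz_on K (f t)"
  obtains g where "continuous_on ({0..} \<times> UNIV) (\<lambda>(t, x). g t x)"
    "\<And>t. 0 \<le> t \<Longrightarrow> L-lipschitz_on UNIV (g t)" "\<And>t x. 0 \<le> t \<Longrightarrow> x \<in> K \<Longrightarrow> g t x = f t x"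
proof -
  have L: "0 \<le> L" using lip[of 0] lipschitz_on_nonneg by blast
  define g where "g = (\<lambda>t x. INF y\<in>K. f t y + L * dist x y)"
  have bdd: "bdd_below ((\<lambda>y. f t y + L * dist x y) ` K)" if t: "0 \<le> t" for t x
  proof -
    have "continuous_on K (f t)" using lip[OF t] lipschitz_on_continuous_on by blast
    then have "bdd_below (f t ` K)"
      using K by (intro bounded_imp_bdd_below compact_imp_bounded compact_continuous_image)
    then obtain m where "\<And>y. y \<in> K \<Longrightarrow> m \<le> f t y" by (auto simp: bdd_below_def)
    then show ?thesis
      using L by (intro bdd_belowI2[of _ m]) (auto intro: add_increasing2)
  qed
  have le: "g t x \<le> f t y + L * dist x y" if "0 \<le> t" "y \<in> K" for t x y
    unfolding g_def using bdd that by (intro cINF_lower) auto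
  have g1: "g t x \<le> g t x' + L * dist x x'" if t: "0 \<le> t" for t x x'
  proof -
    have "g t x - L * dist x x' \<le> g t x'"
      unfolding g_def
    proof (rule cINF_greatest)
      fix y assume y: "y \<in> K"
      have "L * dist x y \<le> L * (dist x x' + dist x' y)"
        using L dist_triangle by (intro mult_left_mono) auto
      then show "(INF y\<in>K. f t y + L * dist x y) - L * dist x x' \<le> f t y + L * dist x' y"
        using le[OF t y, of x] by (simp add: g_def algebra_simps)
    qed (use K in auto)
    then show ?thesis by simp
  qed
  have glip: "L-lipschitz_on UNIV (g t)" if "0 \<le> t" for t
  proof (rule lipschitz_onI[OF _ L])
    fix x y
    show "dist (g t x) (g t y) \<le> L * dist x y"
      using g1[OF that, of x y] g1[OF that, of y x]
      by (simp add: dist_real_def abs_le_iff dist_commute[of y x])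
  qed
  have "continuous_on ({0..} \<times> UNIV) (\<lambda>(t, x). g t x)"
  proof (rule continuous_on_tubeI)
    fix z0 :: 'a and T e :: real assume e: "0 < e"
    show "\<exists>d>0. \<forall>z\<in>UNIV. dist z z0 < d \<longrightarrow> (\<forall>s\<in>{0..T}. dist (g s z) (g s z0) \<le> e)"
    proof (intro exI[of _ "e / (L + 1)"] conjI ballI impI)
      fix z s assume z: "dist z z0 < e / (L + 1)" and s: "s \<in> {0..T}"
      have "dist (g s z) (g s z0) \<le> L * dist z z0"
        using glip[of s] s by (auto simp: lipschitz_on_def)
      also have "\<dots> \<le> (L + 1) * dist z z0" by (simp add: algebra_simps)
      also have "\<dots> \<le> e" using z L by (simp add: field_simps)
      finally show "dist (g s z) (g s z0) \<le> e" .
    qed (use e L in auto)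
  next
    fix x :: 'a
    show "continuous_on {0..} (\<lambda>t. g t x)"
      unfolding continuous_on_iff
    proof (intro ballI allI impI)
      fix t0 e :: real assume t0: "t0 \<in> {0..}" and e: "0 < e"
      obtain X where X: "t0 \<in> X" "open X" "\<forall>t\<in>X \<inter> {0..}. \<forall>y\<in>K. dist (f t y) (f t0 y) \<le> e / 2"
        by (rule continuous_on_prod_compactE[OF cont K(1) t0, of "e/2"]) (use e in simp_all)
      obtain d where d: "0 < d" "\<And>t. dist t t0 < d \<Longrightarrow> t \<in> X" using X by (auto simp: open_dist)
      show "\<exists>d>0. \<forall>t\<in>{0..}. dist t t0 < d \<longrightarrow> dist (g t x) (g t0 x) < e"
      proof (intro exI[of _ d] conjI ballI impI)
        fix t assume t: "t \<in> {0..}" "dist t t0 < d"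
        have f: "\<bar>f t y - f t0 y\<bar> \<le> e / 2" if "y \<in> K" for y
          using X(3) d(2)[OF t(2)] t that by (auto simp: dist_real_def)
        have "g t x - e/2 \<le> g t0 x"
          unfolding g_def
        proof (rule cINF_greatest)
          fix y assume y: "y \<in> K"
          show "(INF y\<in>K. f t y + L * dist x y) - e/2 \<le> f t0 y + L * dist x y"
            using le[of t y x, unfolded g_def] abs_le_D1[OF f[OF y]] abs_le_D2[OF f[OF y]] t y by simp
        qed (use K in auto)
        moreover have "g t0 x - e/2 \<le> g t x"
          unfolding g_def
        proof (rule cINF_greatest)
          fix y assume y: "y \<in> K"
          show "(INF y\<in>K. f t0 y + L * dist x y) - e/2 \<le> f t y + L * dist x y"
            using le[of t0 y x, unfolded g_def] abs_le_D1[OF f[OF y]] abs_le_D2[OF f[OF y]] t0 y by simp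
        qed (use K in auto)
        ultimately show "dist (g t x) (g t0 x) < e" using e by (simp add: dist_real_def abs_le_iff)
      qed (use d in auto)
    qed
  qed
  moreover have "g t x = f t x" if t: "0 \<le> t" and x: "x \<in> K" for t x
  proof (rule antisym)
    show "g t x \<le> f t x" using le[OF t x, of x] by simp
    have "\<bar>f t x - f t y\<bar> \<le> L * dist x y" if "y \<in> K" for y
      using lip[OF t] that x by (auto simp: lipschitz_on_def dist_real_def)
    then show "f t x \<le> g t x"
      unfolding g_def using K by (intro cINF_greatest) (auto simp: abs_le_iff algebra_simps)
  qed
  ultimately show ?thesis using that glip by blast
qed

text \<open>The extension is componentwise, and bounding the norm by the l1 norm costs the dimension
  factor. This is harmless: the extended field is used only for global existence, while the
  quantitative estimates use \<open>v\<close> itself on the closure of the domain.\<close>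

lemma lipschitz_time_extension_vec:
  fixes v :: "real \<Rightarrow> 'a::metric_space \<Rightarrow> real^'n"
  assumes K: "compact K" "K \<noteq> {}"
    and cont: "continuous_on ({0..} \<times> K) (\<lambda>(t, x). v t x)"
    and lip: "\<And>t. 0 \<le> t \<Longrightarrow> L-lipschitz_on K (v t)"
  obtains V where "continuous_on ({0..} \<times> UNIV) (\<lambda>(t, x). V t x)"
    "\<And>t x y. 0 \<le> t \<Longrightarrow> norm (V t x - V t y) \<le> (real (CARD('n)) * L) * dist x y"
    "\<And>t x. 0 \<le> t \<Longrightarrow> x \<in> K \<Longrightarrow> V t x = v t x"
proof -
  have "\<exists>g. continuous_on ({0..} \<times> UNIV) (\<lambda>(t, x). g t x) \<and>
      (\<forall>t\<ge>0. L-lipschitz_on UNIV (g t)) \<and> (\<forall>t\<ge>0. \<forall>x\<in>K. g t x = v t x $ i)" for i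
  proof (rule lipschitz_time_extension[OF K, of "\<lambda>t x. v t x $ i" L])
    show "continuous_on ({0..} \<times> K) (\<lambda>(t, x). v t x $ i)"
      using continuous_on_component[OF cont, of i] by (simp add: case_prod_unfold)
    show "L-lipschitz_on K (\<lambda>x. v t x $ i)" if "0 \<le> t" for t
    proof (rule lipschitz_onI)
      fix x y assume "x \<in> K" "y \<in> K"
      then have "dist (v t x) (v t y) \<le> L * dist x y" using lip[OF that] by (auto simp: lipschitz_on_def)
      then show "dist (v t x $ i) (v t y $ i) \<le> L * dist x y"
        using dist_vec_nth_le[of "v t x" i "v t y"] by simp
    qed (use lip[OF that] in \<open>auto simp: lipschitz_on_def\<close>)
  qed blast
  then obtain g where g: "\<And>i. continuous_on ({0..} \<times> UNIV) (\<lambda>(t, x). g i t x)"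
      "\<And>i t. 0 \<le> t \<Longrightarrow> L-lipschitz_on UNIV (g i t)"
      "\<And>i t x. 0 \<le> t \<Longrightarrow> x \<in> K \<Longrightarrow> g i t x = v t x $ i"
    by metis
  define V where "V = (\<lambda>t x. \<chi> i. g i t x)"
  show ?thesis
  proof (rule that[of V])
    show "continuous_on ({0..} \<times> UNIV) (\<lambda>(t, x). V t x)"
      unfolding V_def case_prod_unfold using g(1)
      by (intro continuous_on_vec_lambda) (simp add: case_prod_unfold)
    show "V t x = v t x" if "0 \<le> t" "x \<in> K" for t x
      using g(3) that by (simp add: V_def vec_eq_iff)
    fix t x y assume t: "(0::real) \<le> t"
    have "norm (V t x - V t y) \<le> (\<Sum>i\<in>UNIV. \<bar>g i t x - g i t y\<bar>)"
      using norm_le_l1_cart[of "V t x - V t y"] by (simp add: V_def)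
    also have "\<dots> \<le> (\<Sum>i\<in>(UNIV :: 'n set). L * dist x y)"
      using g(2)[OF t] by (intro sum_mono) (auto simp: lipschitz_on_def dist_real_def)
    finally show "norm (V t x - V t y) \<le> (real (CARD('n)) * L) * dist x y" by simp
  qed
qed

section \<open>Invariance of the domain under the flow\<close>

text \<open>A liminf only produces arbitrarily small \<open>h\<close> with a small quotient, not all
  small \<open>h\<close>. The existential step hypothesis of \<open>dini_gronwall\<close> is
  tailored to this.\<close>

lemma tangent_cone_frequently:
  assumes "z \<in> tangent_cone S x" "0 < e" "0 < d"
  obtains h where "0 < h" "h < d" "infdist (x + h *\<^sub>R z) S \<le> h * e"
proof -
  have "\<exists>h. 0 < h \<and> h < d \<and> infdist (x + h *\<^sub>R z) S / h < e"
  proof (rule ccontr)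
    assume "\<not> ?thesis"
    then have "\<forall>\<^sub>F h in at_right 0. ereal e \<le> ereal (infdist (x + h *\<^sub>R z) S / h)"
      using \<open>0 < d\<close> by (intro eventually_at_rightI[of 0 d]) (fastforce simp: not_less)+
    from Liminf_bounded[OF this] show False
      using assms(1,2) by (simp add: tangent_cone_def)
  qed
  then show ?thesis using that by (fastforce simp: field_simps)
qed

text \<open>Run backwards in time from a contact point, the distance to the boundary satisfies a Dini
  differential inequality with initial value zero.\<close>

lemma frontier_backward_invariant:
  fixes x :: "real \<Rightarrow> real^3"
  assumes v: "\<And>t. 0 \<le> t \<Longrightarrow> L-lipschitz_on (closure \<Omega>) (v t)"
    and H2: "H2 \<Omega> v"
    and x: "\<And>t. 0 \<le> t \<Longrightarrow> t \<le> T \<Longrightarrow> x t \<in> closure \<Omega>"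
    and x': "\<And>t. 0 \<le> t \<Longrightarrow> t \<le> T \<Longrightarrow> (x has_vector_derivative v t (x t)) (at t within {0..T})"
    and T: "0 \<le> T" and xT: "x T \<in> frontier \<Omega>"
  shows "x 0 \<in> frontier \<Omega>"
proof -
  define K where "K = frontier \<Omega>"
  have K: "closed K" "K \<noteq> {}" "K \<subseteq> closure \<Omega>" using xT by (auto simp: K_def frontier_def)
  have L: "0 \<le> L" using v[of 0] by (auto simp: lipschitz_on_def)
  have xc: "continuous_on {0..T} x" using x' by (intro continuous_on_vector_derivative) auto
  have "infdist (x (T - T)) K \<le> (infdist (x (T - 0)) K + 0 * T) * exp (L * T)"
  proof (rule dini_gronwall[where g = "\<lambda>s. infdist (x (T - s)) K"])
    have "continuous_on {0..T} (\<lambda>s. x (T - s))"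
      by (rule continuous_on_compose2[OF xc]) (auto intro!: continuous_intros)
    then show "continuous_on {0..T} (\<lambda>s. infdist (x (T - s)) K)"
      by (rule continuous_on_infdist)
    fix s e :: real assume s: "0 \<le> s" "s < T" and e: "0 < e"
    define t where "t = T - s"
    have t: "0 < t" "t \<le> T" using s by (auto simp: t_def)
    \<comment> \<open>A nearest boundary point. Moved along \<open>- v t k\<close> it stays close to
      the boundary for suitable small \<open>h\<close>, and the trajectory run backwards is compared
      with it.\<close>
    obtain k where k: "k \<in> K" "infdist (x t) K = dist (x t) k"
      using infdist_attains_inf[OF K(1,2)] by metis
    have "- v t k \<in> tangent_cone K k"
      using H2 k t unfolding H2_def K_def by auto
    obtain d where d: "0 < d" "\<And>y. y \<in> {0..T} \<Longrightarrow> norm (y - t) < d \<Longrightarrow>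
        norm (x y - x t - (y - t) *\<^sub>R v t (x t)) \<le> (e/2) * norm (y - t)"
      using x'[of t] t e unfolding has_vector_derivative_def has_derivative_within_alt
      by (metis half_gt_zero less_eq_real_def)
    obtain h where h: "0 < h" "h < min e (min d t)"
        and hK: "infdist (k + h *\<^sub>R (- v t k)) K \<le> h * (e/2)"
      using tangent_cone_frequently[OF \<open>- v t k \<in> tangent_cone K k\<close>, of "e/2" "min e (min d t)"] e d t by auto
    have a: "norm (x (t - h) - x t + h *\<^sub>R v t (x t)) \<le> (e/2) * h"
      using d(2)[of "t - h"] h t by simp
    have b: "norm (v t (x t) - v t k) \<le> L * norm (x t - k)"
      using v[of t] t x[of t] k K(3) by (auto simp: lipschitz_on_def dist_norm)
    \<comment> \<open>The three errors are the linearization of \<open>x\<close> at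
      \<open>t\<close>, the distance already present at \<open>t\<close>, and the Lipschitz
      difference of the velocities at \<open>x t\<close> and \<open>k\<close>.\<close>
    have "x (t - h) - (k + h *\<^sub>R (- v t k))
        = (x (t - h) - x t + h *\<^sub>R v t (x t)) + ((x t - k) - h *\<^sub>R (v t (x t) - v t k))"
      by (simp add: algebra_simps)
    then have "dist (x (t - h)) (k + h *\<^sub>R (- v t k))
        \<le> norm (x (t - h) - x t + h *\<^sub>R v t (x t)) + norm ((x t - k) - h *\<^sub>R (v t (x t) - v t k))"
      by (metis dist_norm norm_triangle_ineq)
    also have "norm ((x t - k) - h *\<^sub>R (v t (x t) - v t k)) \<le> norm (x t - k) + h * norm (v t (x t) - v t k)"
      using norm_triangle_ineq4[of "x t - k" "h *\<^sub>R (v t (x t) - v t k)"] h by simp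
    also have "h * norm (v t (x t) - v t k) \<le> h * (L * norm (x t - k))"
      using b h by (intro mult_left_mono) auto
    finally have "dist (x (t - h)) (k + h *\<^sub>R (- v t k)) \<le> (e/2) * h + (norm (x t - k) + h * (L * norm (x t - k)))"
      using a by simp
    then have "infdist (x (t - h)) K \<le> infdist (x t) K + h * (L * infdist (x t) K + 0 + e)"
      using infdist_triangle[of "x (t - h)" K "k + h *\<^sub>R (- v t k)"] hK k(2)
      by (simp add: dist_norm algebra_simps)
    then show "\<exists>h>0. h < e \<and> infdist (x (T - (s + h))) K
        \<le> infdist (x (T - s)) K + h * (L * infdist (x (T - s)) K + 0 + e)"
      using h by (intro exI[of _ h]) (simp add: t_def algebra_simps)
  qed (use L T in \<open>auto intro: infdist_nonneg\<close>)
  moreover have "infdist (x T) K = 0" using xT by (simp add: K_def)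
  ultimately have "infdist (x 0) K = 0" using infdist_nonneg[of "x 0" K] by simp
  then show ?thesis using in_closed_iff_infdist_zero[OF K(1,2)] by (simp add: K_def)
qed

text \<open>A solution of the extended field is followed to its first exit time from \<Omega>. Up to
  then it lies in the closure, where the extension agrees with \<open>v\<close>; the exit point
  would be on the boundary, and \<open>frontier_backward_invariant\<close> would put the initial
  point there too. Uniqueness of solutions then evaluates the definite description in
  \<open>flow\<close>.\<close>

lemma flow_in_domain:
  fixes \<Omega> :: "(real^3) set"
  assumes "bounded \<Omega>" "open \<Omega>" "H1 \<Omega> v" "H2 \<Omega> v"
  obtains L where "0 \<le> L"
    "\<And>\<xi>. \<xi> \<in> \<Omega> \<Longrightarrow> flow \<Omega> v 0 0 \<xi> = \<xi>"
    "\<And>t \<xi>. 0 \<le> t \<Longrightarrow> \<xi> \<in> \<Omega> \<Longrightarrow> flow \<Omega> v t 0 \<xi> \<in> \<Omega>"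
    "\<And>t \<xi>. 0 \<le> t \<Longrightarrow> \<xi> \<in> \<Omega> \<Longrightarrow>
       ((\<lambda>s. flow \<Omega> v s 0 \<xi>) has_vector_derivative v t (flow \<Omega> v t 0 \<xi>)) (at t within {0..})"
    "\<And>t \<xi> \<xi>'. 0 \<le> t \<Longrightarrow> \<xi> \<in> \<Omega> \<Longrightarrow> \<xi>' \<in> \<Omega> \<Longrightarrow>
       norm (flow \<Omega> v t 0 \<xi> - flow \<Omega> v t 0 \<xi>') \<le> norm (\<xi> - \<xi>') * exp (L * t)"
    "\<And>t. 0 \<le> t \<Longrightarrow> inj_on (flow \<Omega> v t 0) \<Omega>"
proof -
  obtain L where L: "\<And>t. 0 \<le> t \<Longrightarrow> L-lipschitz_on (closure \<Omega>) (v t)"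
    using \<open>H1 \<Omega> v\<close> unfolding H1_def by blast
  have vc: "continuous_on ({0..} \<times> closure \<Omega>) (\<lambda>(t, x). v t x)"
    using \<open>H1 \<Omega> v\<close> unfolding H1_def by blast
  have L0: "0 \<le> L" using L[of 0] by (auto simp: lipschitz_on_def)
  have lip: "norm (v t x - v t y) \<le> L * norm (x - y)" if "0 \<le> t" "x \<in> closure \<Omega>" "y \<in> closure \<Omega>" for t x y
    using L[of t] that by (auto simp: lipschitz_on_def dist_norm)
  have "\<exists>x. x 0 = \<xi> \<and> (\<forall>t\<ge>0. x t \<in> \<Omega> \<and> (x has_vector_derivative v t (x t)) (at t within {0..}))"
    if \<xi>: "\<xi> \<in> \<Omega>" for \<xi>
  proof -
    have "compact (closure \<Omega>)" "closure \<Omega> \<noteq> {}" using \<open>bounded \<Omega>\<close> \<xi> by auto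
    from lipschitz_time_extension_vec[OF this vc L]
    obtain V where V: "continuous_on ({0..} \<times> UNIV) (\<lambda>(t, x). V t x)"
      "\<And>t x y. 0 \<le> t \<Longrightarrow> norm (V t x - V t y) \<le> (real (CARD(3)) * L) * dist x y"
      "\<And>t x. 0 \<le> t \<Longrightarrow> x \<in> closure \<Omega> \<Longrightarrow> V t x = v t x"
      by blast
    have "\<exists>x. x 0 = \<xi> \<and> (\<forall>t\<ge>0. (x has_vector_derivative V t (x t)) (at t within {0..}))"
    proof (rule picard_global[OF V(1)])
      show "\<exists>L. \<forall>t\<in>{0..T}. \<forall>x y. norm (V t x - V t y) \<le> L * norm (x - y)" for T
        using V(2) by (intro exI[of _ "real (CARD(3)) * L"]) (auto simp: dist_norm)
    qed
    then obtain x where x: "x 0 = \<xi>" "\<And>t. 0 \<le> t \<Longrightarrow> (x has_vector_derivative V t (x t)) (at t within {0..})"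
      by blast
    have xc: "continuous_on {0..} x" using x(2) by (intro continuous_on_vector_derivative) auto
    have "x t \<in> \<Omega>" if t: "0 \<le> t" for t
    proof (rule ccontr)
      assume "x t \<notin> \<Omega>"
      define A where "A = {0..t} \<inter> x -` (- \<Omega>)"
      have "closed A" unfolding A_def
        using \<open>open \<Omega>\<close> by (intro continuous_closed_preimage continuous_on_subset[OF xc]) auto
      then have "compact A"
        by (auto simp: compact_eq_bounded_closed A_def intro: bounded_subset[OF bounded_closed_interval[of 0 t]])
      moreover have "t \<in> A" using \<open>x t \<notin> \<Omega>\<close> t by (simp add: A_def)
      ultimately obtain T where T: "T \<in> A" "\<And>s. s \<in> A \<Longrightarrow> T \<le> s"
        using compact_attains_inf[of A] by blast
      then have T': "0 \<le> T" "x T \<notin> \<Omega>" "\<And>s. 0 \<le> s \<Longrightarrow> s < T \<Longrightarrow> x s \<in> \<Omega>" by (force simp: A_def)+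
      have "T \<noteq> 0" using T'(2) x \<xi> by auto
      then have "0 < T" using T' by simp
      have "x T \<in> closure \<Omega>"
      proof -
        have "x ` closure {0..<T} \<subseteq> closure \<Omega>"
        proof (rule image_closure_subset)
          show "continuous_on (closure {0..<T}) x"
            using \<open>0 < T\<close> by (auto intro: continuous_on_subset[OF xc])
          show "x ` {0..<T} \<subseteq> closure \<Omega>"
            by (auto intro!: subsetD[OF closure_subset] T'(3))
        qed simp
        then show ?thesis using \<open>0 < T\<close> by auto
      qed
      then have "x s \<in> closure \<Omega>" if "0 \<le> s" "s \<le> T" for s
        using T'(3)[of s] that closure_subset[of \<Omega>] by (cases "s = T") auto
      moreover from this have "(x has_vector_derivative v s (x s)) (at s within {0..T})" if "0 \<le> s" "s \<le> T" for s
        using has_vector_derivative_within_subset[OF x(2), of s "{0..T}"] V(3)[of s "x s"] that by auto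
      moreover have "x T \<in> frontier \<Omega>"
        using \<open>x T \<in> closure \<Omega>\<close> T'(2) \<open>open \<Omega>\<close> by (simp add: frontier_def interior_open)
      ultimately have "x 0 \<in> frontier \<Omega>"
        using frontier_backward_invariant[OF L \<open>H2 \<Omega> v\<close>, of T x] T'(1) by blast
      then show False using x(1) \<xi> \<open>open \<Omega>\<close> by (simp add: frontier_def interior_open)
    qed
    then show ?thesis
      using x V(3) closure_subset[of \<Omega>] by (metis subset_eq)
  qed
  then obtain Y where Y: "\<And>\<xi>. \<xi> \<in> \<Omega> \<Longrightarrow> Y \<xi> 0 = \<xi>" "\<And>t \<xi>. 0 \<le> t \<Longrightarrow> \<xi> \<in> \<Omega> \<Longrightarrow> Y \<xi> t \<in> \<Omega>"
    "\<And>t \<xi>. 0 \<le> t \<Longrightarrow> \<xi> \<in> \<Omega> \<Longrightarrow> (Y \<xi> has_vector_derivative v t (Y \<xi> t)) (at t within {0..})"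
    by metis
  have sol: "solution \<Omega> v (Y \<xi>)" if "\<xi> \<in> \<Omega>" for \<xi>
    using Y that closure_subset[of \<Omega>] by (auto simp: solution_def)
  have uniq: "norm (x t - y t) \<le> norm (x 0 - y 0) * exp (L * t)"
    if "solution \<Omega> v x" "solution \<Omega> v y" "0 \<le> t" for x y t
  proof (rule ode_unique[where T = t and F = v])
    show "(x has_vector_derivative v s (x s)) (at s within {0..t})" if "0 \<le> s" "s \<le> t" for s
      using \<open>solution \<Omega> v x\<close> that has_vector_derivative_within_subset[of x _ s "{0..}" "{0..t}"]
      by (auto simp: solution_def)
    show "(y has_vector_derivative v s (y s)) (at s within {0..t})" if "0 \<le> s" "s \<le> t" for s
      using \<open>solution \<Omega> v y\<close> that has_vector_derivative_within_subset[of y _ s "{0..}" "{0..t}"]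
      by (auto simp: solution_def)
  qed (use that lip L0 in \<open>auto simp: solution_def\<close>)
  have flow: "flow \<Omega> v t 0 \<xi> = Y \<xi> t" if t: "0 \<le> t" and \<xi>: "\<xi> \<in> \<Omega>" for t \<xi>
    unfolding flow_def
  proof (rule the_equality)
    show "\<exists>x. solution \<Omega> v x \<and> x 0 = \<xi> \<and> x t = Y \<xi> t" using sol Y \<xi> by blast
    show "y = Y \<xi> t" if ex: "\<exists>x. solution \<Omega> v x \<and> x 0 = \<xi> \<and> x t = y" for y
    proof -
      obtain x where x: "solution \<Omega> v x" "x 0 = \<xi>" "x t = y" using ex by blast
      show ?thesis using uniq[OF x(1) sol[OF \<xi>] t] x Y(1)[OF \<xi>] by simp
    qed
  qed
  have inj: "\<xi> = \<xi>'" if t: "0 \<le> t" and \<xi>: "\<xi> \<in> \<Omega>" "\<xi>' \<in> \<Omega>" and eq: "Y \<xi> t = Y \<xi>' t" for t \<xi> \<xi>'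
  proof -
    \<comment> \<open>Gronwall runs forwards, so time is reversed from \<open>t\<close>:
      trajectories that meet at time \<open>t\<close> have a difference that starts at 0.\<close>
    define w where "w = (\<lambda>s. Y \<xi> (t - s) - Y \<xi>' (t - s))"
    have "norm (w t) \<le> (norm (w 0) + 0 * t) * exp (L * t)"
    proof (rule gronwall[where T = t and w' = "\<lambda>s. - (v (t - s) (Y \<xi> (t - s)) - v (t - s) (Y \<xi>' (t - s)))"])
      fix s assume s: "0 \<le> s" "s \<le> t"
      have "((\<lambda>s. Y \<xi> s - Y \<xi>' s) has_vector_derivative v (t - s) (Y \<xi> (t - s)) - v (t - s) (Y \<xi>' (t - s)))
          (at (t - s) within (-) t ` {0..t})"
        using s \<xi> by (intro has_vector_derivative_diff has_vector_derivative_within_subset[OF Y(3)]) auto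
      moreover have "((-) t has_vector_derivative - 1) (at s within {0..t})"
        by (auto intro!: derivative_eq_intros)
      ultimately have "((\<lambda>s. Y \<xi> s - Y \<xi>' s) \<circ> (-) t has_vector_derivative
          (- 1) *\<^sub>R (v (t - s) (Y \<xi> (t - s)) - v (t - s) (Y \<xi>' (t - s)))) (at s within {0..t})"
        by (intro vector_diff_chain_within) auto
      then show "(w has_vector_derivative - (v (t - s) (Y \<xi> (t - s)) - v (t - s) (Y \<xi>' (t - s)))) (at s within {0..t})"
        by (simp add: w_def o_def)
      show "norm (- (v (t - s) (Y \<xi> (t - s)) - v (t - s) (Y \<xi>' (t - s)))) \<le> L * norm (w s) + 0"
      proof -
        have "Y \<xi> (t - s) \<in> closure \<Omega>" "Y \<xi>' (t - s) \<in> closure \<Omega>"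
          using s \<xi> by (auto intro!: subsetD[OF closure_subset] Y(2))
        then show ?thesis
          using lip[of "t - s" "Y \<xi> (t - s)" "Y \<xi>' (t - s)"] s
          by (simp add: w_def norm_minus_commute)
      qed
    qed (use L0 t in auto)
    then show ?thesis using eq Y(1) \<xi> by (simp add: w_def)
  qed
  show ?thesis
  proof (rule that[OF L0])
    show "flow \<Omega> v 0 0 \<xi> = \<xi>" if "\<xi> \<in> \<Omega>" for \<xi> using that flow Y by auto
    show "inj_on (flow \<Omega> v t 0) \<Omega>" if "0 \<le> t" for t
      using inj[OF that] flow[OF that] by (auto simp: inj_on_def)
    fix t \<xi> assume *: "(0::real) \<le> t" "\<xi> \<in> \<Omega>"
    show "flow \<Omega> v t 0 \<xi> \<in> \<Omega>" using * flow Y by auto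
    have "((\<lambda>s. flow \<Omega> v s 0 \<xi>) has_vector_derivative v t (Y \<xi> t)) (at t within {0..})"
      by (rule has_vector_derivative_transform[OF _ _ Y(3)[OF *]]) (use * flow in auto)
    then show "((\<lambda>s. flow \<Omega> v s 0 \<xi>) has_vector_derivative v t (flow \<Omega> v t 0 \<xi>)) (at t within {0..})"
      using flow * by simp
    show "norm (flow \<Omega> v t 0 \<xi> - flow \<Omega> v t 0 \<xi>') \<le> norm (\<xi> - \<xi>') * exp (L * t)" if "\<xi>' \<in> \<Omega>" for \<xi>'
      using uniq[OF sol sol, of \<xi> \<xi>' t] flow Y(1) * that by simp
  qed
qed

section \<open>Functions of class C1\<close>

lemma C1_on_subset:
  assumes "C1_on S f" "T \<subseteq> S"
  shows "C1_on T f"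
proof -
  obtain f' where "\<And>x. x \<in> S \<Longrightarrow> (f has_derivative blinfun_apply (f' x)) (at x within S)" "continuous_on S f'"
    using assms(1) unfolding C1_on_def by blast
  then show ?thesis
    unfolding C1_on_def using assms(2) continuous_on_subset has_derivative_subset
    by (intro exI[of _ f']) blast
qed

lemma C1_on_continuous_on:
  assumes "C1_on S f"
  shows "continuous_on S f"
proof -
  obtain f' where "\<And>x. x \<in> S \<Longrightarrow> (f has_derivative blinfun_apply (f' x)) (at x within S)"
    using assms unfolding C1_on_def by blast
  then show ?thesis by (rule has_derivative_continuous_on)
qed

lemma C1_on_cong:
  assumes "C1_on S f" "\<And>x. x \<in> S \<Longrightarrow> f x = g x"
  shows "C1_on S g"
  using assms unfolding C1_on_def by (metis has_derivative_transform)

lemma C1_on_bounded_linear: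
  assumes "bounded_linear f"
  shows "C1_on S f"
  unfolding C1_on_def
  by (intro exI[of _ "\<lambda>_. Blinfun f"])
     (auto simp: bounded_linear_Blinfun_apply[OF assms] intro: bounded_linear.has_derivative[OF assms] has_derivative_ident continuous_intros)

lemma C1_on_const: "C1_on S (\<lambda>_. c)"
  unfolding C1_on_def by (intro exI[of _ "\<lambda>_. 0"]) (auto intro: continuous_intros simp: zero_blinfun.rep_eq)

lemma C1_on_compose:
  assumes g: "C1_on T g" and f: "C1_on S f" and sub: "\<And>x. x \<in> S \<Longrightarrow> f x \<in> T"
  shows "C1_on S (\<lambda>x. g (f x))"
proof -
  obtain f' where f': "\<And>x. x \<in> S \<Longrightarrow> (f has_derivative blinfun_apply (f' x)) (at x within S)" "continuous_on S f'"
    using f unfolding C1_on_def by blast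
  obtain g' where g': "\<And>x. x \<in> T \<Longrightarrow> (g has_derivative blinfun_apply (g' x)) (at x within T)" "continuous_on T g'"
    using g unfolding C1_on_def by blast
  show ?thesis
    unfolding C1_on_def
  proof (intro exI[of _ "\<lambda>x. g' (f x) o\<^sub>L f' x"] conjI ballI)
    fix x assume x: "x \<in> S"
    have "((\<lambda>x. g (f x)) has_derivative (\<lambda>h. g' (f x) (f' x h))) (at x within S)"
      using sub x by (intro has_derivative_in_compose2[OF g'(1) _ _ f'(1)]) auto
    then show "((\<lambda>x. g (f x)) has_derivative blinfun_apply (g' (f x) o\<^sub>L f' x)) (at x within S)"
      by (rule has_derivative_eq_rhs) (simp add: fun_eq_iff)
  next
    have "continuous_on S (\<lambda>x. g' (f x))"
      using C1_on_continuous_on[OF f] sub by (intro continuous_on_compose2[OF g'(2)]) auto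
    then show "continuous_on S (\<lambda>x. g' (f x) o\<^sub>L f' x)"
      using f'(2) by (rule bounded_bilinear.continuous_on[OF bounded_bilinear_blinfun_compose])
  qed
qed

lemma C1_on_bounded_bilinear:
  fixes prod :: "'a::real_normed_vector \<Rightarrow> 'b::real_normed_vector \<Rightarrow> 'c::real_normed_vector"
  assumes prod: "bounded_bilinear prod" and f: "C1_on S f" and g: "C1_on S g"
  shows "C1_on S (\<lambda>x. prod (f x) (g x))"
proof -
  interpret prod: bounded_bilinear prod by fact
  obtain f' where f': "\<And>x. x \<in> S \<Longrightarrow> (f has_derivative blinfun_apply (f' x)) (at x within S)" "continuous_on S f'"
    using f unfolding C1_on_def by blast
  obtain g' where g': "\<And>x. x \<in> S \<Longrightarrow> (g has_derivative blinfun_apply (g' x)) (at x within S)" "continuous_on S g'"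
    using g unfolding C1_on_def by blast
  show ?thesis
    unfolding C1_on_def
  proof (intro exI[of _ "\<lambda>x. (prod.prod_right (f x) o\<^sub>L g' x) + (prod.prod_left (g x) o\<^sub>L f' x)"] conjI ballI)
    fix x assume x: "x \<in> S"
    show "((\<lambda>x. prod (f x) (g x)) has_derivative
        blinfun_apply ((prod.prod_right (f x) o\<^sub>L g' x) + (prod.prod_left (g x) o\<^sub>L f' x))) (at x within S)"
      by (rule has_derivative_eq_rhs[OF prod.FDERIV[OF f'(1)[OF x] g'(1)[OF x]]])
         (simp add: fun_eq_iff blinfun.add_left prod.prod_right.rep_eq prod.prod_left.rep_eq)
  next
    show "continuous_on S (\<lambda>x. (prod.prod_right (f x) o\<^sub>L g' x) + (prod.prod_left (g x) o\<^sub>L f' x))"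
      using C1_on_continuous_on[OF f] C1_on_continuous_on[OF g] f'(2) g'(2)
      by (intro continuous_on_add bounded_bilinear.continuous_on[OF bounded_bilinear_blinfun_compose]
            bounded_linear.continuous_on[OF prod.bounded_linear_prod_right]
            bounded_linear.continuous_on[OF prod.bounded_linear_prod_left])
  qed
qed

lemma C1_on_add:
  assumes "C1_on S f" "C1_on S g"
  shows "C1_on S (\<lambda>x. f x + g x)"
proof -
  obtain f' where f': "\<And>x. x \<in> S \<Longrightarrow> (f has_derivative blinfun_apply (f' x)) (at x within S)" "continuous_on S f'"
    using assms(1) unfolding C1_on_def by blast
  obtain g' where g': "\<And>x. x \<in> S \<Longrightarrow> (g has_derivative blinfun_apply (g' x)) (at x within S)" "continuous_on S g'"
    using assms(2) unfolding C1_on_def by blast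
  show ?thesis
    unfolding C1_on_def
    by (intro exI[of _ "\<lambda>x. f' x + g' x"] conjI ballI continuous_on_add f'(2) g'(2))
       (auto intro!: has_derivative_eq_rhs[OF has_derivative_add[OF f'(1) g'(1)]] simp: fun_eq_iff blinfun.add_left)
qed

lemma C1_on_Pair:
  assumes "C1_on S f" "C1_on S g"
  shows "C1_on S (\<lambda>x. (f x, g x))"
proof -
  have "C1_on S (\<lambda>x. (f x, 0))" "C1_on S (\<lambda>x. (0, g x))"
    by (rule C1_on_compose[where T = UNIV and g = "\<lambda>a. (a, 0)"] C1_on_compose[where T = UNIV and g = "\<lambda>a. (0, a)"];
        auto intro!: C1_on_bounded_linear bounded_linear_intros assms)+
  from C1_on_add[OF this] show ?thesis by simp
qed

lemmas C1_on_linear_comp = C1_on_compose[where T = UNIV, OF C1_on_bounded_linear, simplified]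

lemma C1_on_inverse: "C1_on (- {0}) (inverse :: real \<Rightarrow> real)"
  unfolding C1_on_def
proof (intro exI[of _ "\<lambda>x. blinfun_mult_left (- (inverse x * inverse x))"] conjI ballI)
  fix x :: real assume "x \<in> - {0}"
  then show "(inverse has_derivative blinfun_apply (blinfun_mult_left (- (inverse x * inverse x)))) (at x within - {0})"
    by (auto intro!: derivative_eq_intros simp: fun_eq_iff)
qed (intro bounded_linear.continuous_on[OF bounded_linear_blinfun_mult_left] continuous_intros; simp)

lemma C1_on_norm: "C1_on (- {0}) (norm :: 'a::real_inner \<Rightarrow> real)"
  unfolding C1_on_def
proof (intro exI[of _ "\<lambda>x. blinfun_inner_right (sgn x)"] conjI ballI)
  fix x :: 'a assume "x \<in> - {0}"
  then show "(norm has_derivative blinfun_apply (blinfun_inner_right (sgn x))) (at x within - {0})"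
    by (auto intro!: has_derivative_at_withinI[OF has_derivative_eq_rhs[OF has_derivative_norm]]
        simp: fun_eq_iff blinfun_inner_right.rep_eq inner_commute)
qed (intro bounded_linear.continuous_on[OF bounded_linear_blinfun_inner_right] continuous_intros; simp)

text \<open>The hypothesis on \<open>v\<close> speaks of partial derivatives, whereas the flow
  lemmas need Frechet derivatives. The increment is telescoped along the coordinate axes, and each
  single step is compared with \<open>d j x0\<close> by the mean value inequality.\<close>

lemma has_derivative_continuous_partials:
  fixes f :: "real^'n \<Rightarrow> 'b::real_normed_vector"
  assumes S: "open S" and x0: "x0 \<in> S"
    and part: "\<And>x i. x \<in> S \<Longrightarrow> ((\<lambda>h. f (x + h *\<^sub>R axis i 1)) has_vector_derivative d i x) (at 0)"
    and cont: "\<And>i. continuous_on S (d i)"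
  shows "(f has_derivative (\<lambda>h. \<Sum>i\<in>UNIV. h $ i *\<^sub>R d i x0)) (at x0)"
  unfolding has_derivative_at_alt
proof (intro conjI allI impI)
  show "bounded_linear (\<lambda>h. \<Sum>i\<in>UNIV. h $ i *\<^sub>R d i x0)"
    by (intro bounded_linear_sum bounded_linear_scaleR_const bounded_linear_vec_nth)
  fix e' :: real assume e': "0 < e'"
  \<comment> \<open>The sum of the absolute values of the coordinates is at most
    \<open>CARD('n)\<close> times the norm.\<close>
  define e where "e = e' / CARD('n)"
  have e: "0 < e" using e' by (simp add: e_def)
  have "\<exists>\<delta>>0. \<forall>x. dist x x0 < \<delta> \<longrightarrow> x \<in> S \<and> norm (d i x - d i x0) \<le> e" for i
  proof -
    obtain r where r: "0 < r" "\<And>x. dist x x0 < r \<Longrightarrow> x \<in> S" using S x0 by (auto simp: open_dist)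
    obtain r' where r': "0 < r'" "\<And>x. x \<in> S \<Longrightarrow> dist x x0 < r' \<Longrightarrow> dist (d i x) (d i x0) < e"
      using cont[of i] x0 e unfolding continuous_on_iff by metis
    show ?thesis
      using r r' by (intro exI[of _ "min r r'"]) (auto simp: dist_norm intro: less_imp_le)
  qed
  then obtain \<Delta> where \<Delta>: "\<And>i. 0 < \<Delta> i" "\<And>i x. dist x x0 < \<Delta> i \<Longrightarrow> x \<in> S \<and> norm (d i x - d i x0) \<le> e"
    by metis
  define \<delta> where "\<delta> = Min (range \<Delta>)"
  have \<delta>: "0 < \<delta>" "\<And>i x. dist x x0 < \<delta> \<Longrightarrow> x \<in> S" "\<And>i x. dist x x0 < \<delta> \<Longrightarrow> norm (d i x - d i x0) \<le> e"
    using \<Delta> by (auto simp: \<delta>_def)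
  have step: "norm (f (z + c *\<^sub>R axis j 1) - f z - c *\<^sub>R d j x0) \<le> e * \<bar>c\<bar>"
    if z: "dist z x0 < \<delta>" "dist (z + c *\<^sub>R axis j 1) x0 < \<delta>" for z c j
  proof -
    have inb: "dist (z + t *\<^sub>R axis j 1) x0 < \<delta>" if "t \<in> closed_segment 0 c" for t
    proof -
      obtain u where u: "0 \<le> u" "u \<le> 1" "t = u * c" using \<open>t \<in> closed_segment 0 c\<close> by (auto simp: in_segment)
      have "(1 - u) *\<^sub>R z + u *\<^sub>R (z + c *\<^sub>R axis j 1) \<in> ball x0 \<delta>"
        using z u by (intro convexD[OF convex_ball]) (auto simp: dist_commute)
      also have "(1 - u) *\<^sub>R z + u *\<^sub>R (z + c *\<^sub>R axis j 1) = z + t *\<^sub>R axis j 1"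
        by (simp add: u algebra_simps)
      finally show ?thesis by (simp add: dist_commute)
    qed
    \<comment> \<open>Subtracting the linear part leaves the derivative
      \<open>d j (z + t *\<^sub>R axis j 1) - d j x0\<close>, which is at most \<open>e\<close> in
      norm on the ball.\<close>
    define g where "g = (\<lambda>t. f (z + t *\<^sub>R axis j 1) - t *\<^sub>R d j x0)"
    have "norm (g c - g 0) \<le> e * norm (c - 0)"
    proof (rule differentiable_bound[where S = "closed_segment 0 c"
          and f' = "\<lambda>t y. y *\<^sub>R (d j (z + t *\<^sub>R axis j 1) - d j x0)"])
      fix t assume t: "t \<in> closed_segment 0 c"
      have "((\<lambda>h. f ((z + t *\<^sub>R axis j 1) + h *\<^sub>R axis j 1)) has_vector_derivative d j (z + t *\<^sub>R axis j 1)) (at (t - t))"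
        using part[of "z + t *\<^sub>R axis j 1" j] \<delta>(2)[OF inb[OF t]] by simp
      moreover have "((\<lambda>s. s - t) has_vector_derivative 1) (at t)"
        by (auto intro!: derivative_eq_intros)
      ultimately have "((\<lambda>h. f ((z + t *\<^sub>R axis j 1) + h *\<^sub>R axis j 1)) \<circ> (\<lambda>s. s - t) has_vector_derivative
          1 *\<^sub>R d j (z + t *\<^sub>R axis j 1)) (at t)"
        by (intro vector_diff_chain_at) auto
      then have "((\<lambda>s. f (z + s *\<^sub>R axis j 1)) has_vector_derivative d j (z + t *\<^sub>R axis j 1)) (at t)"
        by (simp add: o_def algebra_simps)
      then have "(g has_vector_derivative (d j (z + t *\<^sub>R axis j 1) - d j x0)) (at t)"
        unfolding g_def by (auto intro!: derivative_eq_intros)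
      then show "(g has_derivative (\<lambda>y. y *\<^sub>R (d j (z + t *\<^sub>R axis j 1) - d j x0))) (at t within closed_segment 0 c)"
        by (simp add: has_vector_derivative_def has_derivative_at_withinI)
      show "onorm (\<lambda>y. y *\<^sub>R (d j (z + t *\<^sub>R axis j 1) - d j x0)) \<le> e"
      proof (rule onorm_bound)
        fix y :: real
        have "\<bar>y\<bar> * norm (d j (z + t *\<^sub>R axis j 1) - d j x0) \<le> \<bar>y\<bar> * e"
          using \<delta>(3)[OF inb[OF t]] by (intro mult_left_mono) auto
        then show "norm (y *\<^sub>R (d j (z + t *\<^sub>R axis j 1) - d j x0)) \<le> e * norm y"
          by (simp add: mult.commute)
      qed (use e in auto)
    qed auto
    then show ?thesis by (simp add: g_def algebra_simps)
  qed
  \<comment> \<open>Induction on a set of coordinates outside which \<open>h\<close> vanishes.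
    Deleting a coordinate does not increase the norm, so the intermediate points stay in the
    ball.\<close>
  have claim: "norm (f (x0 + h) - f x0 - (\<Sum>i\<in>I. h $ i *\<^sub>R d i x0)) \<le> e * (\<Sum>i\<in>I. \<bar>h $ i\<bar>)"
    if "finite I" "norm h < \<delta>" "\<forall>i. i \<notin> I \<longrightarrow> h $ i = 0" for I h
    using that
  proof (induction I arbitrary: h rule: finite_induct)
    case empty
    then have "h = 0" by (simp add: vec_eq_iff)
    then show ?case by simp
  next
    case (insert j I)
    define h' where "h' = (\<chi> i. if i = j then 0 else h $ i)"
    have "norm h' \<le> norm h" by (rule norm_le_componentwise_cart) (auto simp: h'_def)
    then have h': "norm h' < \<delta>" using insert.prems by simp
    have IH: "norm (f (x0 + h') - f x0 - (\<Sum>i\<in>I. h' $ i *\<^sub>R d i x0)) \<le> e * (\<Sum>i\<in>I. \<bar>h' $ i\<bar>)"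
      using insert.prems h' by (intro insert.IH) (auto simp: h'_def)
    have s: "(\<Sum>i\<in>I. h' $ i *\<^sub>R d i x0) = (\<Sum>i\<in>I. h $ i *\<^sub>R d i x0)" "(\<Sum>i\<in>I. \<bar>h' $ i\<bar>) = (\<Sum>i\<in>I. \<bar>h $ i\<bar>)"
      using insert.hyps by (auto intro!: sum.cong simp: h'_def)
    have hh: "h = h' + (h $ j) *\<^sub>R axis j 1" by (auto simp: vec_eq_iff h'_def axis_def)
    have "norm (f (x0 + h' + (h $ j) *\<^sub>R axis j 1) - f (x0 + h') - (h $ j) *\<^sub>R d j x0) \<le> e * \<bar>h $ j\<bar>"
    proof (rule step)
      show "dist (x0 + h') x0 < \<delta>" using h' by (simp add: dist_norm)
      show "dist (x0 + h' + (h $ j) *\<^sub>R axis j 1) x0 < \<delta>"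
        using insert.prems(1) by (simp add: dist_norm add.assoc flip: hh)
    qed
    then have "norm ((f (x0 + h) - f (x0 + h') - (h $ j) *\<^sub>R d j x0)
        + (f (x0 + h') - f x0 - (\<Sum>i\<in>I. h $ i *\<^sub>R d i x0))) \<le> e * \<bar>h $ j\<bar> + e * (\<Sum>i\<in>I. \<bar>h $ i\<bar>)"
      using IH by (intro norm_triangle_mono) (simp_all add: s add.assoc flip: hh)
    then show ?case using insert.hyps by (simp add: algebra_simps)
  qed
  show "\<exists>\<delta>>0. \<forall>y. norm (y - x0) < \<delta> \<longrightarrow> norm (f y - f x0 - (\<Sum>i\<in>UNIV. (y - x0) $ i *\<^sub>R d i x0)) \<le> e' * norm (y - x0)"
  proof (intro exI[of _ \<delta>] conjI allI impI)
    fix y assume y: "norm (y - x0) < \<delta>"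
    have "norm (f (x0 + (y - x0)) - f x0 - (\<Sum>i\<in>UNIV. (y - x0) $ i *\<^sub>R d i x0)) \<le> e * (\<Sum>i\<in>UNIV. \<bar>(y - x0) $ i\<bar>)"
      using y by (intro claim) auto
    also have "\<dots> \<le> e * (\<Sum>i\<in>(UNIV::'n set). norm (y - x0))"
      using e by (intro mult_left_mono sum_mono component_le_norm_cart) auto
    also have "\<dots> = e' * norm (y - x0)" by (simp add: e_def)
    finally show "norm (f y - f x0 - (\<Sum>i\<in>UNIV. (y - x0) $ i *\<^sub>R d i x0)) \<le> e' * norm (y - x0)" by simp
  qed (use \<delta> in auto)
qed

section \<open>The flow and its conormal equation\<close>

lemma C1_on_time_space:
  fixes \<Phi> :: "real \<Rightarrow> 'e::real_normed_vector \<Rightarrow> 'f::real_normed_vector"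
  assumes W: "open W"
    and \<Phi>': "\<And>t z. 0 \<le> t \<Longrightarrow> z \<in> W \<Longrightarrow> ((\<lambda>s. \<Phi> s z) has_vector_derivative \<Phi>t t z) (at t within {0..})"
    and \<Phi>tc: "continuous_on ({0..} \<times> W) (\<lambda>(t, z). \<Phi>t t z)"
    and M: "\<And>t z. 0 \<le> t \<Longrightarrow> z \<in> W \<Longrightarrow> (\<Phi> t has_derivative blinfun_apply (M t z)) (at z)"
    and Mc: "continuous_on ({0..} \<times> W) (\<lambda>(t, z). M t z)"
  shows "C1_on ({0..} \<times> W) (\<lambda>(t, z). \<Phi> t z)"
  unfolding C1_on_def
proof (intro exI[of _ "\<lambda>(t, z). (blinfun_scaleR_left (\<Phi>t t z) o\<^sub>L fst_blinfun) + (M t z o\<^sub>L snd_blinfun)"] conjI ballI)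
  fix x :: "real \<times> 'e" assume "x \<in> {0..} \<times> W"
  then obtain t z where x: "x = (t, z)" "0 \<le> t" "z \<in> W" by auto
  have "((\<lambda>(t, z). \<Phi> t z) has_derivative (\<lambda>(a, h). a *\<^sub>R \<Phi>t t z + M t z h)) (at (t, z) within {0..} \<times> W)"
    using has_derivative_time_space[OF W x(2,3) \<Phi>' M Mc] x by auto
  then show "((\<lambda>(t, z). \<Phi> t z) has_derivative blinfun_apply
      ((\<lambda>(t, z). (blinfun_scaleR_left (\<Phi>t t z) o\<^sub>L fst_blinfun) + (M t z o\<^sub>L snd_blinfun)) x)) (at x within {0..} \<times> W)"
    unfolding x by (rule has_derivative_eq_rhs) (simp add: fun_eq_iff blinfun.add_left)
next
  show "continuous_on ({0..} \<times> W) (\<lambda>(t, z). (blinfun_scaleR_left (\<Phi>t t z) o\<^sub>L fst_blinfun) + (M t z o\<^sub>L snd_blinfun))"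
    using \<Phi>tc Mc unfolding case_prod_unfold
    by (intro continuous_on_add bounded_bilinear.continuous_on[OF bounded_bilinear_blinfun_compose]
        bounded_linear.continuous_on[OF bounded_linear_blinfun_scaleR_left] continuous_intros)
qed

text \<open>Flow and conormal form one system on \<Omega> times the space of initial conormals
  \<open>p\<close>. Its right-hand side \<open>f\<close> is C1 in space because \<open>v\<close> has
  continuous second derivatives there, and differentiating its flow gives C1 dependence on \<eta>
  and \<open>p\<close> together. The pairing \<open>q \<bullet> DY k\<close> is constant in time,
  since \<open>q\<close> evolves with minus the transpose of the operator that drives
  \<open>DY k\<close>.\<close>

lemma flow_conormal:
  fixes \<Omega> :: "(real^3) set"
  assumes bdd: "bounded \<Omega>" and op: "open \<Omega>" and H1: "H1 \<Omega> v" and H2: "H2 \<Omega> v"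
  obtains q :: "real \<Rightarrow> (real^3) \<times> (real^3) \<Rightarrow> real^3"
    and DY :: "real \<Rightarrow> real^3 \<Rightarrow> (real^3) \<Rightarrow>\<^sub>L (real^3)"
  where "C1_on ({0..} \<times> (\<Omega> \<times> UNIV)) (\<lambda>(t, z). q t z)"
    "\<And>\<eta> p. \<eta> \<in> \<Omega> \<Longrightarrow> q 0 (\<eta>, p) = p"
    "\<And>t \<eta> p k. 0 \<le> t \<Longrightarrow> \<eta> \<in> \<Omega> \<Longrightarrow> q t (\<eta>, p) \<bullet> DY t \<eta> k = p \<bullet> k"
    "C1_on ({0..} \<times> \<Omega>) (\<lambda>(t, \<eta>). flow \<Omega> v t 0 \<eta>)"
    "\<And>t \<eta>. 0 \<le> t \<Longrightarrow> \<eta> \<in> \<Omega> \<Longrightarrow> ((\<lambda>(t, \<eta>). flow \<Omega> v t 0 \<eta>) has_derivative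
        (\<lambda>(a, k). a *\<^sub>R v t (flow \<Omega> v t 0 \<eta>) + DY t \<eta> k)) (at (t, \<eta>) within {0..} \<times> \<Omega>)"
proof -
  obtain L where L: "0 \<le> L" and "\<And>\<xi>. \<xi> \<in> \<Omega> \<Longrightarrow> flow \<Omega> v 0 0 \<xi> = \<xi>"
    and "\<And>t \<xi>. 0 \<le> t \<Longrightarrow> \<xi> \<in> \<Omega> \<Longrightarrow> flow \<Omega> v t 0 \<xi> \<in> \<Omega>"
    and "\<And>t \<xi>. 0 \<le> t \<Longrightarrow> \<xi> \<in> \<Omega> \<Longrightarrow>
       ((\<lambda>s. flow \<Omega> v s 0 \<xi>) has_vector_derivative v t (flow \<Omega> v t 0 \<xi>)) (at t within {0..})"
    and "\<And>t \<xi> \<xi>'. 0 \<le> t \<Longrightarrow> \<xi> \<in> \<Omega> \<Longrightarrow> \<xi>' \<in> \<Omega> \<Longrightarrow>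
       norm (flow \<Omega> v t 0 \<xi> - flow \<Omega> v t 0 \<xi>') \<le> norm (\<xi> - \<xi>') * exp (L * t)"
    by (rule flow_in_domain[OF bdd op H1 H2]) (rule that)
  moreover define Y where "Y = (\<lambda>t. flow \<Omega> v t 0)"
  ultimately have Y0: "\<And>\<xi>. \<xi> \<in> \<Omega> \<Longrightarrow> Y 0 \<xi> = \<xi>"
    and Y\<Omega>: "\<And>t \<xi>. 0 \<le> t \<Longrightarrow> \<xi> \<in> \<Omega> \<Longrightarrow> Y t \<xi> \<in> \<Omega>"
    and Y': "\<And>t \<xi>. 0 \<le> t \<Longrightarrow> \<xi> \<in> \<Omega> \<Longrightarrow> ((\<lambda>s. Y s \<xi>) has_vector_derivative v t (Y t \<xi>)) (at t within {0..})"
    and Ylip: "\<And>t \<xi> \<xi>'. 0 \<le> t \<Longrightarrow> \<xi> \<in> \<Omega> \<Longrightarrow> \<xi>' \<in> \<Omega> \<Longrightarrow> norm (Y t \<xi> - Y t \<xi>') \<le> norm (\<xi> - \<xi>') * exp (L * t)"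
    by simp_all
  have "twice_partially_C_x \<Omega> v" using H1 by (simp add: H1_def)
  then obtain d1 d2 where
    d: "(\<forall>i. \<forall>t\<ge>0. \<forall>x\<in>\<Omega>. ((\<lambda>h. v t (x + h *\<^sub>R axis i 1)) has_vector_derivative d1 i t x) (at 0)) \<and>
        (\<forall>i j. \<forall>t\<ge>0. \<forall>x\<in>\<Omega>. ((\<lambda>h. d1 i t (x + h *\<^sub>R axis j 1)) has_vector_derivative d2 i j t x) (at 0)) \<and>
        (\<forall>i. continuous_on ({0..} \<times> \<Omega>) (\<lambda>(t, x). d1 i t x)) \<and>
        (\<forall>i j. continuous_on ({0..} \<times> \<Omega>) (\<lambda>(t, x). d2 i j t x))"
    unfolding twice_partially_C_x_def by (elim exE)
  then have d1: "\<And>i t x. 0 \<le> t \<Longrightarrow> x \<in> \<Omega> \<Longrightarrow> ((\<lambda>h. v t (x + h *\<^sub>R axis i 1)) has_vector_derivative d1 i t x) (at 0)"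
    and d2: "\<And>i j t x. 0 \<le> t \<Longrightarrow> x \<in> \<Omega> \<Longrightarrow> ((\<lambda>h. d1 i t (x + h *\<^sub>R axis j 1)) has_vector_derivative d2 i j t x) (at 0)"
    and d1c: "\<And>i. continuous_on ({0..} \<times> \<Omega>) (\<lambda>(t, x). d1 i t x)"
    and d2c: "\<And>i j. continuous_on ({0..} \<times> \<Omega>) (\<lambda>(t, x). d2 i j t x)"
    by simp_all
  have slice: "continuous_on \<Omega> (g t)" if "continuous_on ({0..} \<times> \<Omega>) (\<lambda>(t, x). g t x)" "0 \<le> t"
    for g :: "real \<Rightarrow> real^3 \<Rightarrow> real^3" and t
    by (rule continuous_on_compose_Pair[OF that(1)]) (use that in \<open>auto intro!: continuous_intros\<close>)
  have Dv: "(v t has_derivative (\<lambda>h. \<Sum>i\<in>UNIV. h $ i *\<^sub>R d1 i t x)) (at x)" if "0 \<le> t" "x \<in> \<Omega>" for t x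
    using that d1 slice[OF d1c] by (intro has_derivative_continuous_partials[OF op]) auto
  have Dd1: "(d1 j t has_derivative (\<lambda>h. \<Sum>i\<in>UNIV. h $ i *\<^sub>R d2 j i t x)) (at x)" if "0 \<le> t" "x \<in> \<Omega>" for j t x
    using that d2 slice[OF d2c] by (intro has_derivative_continuous_partials[OF op]) auto
  have Yc: "continuous_on ({0..} \<times> \<Omega>) (\<lambda>(t, x). Y t x)"
  proof (rule continuous_on_tubeI)
    show "continuous_on {0..} (\<lambda>t. Y t z)" if "z \<in> \<Omega>" for z
      using Y' that by (intro continuous_on_vector_derivative) auto
    fix z0 T e assume z0: "z0 \<in> \<Omega>" and T: "(0::real) \<le> T" and e: "(0::real) < e"
    show "\<exists>d>0. \<forall>z\<in>\<Omega>. dist z z0 < d \<longrightarrow> (\<forall>s\<in>{0..T}. dist (Y s z) (Y s z0) \<le> e)"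
    proof (intro exI[of _ "e / exp (L * T)"] conjI ballI impI)
      fix z s assume z: "z \<in> \<Omega>" "dist z z0 < e / exp (L * T)" and s: "s \<in> {0..T}"
      have "norm (Y s z - Y s z0) \<le> norm (z - z0) * exp (L * s)" using Ylip z z0 s by simp
      also have "\<dots> \<le> norm (z - z0) * exp (L * T)"
        using s L by (intro mult_left_mono) (auto intro: mult_left_mono)
      also have "\<dots> \<le> e" using z(2) by (simp add: dist_norm field_simps)
      finally show "dist (Y s z) (Y s z0) \<le> e" by (simp add: dist_norm)
    qed (use e in auto)
  qed
  define W where "W = \<Omega> \<times> (UNIV :: (real^3) set)"
  have W: "open W" using op by (simp add: W_def open_Times)
  have lift: "continuous_on ({0..} \<times> W) (\<lambda>x. g (fst x) (fst (snd x)))"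
    if "continuous_on ({0..} \<times> \<Omega>) (\<lambda>(t, x). g t x)" for g :: "real \<Rightarrow> real^3 \<Rightarrow> real^3"
    by (rule continuous_on_compose_Pair[OF that]) (auto intro!: continuous_intros simp: W_def)
  have along: "continuous_on ({0..} \<times> W) (\<lambda>x. g (fst x) (Y (fst x) (fst (snd x))))"
    if "continuous_on ({0..} \<times> \<Omega>) (\<lambda>(t, x). g t x)" for g :: "real \<Rightarrow> real^3 \<Rightarrow> real^3"
    by (rule continuous_on_compose_Pair[OF that])
       (use lift[OF Yc] Y\<Omega> in \<open>auto intro!: continuous_intros simp: W_def\<close>)
  have along1: "continuous_on ({0..} \<times> W) (\<lambda>x. d1 j (fst x) (Y (fst x) (fst (snd x))))" for j
    by (rule along[OF d1c])
  have lift1: "continuous_on ({0..} \<times> W) (\<lambda>x. d1 j (fst x) (fst (snd x)))" for j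
    by (rule lift[OF d1c])
  have lift2: "continuous_on ({0..} \<times> W) (\<lambda>x. d2 i j (fst x) (fst (snd x)))" for i j
    by (rule lift[OF d2c])
  \<comment> \<open>Minus the transpose of \<open>Dv\<close> along the flow, as \<open>d1 j\<close>
    is the j-th column of \<open>Dv\<close>. With \<open>Y\<close> already known the conormal
    equation is linear, so \<open>q\<close> exists for all times although \<open>f\<close> need not
    be globally Lipschitz.\<close>
  define B where "B = (\<lambda>t (z :: (real^3) \<times> (real^3)). Blinfun (\<lambda>p. - (\<Sum>j\<in>UNIV. (p \<bullet> d1 j t (Y t (fst z))) *\<^sub>R (axis j 1 :: real^3))))"
  have B: "B t z p = - (\<Sum>j\<in>UNIV. (p \<bullet> d1 j t (Y t (fst z))) *\<^sub>R axis j 1)" for t z p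
    unfolding B_def
    by (subst bounded_linear_Blinfun_apply)
       (auto intro!: bounded_linear_minus bounded_linear_sum bounded_linear_scaleR_left
         bounded_linear_compose[OF bounded_linear_scaleR_left] bounded_linear_inner_left)
  have Bc: "continuous_on ({0..} \<times> W) (\<lambda>(t, z). B t z)"
    unfolding case_prod_unfold
    by (rule continuous_on_blinfun_componentwise) (auto simp: B intro!: continuous_intros along1)
  obtain q where qc: "continuous_on ({0..} \<times> W) (\<lambda>(t, z). q t z)"
    and q0: "\<And>z. z \<in> W \<Longrightarrow> q 0 z = snd z"
    and q': "\<And>t z. 0 \<le> t \<Longrightarrow> z \<in> W \<Longrightarrow> ((\<lambda>s. q s z) has_vector_derivative B t z (q t z)) (at t within {0..})"
    by (rule linear_ode_param[OF bounded_bilinear_blinfun_apply Bc, of snd]) (auto intro: continuous_intros)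
  define \<Phi> where "\<Phi> = (\<lambda>t z. (Y t (fst z), q t z))"
  define f where "f = (\<lambda>t z. (v t (fst z), - (\<Sum>j\<in>UNIV. (snd z \<bullet> d1 j t (fst z)) *\<^sub>R (axis j 1 :: real^3))))"
  \<comment> \<open>The spatial derivative of \<open>f\<close>; here the second derivatives of
    \<open>v\<close> enter.\<close>
  define F where "F = (\<lambda>t z (h :: (real^3) \<times> (real^3)). (\<Sum>i\<in>UNIV. fst h $ i *\<^sub>R d1 i t (fst z),
      - (\<Sum>j\<in>UNIV. (snd z \<bullet> (\<Sum>i\<in>UNIV. fst h $ i *\<^sub>R d2 j i t (fst z)) + snd h \<bullet> d1 j t (fst z)) *\<^sub>R (axis j 1 :: real^3))))"
  have fF: "(f t has_derivative F t z) (at z)" if "0 \<le> t" "z \<in> W" for t z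
  proof -
    have z: "fst z \<in> \<Omega>" using that by (auto simp: W_def)
    have fst': "(fst has_derivative fst) (at z)" by (rule bounded_linear_imp_has_derivative[OF bounded_linear_fst])
    have snd': "(snd has_derivative snd) (at z)" by (rule bounded_linear_imp_has_derivative[OF bounded_linear_snd])
    have a: "((\<lambda>z. v t (fst z)) has_derivative (\<lambda>h. \<Sum>i\<in>UNIV. fst h $ i *\<^sub>R d1 i t (fst z))) (at z)"
      using has_derivative_compose[OF fst' Dv[OF that(1) z]] .
    have b: "((\<lambda>z. d1 j t (fst z)) has_derivative (\<lambda>h. \<Sum>i\<in>UNIV. fst h $ i *\<^sub>R d2 j i t (fst z))) (at z)" for j
      using has_derivative_compose[OF fst' Dd1[OF that(1) z]] .
    show ?thesis
      unfolding f_def F_def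
      by (intro has_derivative_Pair a has_derivative_minus has_derivative_sum has_derivative_scaleR_left
          has_derivative_inner snd' b)
  qed
  define f' where "f' = (\<lambda>t z. Blinfun (F t z))"
  have f': "blinfun_apply (f' t z) = F t z" if "0 \<le> t" "z \<in> W" for t z
    unfolding f'_def by (rule bounded_linear_Blinfun_apply) (rule has_derivative_bounded_linear[OF fF[OF that]])
  have f'c: "continuous_on ({0..} \<times> W) (\<lambda>(t, z). f' t z)"
    unfolding case_prod_unfold
  proof (rule continuous_on_blinfun_componentwise)
    fix i :: "(real^3) \<times> (real^3)"
    have "continuous_on ({0..} \<times> W) (\<lambda>x. F (fst x) (snd x) i)"
      unfolding F_def by (intro continuous_intros lift1 lift2)
    then show "continuous_on ({0..} \<times> W) (\<lambda>x. f' (fst x) (snd x) i)"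
      by (rule continuous_on_eq) (auto simp: f')
  qed
  have \<Phi>W: "\<Phi> t z \<in> W" if "0 \<le> t" "z \<in> W" for t z
    using Y\<Omega> that by (auto simp: \<Phi>_def W_def)
  have \<Phi>0: "\<Phi> 0 z = z" if "z \<in> W" for z
    using Y0 q0 that by (auto simp: \<Phi>_def W_def)
  have \<Phi>c: "continuous_on ({0..} \<times> W) (\<lambda>(t, z). \<Phi> t z)"
    unfolding \<Phi>_def case_prod_unfold
    using qc lift[OF Yc] by (auto intro!: continuous_intros simp: case_prod_unfold)
  have \<Phi>': "((\<lambda>s. \<Phi> s z) has_vector_derivative f t (\<Phi> t z)) (at t within {0..})" if "0 \<le> t" "z \<in> W" for t z
    using q'[OF that] Y'[of t "fst z"] that
    unfolding \<Phi>_def f_def by (auto simp: W_def B intro!: has_vector_derivative_Pair)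
  obtain M where Mc: "continuous_on ({0..} \<times> W) (\<lambda>(t, z). M t z)"
    and M0: "\<And>z. z \<in> W \<Longrightarrow> M 0 z = id_blinfun"
    and M': "\<And>t z. 0 \<le> t \<Longrightarrow> z \<in> W \<Longrightarrow>
        ((\<lambda>s. M s z) has_vector_derivative f' t (\<Phi> t z) o\<^sub>L M t z) (at t within {0..})"
    and M: "\<And>t z. 0 \<le> t \<Longrightarrow> z \<in> W \<Longrightarrow> (\<Phi> t has_derivative blinfun_apply (M t z)) (at z)"
    by (rule flow_has_derivative[OF W W _ f'c \<Phi>c \<Phi>0 \<Phi>W \<Phi>']) (simp_all add: f' fF)
  have vc: "continuous_on ({0..} \<times> \<Omega>) (\<lambda>(t, x). v t x)"
    using H1 unfolding H1_def by (auto intro: C1_on_continuous_on)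
  have fc: "continuous_on ({0..} \<times> W) (\<lambda>(t, z). f t (\<Phi> t z))"
    unfolding f_def \<Phi>_def case_prod_unfold
    using qc along[OF vc] along1 by (auto intro!: continuous_intros simp: case_prod_unfold)
  have "C1_on ({0..} \<times> W) (\<lambda>(t, z). \<Phi> t z)"
    by (rule C1_on_time_space[OF W \<Phi>' fc M Mc])
  from C1_on_linear_comp[OF bounded_linear_snd this]
  have C1q: "C1_on ({0..} \<times> (\<Omega> \<times> UNIV)) (\<lambda>(t, z). q t z)"
    by (simp add: \<Phi>_def W_def case_prod_unfold)
  define in1 where "in1 = Blinfun (\<lambda>k :: real^3. (k, 0 :: real^3))"
  have bl: "bounded_linear (\<lambda>k :: real^3. (k, 0 :: real^3))"
    by (intro bounded_linear_Pair bounded_linear_ident bounded_linear_zero)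
  have in1: "in1 k = (k, 0)" for k
    unfolding in1_def by (simp add: bounded_linear_Blinfun_apply[OF bl])
  \<comment> \<open>The flow component of \<Phi> does not see the conormal component, so its
    derivative can be read off from \<open>M\<close> at \<open>p = 0\<close> in the directions
    \<open>(k, 0)\<close>.\<close>
  define DY where "DY = (\<lambda>t \<eta>. fst_blinfun o\<^sub>L M t (\<eta>, 0) o\<^sub>L in1)"
  have DY: "DY t \<eta> k = fst (M t (\<eta>, 0) (k, 0))" for t \<eta> k by (simp add: DY_def in1)
  have YD: "(Y t has_derivative DY t \<eta>) (at \<eta>)" if "0 \<le> t" "\<eta> \<in> \<Omega>" for t \<eta>
  proof -
    have "((\<lambda>\<eta>. fst (\<Phi> t (\<eta>, 0))) has_derivative (\<lambda>k. fst (M t (\<eta>, 0) (k, 0)))) (at \<eta>)"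
      using that
      by (intro has_derivative_fst has_derivative_compose[OF bounded_linear_imp_has_derivative[OF bl] M])
         (auto simp: W_def)
    then show ?thesis by (simp add: \<Phi>_def flip: DY)
  qed
  have DYc: "continuous_on ({0..} \<times> \<Omega>) (\<lambda>(t, \<eta>). DY t \<eta>)"
  proof -
    have "continuous_on ({0..} \<times> \<Omega>) (\<lambda>x. M (fst x) (snd x, 0))"
      by (rule continuous_on_compose_Pair[OF Mc]) (auto intro!: continuous_intros simp: W_def)
    then show ?thesis
      unfolding DY_def case_prod_unfold
      by (intro bounded_bilinear.continuous_on[OF bounded_bilinear_blinfun_compose] continuous_intros)
  qed
  have vYc: "continuous_on ({0..} \<times> \<Omega>) (\<lambda>(t, \<eta>). v t (Y t \<eta>))"
    unfolding case_prod_unfold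
    by (rule continuous_on_compose_Pair[OF vc]) (use Yc Y\<Omega> in \<open>auto intro!: continuous_intros simp: case_prod_unfold\<close>)
  have C1Y: "C1_on ({0..} \<times> \<Omega>) (\<lambda>(t, \<eta>). Y t \<eta>)"
    by (rule C1_on_time_space[OF op Y' vYc YD DYc])
  have "((\<lambda>(t, \<eta>). Y t \<eta>) has_derivative (\<lambda>(a, k). a *\<^sub>R v t (Y t \<eta>) + DY t \<eta> k)) (at (t, \<eta>) within {0..} \<times> \<Omega>)"
    if "0 \<le> t" "\<eta> \<in> \<Omega>" for t \<eta>
    using has_derivative_time_space[OF op that Y'[OF that] YD DYc] .
  moreover have "q t (\<eta>, p) \<bullet> DY t \<eta> k = p \<bullet> k" if t: "0 \<le> t" and \<eta>: "\<eta> \<in> \<Omega>" for t \<eta> p k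
  proof -
    have mem: "(\<eta>, p) \<in> W" "(\<eta>, 0) \<in> W" using \<eta> by (auto simp: W_def)
    have "((\<lambda>s. q s (\<eta>, p) \<bullet> DY s \<eta> k) has_vector_derivative 0) (at s within {0..})" if s: "0 \<le> s" for s
    proof -
      have "((\<lambda>s. fst (M s (\<eta>, 0) (k, 0))) has_vector_derivative
          fst ((f' s (\<Phi> s (\<eta>, 0)) o\<^sub>L M s (\<eta>, 0)) (k, 0))) (at s within {0..})"
        by (rule bounded_linear.has_vector_derivative[OF _ M'[OF s mem(2)]])
           (intro bounded_linear_compose[OF bounded_linear_fst] blinfun.bounded_linear_left)
      also have "fst ((f' s (\<Phi> s (\<eta>, 0)) o\<^sub>L M s (\<eta>, 0)) (k, 0)) = (\<Sum>i\<in>UNIV. DY s \<eta> k $ i *\<^sub>R d1 i s (Y s \<eta>))"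
        using f'[OF s \<Phi>W[OF s mem(2)]] by (simp add: F_def DY) (simp add: \<Phi>_def)
      finally have "((\<lambda>s. DY s \<eta> k) has_vector_derivative (\<Sum>i\<in>UNIV. DY s \<eta> k $ i *\<^sub>R d1 i s (Y s \<eta>))) (at s within {0..})"
        by (simp add: DY)
      from bounded_bilinear.has_vector_derivative[OF bounded_bilinear_inner q'[OF s mem(1)] this]
      have "((\<lambda>s. q s (\<eta>, p) \<bullet> DY s \<eta> k) has_vector_derivative
          q s (\<eta>, p) \<bullet> (\<Sum>i\<in>UNIV. DY s \<eta> k $ i *\<^sub>R d1 i s (Y s \<eta>)) + B s (\<eta>, p) (q s (\<eta>, p)) \<bullet> DY s \<eta> k) (at s within {0..})" .
      \<comment> \<open>Adjointness: \<open>B\<close> is minus the transpose of the operator acting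
        on \<open>DY s \<eta> k\<close>, so the two terms cancel.\<close>
      also have "q s (\<eta>, p) \<bullet> (\<Sum>i\<in>UNIV. DY s \<eta> k $ i *\<^sub>R d1 i s (Y s \<eta>)) + B s (\<eta>, p) (q s (\<eta>, p)) \<bullet> DY s \<eta> k = 0"
        by (simp add: B inner_sum_right inner_sum_left inner_axis' mult.commute)
      finally show ?thesis .
    qed
    then obtain c where "\<And>s. s \<in> {0..} \<Longrightarrow> q s (\<eta>, p) \<bullet> DY s \<eta> k = c"
      using has_vector_derivative_zero_constant[of "{0..}" "\<lambda>s. q s (\<eta>, p) \<bullet> DY s \<eta> k"] by auto
    then have "q t (\<eta>, p) \<bullet> DY t \<eta> k = q 0 (\<eta>, p) \<bullet> DY 0 \<eta> k" using t by simp
    then show ?thesis using q0[OF mem(1)] M0[OF mem(2)] by (simp add: DY)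
  qed
  moreover have "q 0 (\<eta>, p) = p" if "\<eta> \<in> \<Omega>" for \<eta> p using q0 that by (simp add: W_def)
  ultimately show ?thesis 
    by (intro that[of q DY] C1q C1Y[unfolded Y_def]) (simp_all add: Y_def)
qed

section \<open>Diffeomorphisms of space-time fixing the time\<close>

text \<open>A lower bound is injectivity in the form that survives perturbation: half of the
  constant works for every operator within half of it.\<close>

lemma open_bounded_below: "open {A :: 'a::real_normed_vector \<Rightarrow>\<^sub>L 'b::real_normed_vector. \<exists>c>0. \<forall>k. c * norm k \<le> norm (A k)}"
  unfolding open_dist
proof (clarify)
  fix A :: "'a \<Rightarrow>\<^sub>L 'b" and c :: real
  assume c: "0 < c" "\<forall>k. c * norm k \<le> norm (A k)"
  show "\<exists>e>0. \<forall>B. dist B A < e \<longrightarrow> B \<in> {A. \<exists>c>0. \<forall>k. c * norm k \<le> norm (blinfun_apply A k)}"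
  proof (intro exI[of _ "c/2"] conjI allI impI CollectI)
    fix B k assume "dist B A < c/2"
    then have "norm ((A - B) k) \<le> c/2 * norm k"
      by (intro order_trans[OF norm_blinfun mult_right_mono]) (auto simp: dist_norm norm_minus_commute)
    moreover have "norm (A k) \<le> norm ((A - B) k) + norm (B k)"
      using norm_triangle_ineq[of "(A - B) k" "B k"] by (simp add: blinfun.diff_left)
    ultimately show "c/2 * norm k \<le> norm (B k)"
      using c(2)[rule_format, of k] by simp
  qed (use c in auto)
qed

text \<open>The identity \<open>B x - B x0 = B x o\<^sub>L (A x0 - A x) o\<^sub>L B x0\<close> is
  used twice: first to bound \<open>B x\<close> near \<open>x0\<close>, where nothing is known about
  its size, and then to make the difference small.\<close>

lemma continuous_on_blinfun_inverse:
  fixes A :: "'x::metric_space \<Rightarrow> 'a::real_normed_vector \<Rightarrow>\<^sub>L 'b::real_normed_vector"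
    and B :: "'x \<Rightarrow> 'b \<Rightarrow>\<^sub>L 'a"
  assumes A: "continuous_on S A"
    and BA: "\<And>x k. x \<in> S \<Longrightarrow> B x (A x k) = k" and AB: "\<And>x k. x \<in> S \<Longrightarrow> A x (B x k) = k"
  shows "continuous_on S B"
  unfolding continuous_on_iff
proof (intro ballI allI impI)
  fix x0 and e :: real assume x0: "x0 \<in> S" and e: "0 < e"
  define b where "b = norm (B x0) + 1"
  have b: "0 < b" "norm (B x0) \<le> b" by (auto simp: b_def add_nonneg_pos)
  \<comment> \<open>The first entry yields \<open>norm (B x) \<le> 2 * b\<close>; the second then
    makes the difference at most \<open>e / 2\<close>.\<close>
  define \<delta> where "\<delta> = min (1 / (2 * b)) (e / (4 * b * b))"
  have \<delta>: "0 < \<delta>" using b e by (auto simp: \<delta>_def)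
  obtain d where d: "0 < d" "\<forall>x\<in>S. dist x x0 < d \<longrightarrow> dist (A x) (A x0) < \<delta>"
    using A x0 \<delta> unfolding continuous_on_iff by blast
  show "\<exists>d>0. \<forall>x\<in>S. dist x x0 < d \<longrightarrow> dist (B x) (B x0) < e"
  proof (intro exI[of _ d] conjI ballI impI)
    fix x assume x: "x \<in> S" "dist x x0 < d"
    define a where "a = norm (A x0 - A x)"
    have a: "0 \<le> a" "a \<le> \<delta>" using d x by (auto simp: a_def dist_norm norm_minus_commute intro: less_imp_le)
    have "B x - B x0 = B x o\<^sub>L (A x0 - A x) o\<^sub>L B x0"
      using BA[OF x(1)] AB[OF x0] by (intro blinfun_eqI) (simp add: blinfun.diff_left blinfun.diff_right)
    then have "norm (B x - B x0) \<le> norm (B x) * a * norm (B x0)"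
      unfolding a_def by (simp add: order_trans[OF norm_blinfun_compose mult_right_mono[OF norm_blinfun_compose]])
    also have "\<dots> \<le> norm (B x) * a * b" using a b by (intro mult_left_mono) auto
    finally have D: "norm (B x - B x0) \<le> norm (B x) * (a * b)" by simp
    have ab: "a * b \<le> 1/2" "a * b \<le> e / (4 * b)"
    proof -
      have "a \<le> 1 / (2 * b)" "a \<le> e / (4 * b * b)" using a(2) by (auto simp: \<delta>_def)
      then show "a * b \<le> 1/2" "a * b \<le> e / (4 * b)" using b(1) by (simp_all add: field_simps)
    qed
    have "norm (B x) \<le> norm (B x0) + norm (B x - B x0)"
      using norm_triangle_sub[of "B x" "B x0"] by simp
    also have "\<dots> \<le> b + norm (B x) * (1/2)"
      using D b(2) mult_left_mono[OF ab(1), of "norm (B x)"] by simp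
    finally have "norm (B x) \<le> 2 * b" by simp
    then have "norm (B x) * (a * b) \<le> 2 * b * (e / (4 * b))"
      using ab a b by (intro mult_mono) auto
    also have "\<dots> < e" using b e by (simp add: field_simps)
    finally show "dist (B x) (B x0) < e" using D by (simp add: dist_norm)
  qed (use d in auto)
qed

text \<open>For two points with equal images, linearization at \<open>p\<close> bounds
  \<open>DZ s p\<close> on their difference by the factor \<open>c / 2\<close>, and replacing
  \<open>s\<close> by \<open>s0\<close> costs another \<open>c / 4\<close>. The total, 3/4 of the
  lower bound \<open>c\<close>, forces the difference to vanish. The radius also covers times near
  \<open>s0\<close>, as the later compactness argument requires.\<close>

lemma locally_uniformly_injective:
  fixes Z :: "real \<Rightarrow> 'a::euclidean_space \<Rightarrow> 'b::euclidean_space"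
  assumes U: "open U" and p: "p \<in> U" and s0: "0 \<le> s0"
    and deriv: "\<And>t \<xi>. 0 \<le> t \<Longrightarrow> \<xi> \<in> U \<Longrightarrow> (Z t has_derivative blinfun_apply (DZ t \<xi>)) (at \<xi>)"
    and DZc: "continuous_on ({0..} \<times> U) (\<lambda>(t, \<xi>). DZ t \<xi>)"
    and reg: "\<And>k. DZ s0 p k = 0 \<Longrightarrow> k = 0"
  obtains \<rho> where "0 < \<rho>"
    "\<And>s \<xi> \<xi>'. 0 \<le> s \<Longrightarrow> dist s s0 < \<rho> \<Longrightarrow> \<xi> \<in> ball p \<rho> \<Longrightarrow> \<xi>' \<in> ball p \<rho> \<Longrightarrow> Z s \<xi> = Z s \<xi>' \<Longrightarrow> \<xi> = \<xi>'"
proof -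
  have lin: "linear (DZ s0 p)" by (simp add: blinfun.bounded_linear_right bounded_linear.linear)
  then have "inj (DZ s0 p)" using reg by (simp add: linear_injective_0)
  with lin obtain c where c: "0 < c" "\<And>k. c * norm k \<le> norm (DZ s0 p k)"
    using linear_inj_bounded_below_pos by blast
  obtain r where r: "0 < r" "ball p r \<subseteq> U" using U p by (auto simp: open_contains_ball)
  obtain d where d: "0 < d"
    "\<And>x. x \<in> {0..} \<times> U \<Longrightarrow> dist x (s0, p) < d \<Longrightarrow> dist (DZ (fst x) (snd x)) (DZ s0 p) < c / 4"
    using DZc p s0 c(1) unfolding continuous_on_iff case_prod_unfold
    by (metis (no_types, lifting) SigmaI atLeast_iff divide_pos_pos fst_conv snd_conv zero_less_numeral)
  define \<rho> where "\<rho> = min r (d / 2)"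
  have \<rho>: "0 < \<rho>" "\<rho> \<le> r" "\<rho> \<le> d / 2" using r d by (auto simp: \<rho>_def)
  show ?thesis
  proof (rule that[OF \<rho>(1)])
    fix s \<xi> \<xi>' assume s: "0 \<le> s" "dist s s0 < \<rho>" and \<xi>: "\<xi> \<in> ball p \<rho>" "\<xi>' \<in> ball p \<rho>" and eq: "Z s \<xi> = Z s \<xi>'"
    have near: "norm (DZ s x - DZ s0 p) \<le> c / 4" if "x \<in> ball p \<rho>" for x
    proof -
      have "dist (s, x) (s0, p) \<le> dist s s0 + dist x p"
        by (simp add: dist_Pair_Pair sqrt_sum_squares_le_sum)
      also have "\<dots> < d" using s that \<rho> by (simp add: dist_commute)
      finally have "dist (s, x) (s0, p) < d" .
      moreover have "x \<in> U" using that \<rho> r(2) by auto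
      ultimately show ?thesis using d(2)[of "(s, x)"] s by (simp add: dist_norm)
    qed
    have pin: "p \<in> ball p \<rho>" using \<rho> by simp
    have "norm (Z s \<xi>' - Z s \<xi> - DZ s p (\<xi>' - \<xi>)) \<le> norm (\<xi>' - \<xi>) * (c / 2)"
    proof (rule differentiable_bound_linearization[where S = "ball p \<rho>"
          and f' = "\<lambda>x. blinfun_apply (DZ s x)" and ?x0.0 = p])
      fix t :: real assume "t \<in> {0..1}"
      then have "(1 - t) *\<^sub>R \<xi> + t *\<^sub>R \<xi>' \<in> ball p \<rho>"
        by (intro convexD[OF convex_ball \<xi>]) auto
      then show "\<xi> + t *\<^sub>R (\<xi>' - \<xi>) \<in> ball p \<rho>" by (simp add: algebra_simps)
    next
      fix x assume x: "x \<in> ball p \<rho>"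
      then have "x \<in> U" using r \<rho> by auto
      then show "(Z s has_derivative blinfun_apply (DZ s x)) (at x within ball p \<rho>)"
        using deriv s has_derivative_at_withinI by blast
      have eq: "blinfun_apply (DZ s x) - blinfun_apply (DZ s p) = blinfun_apply (DZ s x - DZ s p)"
        by (simp add: fun_eq_iff blinfun.diff_left)
      have "norm (DZ s x - DZ s p) \<le> norm (DZ s x - DZ s0 p) + norm (DZ s p - DZ s0 p)"
        using norm_triangle_ineq4[of "DZ s x - DZ s0 p" "DZ s p - DZ s0 p"] by simp
      then show "onorm (blinfun_apply (DZ s x) - blinfun_apply (DZ s p)) \<le> c / 2"
        unfolding eq norm_blinfun.rep_eq[symmetric] using near[OF x] near[OF pin] by simp
    qed (rule pin)
    then have 1: "norm (DZ s p (\<xi>' - \<xi>)) \<le> c / 2 * norm (\<xi>' - \<xi>)"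
      using eq by (simp add: mult.commute)
    have 2: "norm ((DZ s p - DZ s0 p) (\<xi>' - \<xi>)) \<le> c / 4 * norm (\<xi>' - \<xi>)"
      using near[OF pin] by (intro order_trans[OF norm_blinfun mult_right_mono]) auto
    have "norm (DZ s0 p (\<xi>' - \<xi>)) \<le> norm (DZ s p (\<xi>' - \<xi>)) + norm ((DZ s p - DZ s0 p) (\<xi>' - \<xi>))"
      using norm_triangle_ineq4[of "DZ s p (\<xi>' - \<xi>)" "(DZ s p - DZ s0 p) (\<xi>' - \<xi>)"]
      by (simp add: blinfun.diff_left)
    then have "c * norm (\<xi>' - \<xi>) \<le> 3/4 * (c * norm (\<xi>' - \<xi>))"
      using 1 2 c(2)[of "\<xi>' - \<xi>"] by simp
    then have "c * norm (\<xi>' - \<xi>) \<le> 0" by linarith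
    then show "\<xi> = \<xi>'" using c(1) by (simp add: mult_le_0_iff)
  qed
qed

lemma continuous_on_abs_time:
  assumes "continuous_on ({0::real..} \<times> U) (\<lambda>(t, x). g t x)"
  shows "continuous_on (UNIV \<times> U) (\<lambda>(t, x). g \<bar>t\<bar> x)"
  unfolding case_prod_unfold
  by (rule continuous_on_compose_Pair[OF assms]) (auto intro!: continuous_intros)

section \<open>Uniform injectivity near a compact set and the inverse map\<close>

text \<open>Injectivity is a condition on pairs, so compactness is applied to
  \<open>{0..T} \<times> S \<times> S\<close>. Near pairs of distinct points the images stay apart;
  near the diagonal local injectivity takes over. Both are open conditions, and a compact set inside
  an open set has a uniform margin.\<close>

lemma uniform_injectivity_radius:
  fixes Z :: "real \<Rightarrow> 'a::euclidean_space \<Rightarrow> 'b::euclidean_space"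
  assumes U: "open U" and S: "compact S" "S \<subseteq> U"
    and deriv: "\<And>t \<xi>. 0 \<le> t \<Longrightarrow> \<xi> \<in> U \<Longrightarrow> (Z t has_derivative blinfun_apply (DZ t \<xi>)) (at \<xi>)"
    and DZc: "continuous_on ({0..} \<times> U) (\<lambda>(t, \<xi>). DZ t \<xi>)"
    and Zc: "continuous_on ({0..} \<times> U) (\<lambda>(t, \<xi>). Z t \<xi>)"
    and inj: "\<And>t. 0 \<le> t \<Longrightarrow> inj_on (Z t) S"
    and reg: "\<And>t \<xi> k. 0 \<le> t \<Longrightarrow> \<xi> \<in> S \<Longrightarrow> DZ t \<xi> k = 0 \<Longrightarrow> k = 0"
    and V: "openin (top_of_set ({0..} \<times> UNIV)) V" "\<And>t \<xi>. 0 \<le> t \<Longrightarrow> \<xi> \<in> S \<Longrightarrow> (t, Z t \<xi>) \<in> V"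
  obtains r where "0 < r"
    "\<And>s \<xi>. 0 \<le> s \<Longrightarrow> s \<le> T \<Longrightarrow> \<xi> \<in> (\<Union>p\<in>S. ball p r) \<Longrightarrow> \<xi> \<in> U \<and> (s, Z s \<xi>) \<in> V \<and> (\<forall>k. DZ s \<xi> k = 0 \<longrightarrow> k = 0)"
    "\<And>s. 0 \<le> s \<Longrightarrow> s \<le> T \<Longrightarrow> inj_on (Z s) (\<Union>p\<in>S. ball p r)"
proof -
  obtain V' where V': "open V'" "V = ({0..} \<times> UNIV) \<inter> V'" using V(1) by (auto simp: openin_open)
  \<comment> \<open>The absolute value of time makes the sets below open in full space-time and not
    merely relative to nonnegative times.\<close>
  define Z' where "Z' = (\<lambda>(t, x). Z \<bar>t\<bar> x)"
  have Z'c: "continuous_on (UNIV \<times> U) Z'" unfolding Z'_def by (rule continuous_on_abs_time[OF Zc])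
  have UU: "open ((UNIV :: real set) \<times> U)" using U by (simp add: open_Times)
  define W1 where "W1 = (UNIV \<times> U) \<inter> (\<lambda>(t, x). (\<bar>t\<bar>, Z' (t, x))) -` V'"
  have W1: "open W1" unfolding W1_def
    by (intro continuous_open_preimage UU V') (use Z'c in \<open>auto simp: case_prod_unfold intro!: continuous_intros\<close>)
  define W2 where "W2 = (UNIV \<times> U) \<inter> (\<lambda>(t, x). DZ \<bar>t\<bar> x) -` {A. \<exists>c>0. \<forall>k. c * norm k \<le> norm (blinfun_apply A k)}"
  have W2: "open W2" unfolding W2_def
    by (intro continuous_open_preimage UU open_bounded_below continuous_on_abs_time[OF DZc])
  define W3 where "W3 = (UNIV \<times> U \<times> U) \<inter> (\<lambda>(t, x, y). Z' (t, x) - Z' (t, y)) -` (- {0})"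
  have W3: "open W3" unfolding W3_def case_prod_unfold
    by (intro continuous_open_preimage continuous_on_diff continuous_on_compose2[OF Z'c])
       (use U in \<open>auto intro!: continuous_intros open_Times\<close>)
  \<comment> \<open>Centres and radii for which local injectivity holds. The set \<open>W4\<close>
    built from them is open and contains the triples of \<open>C\<close> on the diagonal.\<close>
  define I where "I = {(s0, p, \<rho>). 0 < \<rho> \<and> (\<forall>s \<xi> \<xi>'. 0 \<le> s \<longrightarrow> dist s s0 < \<rho> \<longrightarrow> \<xi> \<in> ball p \<rho> \<longrightarrow> \<xi>' \<in> ball p \<rho> \<longrightarrow> Z s \<xi> = Z s \<xi>' \<longrightarrow> \<xi> = \<xi>')}"
  define W4 where "W4 = (\<Union>(s0, p, \<rho>)\<in>I. ball s0 \<rho> \<times> ball p \<rho> \<times> ball p \<rho>)"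
  have W4: "open W4" unfolding W4_def by (auto intro!: open_Times)
  define B where "B = ((\<lambda>(t, x, y). (t, x)) -` (W1 \<inter> W2)) \<inter> (W3 \<union> W4)"
  have B: "open B" unfolding B_def case_prod_unfold
    using W1 W2 W3 W4 by (intro open_Int open_Un open_vimage) (auto intro!: continuous_intros)
  define C where "C = {0..T} \<times> S \<times> S"
  have "C \<subseteq> B"
  proof
    fix x assume "x \<in> C"
    then obtain s p p' where x: "x = (s, p, p')" and s: "0 \<le> s" and p: "p \<in> S" "p' \<in> S" by (auto simp: C_def)
    have "(s, p) \<in> W1" using V(2)[OF s p(1)] s p S V' by (auto simp: W1_def Z'_def)
    moreover have "(s, p) \<in> W2"
    proof -
      have lin: "linear (DZ s p)" by (simp add: blinfun.bounded_linear_right bounded_linear.linear)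
      then have "inj (DZ s p)" using reg[OF s p(1)] by (simp add: linear_injective_0)
      with lin have "\<exists>c>0. \<forall>k. c * norm k \<le> norm (DZ s p k)"
        using linear_inj_bounded_below_pos by blast
      then show ?thesis using s p S by (auto simp: W2_def)
    qed
    moreover have "x \<in> W3 \<union> W4"
    proof (cases "p = p'")
      case True
      obtain \<rho> where "(s, p, \<rho>) \<in> I"
        by (rule locally_uniformly_injective[OF U _ s deriv DZc reg[OF s p(1)]])
           (use p S in \<open>auto simp: I_def\<close>)
      then have "x \<in> ball s \<rho> \<times> ball p \<rho> \<times> ball p \<rho>" using True by (auto simp: x I_def)
      with \<open>(s, p, \<rho>) \<in> I\<close> show ?thesis unfolding W4_def by blast
    next
      case False
      then have "Z s p \<noteq> Z s p'" using inj[OF s] p by (auto simp: inj_on_def)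
      then show ?thesis using s p S by (auto simp: W3_def x Z'_def)
    qed
    ultimately show "x \<in> B" by (auto simp: B_def x)
  qed
  moreover have "compact C" unfolding C_def by (intro compact_Times S compact_Icc)
  ultimately obtain e where e: "0 < e" "(\<Union>x\<in>C. ball x e) \<subseteq> B"
    using compact_subset_open_imp_ball_epsilon_subset[OF _ B] by blast
  \<comment> \<open>The radius \<open>e/2\<close> for each of the two points keeps the triple within
    distance \<open>e\<close> of \<open>C\<close>.\<close>
  have inB: "(s, \<xi>, \<xi>') \<in> B" if "0 \<le> s" "s \<le> T" "\<xi> \<in> (\<Union>p\<in>S. ball p (e/2))" "\<xi>' \<in> (\<Union>p\<in>S. ball p (e/2))" for s \<xi> \<xi>'
  proof -
    from that(3) obtain p where "p \<in> S" "\<xi> \<in> ball p (e/2)" by blast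
    moreover from that(4) obtain p' where "p' \<in> S" "\<xi>' \<in> ball p' (e/2)" by blast
    ultimately have p: "p \<in> S" "p' \<in> S" "dist p \<xi> < e/2" "dist p' \<xi>' < e/2" by auto
    have "dist (s, p, p') (s, \<xi>, \<xi>') \<le> dist p \<xi> + dist p' \<xi>'"
      by (simp add: dist_Pair_Pair sqrt_sum_squares_le_sum)
    then have "(s, \<xi>, \<xi>') \<in> ball (s, p, p') e" using p by simp
    then show ?thesis using e(2) p that by (force simp: C_def)
  qed
  show ?thesis
  proof (rule that[of "e/2"])
    fix s \<xi> assume s: "0 \<le> s" "s \<le> T" and \<xi>: "\<xi> \<in> (\<Union>p\<in>S. ball p (e/2))"
    have W: "(s, \<xi>) \<in> W1" "(s, \<xi>) \<in> W2" using inB[OF s \<xi> \<xi>] unfolding B_def by simp_all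
    have "\<xi> \<in> U" "(s, Z s \<xi>) \<in> V" using W(1) s V'(2) by (simp_all add: W1_def Z'_def)
    moreover obtain c where c: "0 < c" "\<And>k. c * norm k \<le> norm (DZ s \<xi> k)"
      using W(2) s(1) by (auto simp: W2_def)
    have "k = 0" if "DZ s \<xi> k = 0" for k
      using c(2)[of k] c(1) that by (simp add: mult_le_0_iff)
    ultimately show "\<xi> \<in> U \<and> (s, Z s \<xi>) \<in> V \<and> (\<forall>k. DZ s \<xi> k = 0 \<longrightarrow> k = 0)" by blast
  next
    fix s assume s: "0 \<le> s" "s \<le> T"
    show "inj_on (Z s) (\<Union>p\<in>S. ball p (e/2))"
    proof (rule inj_onI)
      fix \<xi> \<xi>' assume \<xi>: "\<xi> \<in> (\<Union>p\<in>S. ball p (e/2))" "\<xi>' \<in> (\<Union>p\<in>S. ball p (e/2))" and eq: "Z s \<xi> = Z s \<xi>'"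
      have "(s, \<xi>, \<xi>') \<notin> W3" using eq s by (simp add: W3_def Z'_def)
      then have "(s, \<xi>, \<xi>') \<in> W4" using inB[OF s \<xi>] unfolding B_def by simp
      then obtain s0 p \<rho> where "(s0, p, \<rho>) \<in> I" "(s, \<xi>, \<xi>') \<in> ball s0 \<rho> \<times> ball p \<rho> \<times> ball p \<rho>"
        unfolding W4_def by blast
      then show "\<xi> = \<xi>'" using s eq unfolding I_def by (auto simp: dist_commute)
    qed
  qed (use e in auto)
qed

text \<open>The injectivity radius depends on the time horizon, so the domain is a union of slabs
  that may get thinner with time. The reflected map is only known to be continuous across time 0;
  invariance of domain supplies an open image and a continuous inverse, and invertibility of the
  derivative makes this inverse C1 within nonnegative times.\<close>

lemma time_space_inverse:
  fixes Z :: "real \<Rightarrow> 'a::euclidean_space \<Rightarrow> 'a"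
  assumes U: "open U" and S: "compact S" "S \<subseteq> U"
    and C1: "C1_on ({0..} \<times> U) (\<lambda>(t, \<xi>). Z t \<xi>)"
    and inj: "\<And>t. 0 \<le> t \<Longrightarrow> inj_on (Z t) S"
    and reg: "\<And>t \<xi> D k. 0 \<le> t \<Longrightarrow> \<xi> \<in> S \<Longrightarrow> (Z t has_derivative D) (at \<xi>) \<Longrightarrow> D k = 0 \<Longrightarrow> k = 0"
    and V: "openin (top_of_set ({0..} \<times> UNIV)) V" "\<And>t \<xi>. 0 \<le> t \<Longrightarrow> \<xi> \<in> S \<Longrightarrow> (t, Z t \<xi>) \<in> V"
  obtains Q G where "Q \<subseteq> {0..} \<times> U" "openin (top_of_set ({0..} \<times> UNIV)) Q" "{0..} \<times> S \<subseteq> Q"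
    "\<And>s t \<xi>. (t, \<xi>) \<in> Q \<Longrightarrow> 0 \<le> s \<Longrightarrow> s \<le> t \<Longrightarrow> (s, \<xi>) \<in> Q"
    "openin (top_of_set ({0..} \<times> UNIV)) ((\<lambda>(t, \<xi>). (t, Z t \<xi>)) ` Q)"
    "(\<lambda>(t, \<xi>). (t, Z t \<xi>)) ` Q \<subseteq> V"
    "\<And>t \<xi>. (t, \<xi>) \<in> Q \<Longrightarrow> G (t, Z t \<xi>) = \<xi>"
    "C1_on ((\<lambda>(t, \<xi>). (t, Z t \<xi>)) ` Q) G"
proof -
  obtain f' where f': "\<And>x. x \<in> {0..} \<times> U \<Longrightarrow> ((\<lambda>(t, \<xi>). Z t \<xi>) has_derivative blinfun_apply (f' x)) (at x within {0..} \<times> U)"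
    and f'c: "continuous_on ({0..} \<times> U) f'"
    using C1 unfolding C1_on_def by blast
  define in2 where "in2 = Blinfun (\<lambda>k :: 'a. (0 :: real, k))"
  have bl: "bounded_linear (\<lambda>k :: 'a. (0 :: real, k))"
    by (intro bounded_linear_Pair bounded_linear_ident bounded_linear_zero)
  have in2: "in2 k = (0, k)" for k by (simp add: in2_def bounded_linear_Blinfun_apply[OF bl])
  define DZ where "DZ = (\<lambda>t \<xi>. f' (t, \<xi>) o\<^sub>L in2)"
  have deriv: "(Z t has_derivative blinfun_apply (DZ t \<xi>)) (at \<xi>)" if "0 \<le> t" "\<xi> \<in> U" for t \<xi>
  proof -
    have "((\<lambda>\<xi>. (t, \<xi>)) has_derivative (\<lambda>k. (0, k))) (at \<xi> within U)"
      by (auto intro!: derivative_eq_intros)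
    then have "((\<lambda>\<xi>. (\<lambda>(t, \<xi>). Z t \<xi>) (t, \<xi>)) has_derivative (\<lambda>k. f' (t, \<xi>) (0, k))) (at \<xi> within U)"
      using that by (intro has_derivative_in_compose2[where f = "\<lambda>\<xi>. (t, \<xi>)" and g' = "\<lambda>x. blinfun_apply (f' x)", OF f']) auto
    then show ?thesis using that U by (simp add: at_within_open[OF _ U] DZ_def in2 o_def comp_def blinfun_compose.rep_eq)
  qed
  have DZc: "continuous_on ({0..} \<times> U) (\<lambda>(t, \<xi>). DZ t \<xi>)"
    unfolding DZ_def case_prod_unfold
    using f'c by (intro bounded_bilinear.continuous_on[OF bounded_bilinear_blinfun_compose] continuous_intros) simp
  have Zc: "continuous_on ({0..} \<times> U) (\<lambda>(t, \<xi>). Z t \<xi>)" by (rule C1_on_continuous_on[OF C1])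
  define N where "N = (\<lambda>r. \<Union>p\<in>S. ball p r)"
  have N: "open (N r)" for r unfolding N_def by auto
  have "\<exists>r>0. (\<forall>s \<xi>. 0 \<le> s \<longrightarrow> s \<le> T \<longrightarrow> \<xi> \<in> N r \<longrightarrow> \<xi> \<in> U \<and> (s, Z s \<xi>) \<in> V \<and> (\<forall>k. DZ s \<xi> k = 0 \<longrightarrow> k = 0)) \<and>
      (\<forall>s. 0 \<le> s \<longrightarrow> s \<le> T \<longrightarrow> inj_on (Z s) (N r))" for T
    unfolding N_def
    by (rule uniform_injectivity_radius[OF U S deriv DZc Zc inj _ V, of T]) (use reg deriv S in blast)+
  then obtain r where r: "\<And>T. 0 < r T"
    "\<And>T s \<xi>. 0 \<le> s \<Longrightarrow> s \<le> T \<Longrightarrow> \<xi> \<in> N (r T) \<Longrightarrow> \<xi> \<in> U \<and> (s, Z s \<xi>) \<in> V \<and> (\<forall>k. DZ s \<xi> k = 0 \<longrightarrow> k = 0)"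
    "\<And>T s. 0 \<le> s \<Longrightarrow> s \<le> T \<Longrightarrow> inj_on (Z s) (N (r T))"
    by metis
  define Qr where "Qr = (\<Union>T. {-T<..<T} \<times> N (r T))"
  have Qr: "open Qr" unfolding Qr_def using N by (auto intro!: open_Times)
  have Qr_iff: "(t, \<xi>) \<in> Qr \<longleftrightarrow> (\<exists>T>\<bar>t\<bar>. \<xi> \<in> N (r T))" for t \<xi>
    unfolding Qr_def by (force simp: abs_less_iff)
  define Q where "Q = ({0..} \<times> UNIV) \<inter> Qr"
  have Q_iff: "(t, \<xi>) \<in> Q \<longleftrightarrow> 0 \<le> t \<and> (\<exists>T>t. \<xi> \<in> N (r T))" for t \<xi> by (auto simp: Q_def Qr_iff)
  have QrU: "\<xi> \<in> U" "(\<bar>t\<bar>, Z \<bar>t\<bar> \<xi>) \<in> V" "DZ \<bar>t\<bar> \<xi> k = 0 \<Longrightarrow> k = 0" if "(t, \<xi>) \<in> Qr" for t \<xi> k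
  proof -
    from that obtain T where "\<bar>t\<bar> < T" "\<xi> \<in> N (r T)" by (auto simp: Qr_iff)
    then show "\<xi> \<in> U" "(\<bar>t\<bar>, Z \<bar>t\<bar> \<xi>) \<in> V" "DZ \<bar>t\<bar> \<xi> k = 0 \<Longrightarrow> k = 0"
      using r(2)[of "\<bar>t\<bar>" T \<xi>] by auto
  qed
  define F where "F = (\<lambda>(t, \<xi>). (t, Z \<bar>t\<bar> \<xi>))"
  have injF: "inj_on F Qr"
  proof (rule inj_onI, clarsimp simp: F_def)
    fix t \<xi> \<xi>' assume q: "(t, \<xi>) \<in> Qr" "(t, \<xi>') \<in> Qr" and eq: "Z \<bar>t\<bar> \<xi> = Z \<bar>t\<bar> \<xi>'"
    obtain T T' where T: "\<bar>t\<bar> < T" "\<xi> \<in> N (r T)" "\<bar>t\<bar> < T'" "\<xi>' \<in> N (r T')" using q by (auto simp: Qr_iff)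
    \<comment> \<open>Both radii are valid at this time, so the larger of the two neighborhoods
      contains both points and gives injectivity.\<close>
    have mono: "N a \<subseteq> N b" if "a \<le> b" for a b using that by (force simp: N_def)
    obtain T'' where "\<bar>t\<bar> \<le> T''" "\<xi> \<in> N (r T'')" "\<xi>' \<in> N (r T'')"
      using T mono[of "r T" "r T'"] mono[of "r T'" "r T"]
      by (metis less_imp_le linorder_linear subsetD)
    then show "\<xi> = \<xi>'" using r(3)[of "\<bar>t\<bar>" T''] eq by (auto simp: inj_on_def)
  qed
  have Fc: "continuous_on Qr F"
    unfolding F_def case_prod_unfold
    by (intro continuous_intros continuous_on_compose_Pair[OF Zc]) (use QrU in \<open>force+\<close>)
  have FQr: "open (F ` Qr)" by (rule invariance_of_domain[OF Fc Qr injF])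
  define Fi where "Fi = inv_into Qr F"
  have FiF: "Fi (F x) = x" if "x \<in> Qr" for x unfolding Fi_def using injF that by simp
  have Fic: "continuous_on (F ` Qr) Fi"
    by (rule continuous_on_inverse_open[OF Qr Fc]) (auto simp: FiF)
  have img: "(\<lambda>(t, \<xi>). (t, Z t \<xi>)) ` Q = ({0..} \<times> UNIV) \<inter> F ` Qr"
    by (force simp: Q_def F_def)
  have FQ: "(\<lambda>(t, \<xi>). (t, Z t \<xi>)) ` Q = F ` Q" by (force simp: Q_def F_def)
  have QU: "Q \<subseteq> {0..} \<times> U" using QrU by (auto simp: Q_def)
  have QQr: "Q \<subseteq> Qr" by (auto simp: Q_def)
  define F' where "F' = (\<lambda>x. Blinfun (\<lambda>h :: real \<times> 'a. (fst h, f' x h)))"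
  have F': "F' x h = (fst h, f' x h)" for x h
    unfolding F'_def
    by (subst bounded_linear_Blinfun_apply) (auto intro!: bounded_linear_Pair bounded_linear_fst blinfun.bounded_linear_right)
  have F'c: "continuous_on Q F'"
    by (rule continuous_on_blinfun_componentwise)
       (auto simp: F' intro!: continuous_intros continuous_on_subset[OF f'c QU])
  have FD: "(F has_derivative F' x) (at x within Q)" if x: "x \<in> Q" for x
  proof -
    have "((\<lambda>(t, \<xi>). Z t \<xi>) has_derivative blinfun_apply (f' x)) (at x within Q)"
      by (rule has_derivative_subset[OF f' QU]) (use x QU in auto)
    then have "((\<lambda>x. (fst x, (\<lambda>(t, \<xi>). Z t \<xi>) x)) has_derivative (\<lambda>h. (fst h, f' x h))) (at x within Q)"
      by (intro has_derivative_Pair has_derivative_fst has_derivative_ident)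
    then have "(F has_derivative (\<lambda>h. (fst h, f' x h))) (at x within Q)"
      by (rule has_derivative_transform[OF x, rotated]) (auto simp: F_def Q_def)
    moreover have "blinfun_apply (F' x) = (\<lambda>h. (fst h, f' x h))" by (simp add: fun_eq_iff F')
    ultimately show ?thesis by simp
  qed
  \<comment> \<open>Time is preserved, so the derivative is block triangular: a kernel vector has no
    time component, and its spatial part is in the kernel of \<open>DZ\<close>.\<close>
  have F'inj: "h = 0" if "x \<in> Q" "F' x h = 0" for x h
  proof -
    obtain t \<xi> where x: "x = (t, \<xi>)" "0 \<le> t" "(t, \<xi>) \<in> Qr" using \<open>x \<in> Q\<close> by (cases x) (auto simp: Q_def)
    obtain a k where h: "h = (a, k)" by (cases h)
    have "a = 0" "f' (t, \<xi>) (0, k) = 0" using that(2) by (auto simp: F' h x zero_prod_def)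
    then show ?thesis using QrU(3)[OF x(3), of k] x(2) by (simp add: DZ_def in2 h zero_prod_def)
  qed
  have "\<exists>B :: (real \<times> 'a) \<Rightarrow>\<^sub>L (real \<times> 'a). (\<forall>h. B (F' x h) = h) \<and> (\<forall>h. F' x (B h) = h)" if "x \<in> Q" for x
  proof -
    have lin: "linear (F' x)" by (simp add: blinfun.bounded_linear_right bounded_linear.linear)
    moreover have "inj (F' x)" using F'inj[OF that] lin by (simp add: linear_injective_0)
    ultimately obtain b where b: "linear b" "\<forall>h. b (F' x h) = h" "\<forall>h. F' x (b h) = h"
      using linear_injective_isomorphism by blast
    then show ?thesis
      using bounded_linear_Blinfun_apply[of b] linear_conv_bounded_linear[of b] by (intro exI[of _ "Blinfun b"]) auto
  qed
  then obtain B :: "real \<times> 'a \<Rightarrow> (real \<times> 'a) \<Rightarrow>\<^sub>L (real \<times> 'a)" where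
    B: "\<And>x h. x \<in> Q \<Longrightarrow> B x (F' x h) = h" "\<And>x h. x \<in> Q \<Longrightarrow> F' x (B x h) = h"
    by metis
  have Bc: "continuous_on Q B" by (rule continuous_on_blinfun_inverse[OF F'c B])
  have Fic': "continuous_on (F ` Q) Fi" by (rule continuous_on_subset[OF Fic]) (use QQr in auto)
  have "C1_on (F ` Q) Fi"
    unfolding C1_on_def
  proof (intro exI[of _ "\<lambda>y. B (Fi y)"] conjI ballI)
    fix y assume "y \<in> F ` Q"
    then obtain x where x: "x \<in> Q" "y = F x" by auto
    have "(Fi has_derivative B x) (at (F x) within F ` Q)"
    proof (rule has_derivative_inverse_within[OF FD[OF x(1)] _ x(1)])
      show "continuous (at (F x) within F ` Q) Fi"
        using Fic' x by (auto simp: continuous_on_eq_continuous_within)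
      show "linear (B x)" by (simp add: blinfun.bounded_linear_right bounded_linear.linear)
      show "blinfun_apply (B x) \<circ> blinfun_apply (F' x) = id" using B(1)[OF x(1)] by (simp add: fun_eq_iff)
    qed (use FiF QQr in auto)
    then show "(Fi has_derivative blinfun_apply (B (Fi y))) (at y within F ` Q)"
      using FiF[of x] QQr x by auto
  next
    show "continuous_on (F ` Q) (\<lambda>y. B (Fi y))"
      by (rule continuous_on_compose2[OF Bc Fic']) (use FiF QQr in auto)
  qed
  from C1_on_linear_comp[OF bounded_linear_snd this]
  have C1G: "C1_on ((\<lambda>(t, \<xi>). (t, Z t \<xi>)) ` Q) (\<lambda>y. snd (Fi y))" by (simp add: FQ)
  show ?thesis
  proof (rule that[OF QU _ _ _ _ _ _ C1G])
    show "openin (top_of_set ({0..} \<times> UNIV)) Q" unfolding Q_def using Qr by (rule openin_open_Int)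
    show "{0..} \<times> S \<subseteq> Q"
    proof (clarsimp simp: Q_iff)
      fix t \<xi> assume "\<xi> \<in> S"
      then show "\<exists>T>t. \<xi> \<in> N (r T)" using r(1)[of "t + 1"] by (intro exI[of _ "t + 1"]) (auto simp: N_def intro!: bexI[of _ \<xi>])
    qed
    show "(s, \<xi>) \<in> Q" if "(t, \<xi>) \<in> Q" "0 \<le> s" "s \<le> t" for s t \<xi>
      using that by (auto simp: Q_iff intro: le_less_trans)
    show "openin (top_of_set ({0..} \<times> UNIV)) ((\<lambda>(t, \<xi>). (t, Z t \<xi>)) ` Q)"
      unfolding img using FQr by (rule openin_open_Int)
    show "(\<lambda>(t, \<xi>). (t, Z t \<xi>)) ` Q \<subseteq> V" using QrU(2) by (force simp: Q_def)
    show "snd (Fi (t, Z t \<xi>)) = \<xi>" if "(t, \<xi>) \<in> Q" for t \<xi>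
      using FiF[of "(t, \<xi>)"] that by (simp add: Q_def F_def)
  qed
qed

section \<open>The characteristics\<close>

lemma C1_on_mult:
  fixes f g :: "'a::real_normed_vector \<Rightarrow> real"
  shows "C1_on S f \<Longrightarrow> C1_on S g \<Longrightarrow> C1_on S (\<lambda>x. f x * g x)"
  by (rule C1_on_bounded_bilinear[OF bounded_bilinear_mult])

lemmas C1_on_scaleR = C1_on_bounded_bilinear[OF bounded_bilinear_scaleR]
lemmas C1_on_inner = C1_on_bounded_bilinear[OF bounded_bilinear_inner]

lemma C1_on_divide:
  fixes f g :: "'a::real_normed_vector \<Rightarrow> real"
  assumes "C1_on S f" "C1_on S g" "\<And>x. x \<in> S \<Longrightarrow> g x \<noteq> 0"
  shows "C1_on S (\<lambda>x. f x / g x)"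
  unfolding divide_inverse
  by (intro C1_on_mult assms(1) C1_on_compose[OF C1_on_inverse assms(2)]) (use assms(3) in auto)

lemma C1_on_norm_compose:
  fixes f :: "'a::real_normed_vector \<Rightarrow> 'b::real_inner"
  assumes "C1_on S f" "\<And>x. x \<in> S \<Longrightarrow> f x \<noteq> 0"
  shows "C1_on S (\<lambda>x. norm (f x))"
  by (rule C1_on_compose[OF C1_on_norm assms(1)]) (use assms(2) in auto)

lemma grad_eqI:
  assumes "(f has_derivative (\<lambda>h. p \<bullet> h)) (at x)"
  shows "grad f x = p"
  unfolding grad_def
proof (rule the_equality)
  show "GDERIV f x :> p" using assms by (simp add: gderiv_def inner_commute)
  fix D assume "GDERIV f x :> D"
  then have "(\<lambda>h. h \<bullet> D) = (\<lambda>h. p \<bullet> h)"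
    using has_derivative_unique assms by (auto simp: gderiv_def)
  then show "D = p" by (metis inner_commute vector_eq_rdot)
qed

text \<open>At time 0 only forward time increments are available. They suffice because the basis
  vectors have a nonnegative time component, so a small positive multiple of each stays in the half
  space.\<close>

lemma has_derivative_unique_time_space:
  fixes f :: "real \<times> 'a::euclidean_space \<Rightarrow> 'b::real_normed_vector"
  assumes S: "openin (top_of_set ({0..} \<times> UNIV)) S" and x: "x \<in> S"
    and f': "(f has_derivative f') (at x within S)" and f'': "(f has_derivative f'') (at x within S)"
  shows "f' = f''"
proof (rule frechet_derivative_unique_within[OF f' f''])
  fix i :: "real \<times> 'a" and e :: real
  assume i: "i \<in> Basis" and e: "0 < e"
  obtain S' where S': "open S'" "S = ({0..} \<times> UNIV) \<inter> S'" using S by (auto simp: openin_open)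
  obtain r where r: "0 < r" "ball x r \<subseteq> S'" using S' x by (auto simp: open_contains_ball)
  define d where "d = min r e / 2"
  have d: "0 < d" "d < r" "d < e" using r e by (auto simp: d_def)
  have "norm i = 1" using i by simp
  then have "x + d *\<^sub>R i \<in> ball x r" using d by (simp add: dist_norm)
  moreover have "0 \<le> fst i" using i by (auto simp: Basis_prod_def)
  then have "0 \<le> fst (x + d *\<^sub>R i)" using x d S' by auto
  ultimately have "x + d *\<^sub>R i \<in> S" using S' r by (cases "x + d *\<^sub>R i") auto
  then show "\<exists>d. 0 < \<bar>d\<bar> \<and> \<bar>d\<bar> < e \<and> x + d *\<^sub>R i \<in> S" using d by (intro exI[of _ d]) auto
qed

text \<open>The supremum of the admissible radii is nonincreasing in time but need not be admissible
  itself; half of it lies below an admissible radius. The cap at 1 keeps the supremum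
  finite.\<close>

lemma antimono_selection:
  fixes P :: "real \<Rightarrow> real \<Rightarrow> bool"
  assumes ex: "\<And>T. 0 \<le> T \<Longrightarrow> \<exists>e>0. P T e"
    and time: "\<And>S T e. 0 \<le> S \<Longrightarrow> S \<le> T \<Longrightarrow> P T e \<Longrightarrow> P S e"
    and down: "\<And>T e e'. 0 < e' \<Longrightarrow> e' \<le> e \<Longrightarrow> P T e \<Longrightarrow> P T e'"
  obtains \<epsilon> where "antimono_on {0..} \<epsilon>" "\<And>T. 0 \<le> T \<Longrightarrow> 0 < \<epsilon> T" "\<And>T. 0 \<le> T \<Longrightarrow> P T (\<epsilon> T)"
proof -
  define E where "E = (\<lambda>T. {e. 0 < e \<and> e \<le> 1 \<and> P T e})"
  have ne: "E T \<noteq> {}" if T: "0 \<le> T" for T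
  proof -
    obtain e where "0 < e" "P T e" using ex[OF T] by blast
    then have "min 1 e \<in> E T" using down[of "min 1 e" e T] by (auto simp: E_def)
    then show ?thesis by blast
  qed
  have bdd: "bdd_above (E T)" for T by (auto simp: E_def)
  define \<epsilon> where "\<epsilon> = (\<lambda>T. Sup (E T) / 2)"
  have pos: "0 < Sup (E T)" if "0 \<le> T" for T
    using ne[OF that] cSup_upper[OF _ bdd, of _ T] by (force simp: E_def)
  show ?thesis
  proof (rule that[of \<epsilon>])
    show "antimono_on {0..} \<epsilon>"
    proof (rule monotone_onI)
      fix S T :: real assume "S \<in> {0..}" "T \<in> {0..}" "S \<le> T"
      then have "E T \<subseteq> E S" using time by (auto simp: E_def)
      then show "\<epsilon> T \<le> \<epsilon> S" unfolding \<epsilon>_def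
        using cSup_subset_mono[OF ne bdd] \<open>T \<in> {0..}\<close> by simp
    qed
    fix T :: real assume T: "0 \<le> T"
    show "0 < \<epsilon> T" using pos[OF T] by (simp add: \<epsilon>_def)
    have "\<epsilon> T < Sup (E T)" using pos[OF T] by (simp add: \<epsilon>_def)
    then obtain e where "e \<in> E T" "\<epsilon> T < e" using less_cSup_iff[OF ne[OF T] bdd] by blast
    then show "P T (\<epsilon> T)" using down[OF \<open>0 < \<epsilon> T\<close>, of e T] by (auto simp: E_def)
  qed
qed

text \<open>Along the characteristics the value \<open>u\<close> and the gradient \<open>P\<close> are explicit in terms of the flow;
  the identity below says that \<open>du = P dx - H dt\<close>, so no differential equation for them
  has to be solved.\<close>

lemma characteristic_derivative:
  fixes g :: "real \<times> 'a::real_inner \<Rightarrow> real" and p w :: "real \<times> 'a \<Rightarrow> 'a" and y :: "real \<times> 'a \<Rightarrow> 'a"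
  defines "\<eta> \<equiv> \<lambda>x. snd x - (g x / (norm (p x))\<^sup>2) *\<^sub>R p x"
  defines "Z \<equiv> \<lambda>x. y (fst x, \<eta> x) + (g x / (norm (w x))\<^sup>2) *\<^sub>R w x"
    and "u \<equiv> \<lambda>x. g x * norm (p x) / norm (w x)"
    and "P \<equiv> \<lambda>x. (norm (p x) / norm (w x)) *\<^sub>R w x"
  assumes x: "x \<in> S"
    and g: "(g has_derivative (\<lambda>d. p x \<bullet> snd d)) (at x within S)"
    and p: "(p has_derivative p') (at x within S)"
    and w: "(w has_derivative w') (at x within S)"
    and nz: "p x \<noteq> 0" "w x \<noteq> 0"
    and y: "(y has_derivative (\<lambda>(a, k). a *\<^sub>R V + A k)) (at (fst x, \<eta> x) within T)"
    and ST: "\<And>x. x \<in> S \<Longrightarrow> (fst x, \<eta> x) \<in> T"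
    and A: "\<And>k. w x \<bullet> A k = p x \<bullet> k"
  shows "\<exists>Z' u'. (Z has_derivative Z') (at x within S) \<and> (u has_derivative u') (at x within S) \<and>
    (\<forall>d. u' d = P x \<bullet> Z' d - fst d * (P x \<bullet> V)) \<and> (g x = 0 \<longrightarrow> (\<forall>k. Z' (0, k) = 0 \<longrightarrow> A k = 0))"
proof -
  define N where "N = norm (p x)"
  define M where "M = norm (w x)"
  have pos: "0 < N" "0 < M" using nz by (auto simp: N_def M_def)
  define N' where "N' = (\<lambda>d. (p x \<bullet> p' d) / N)"
  define M' where "M' = (\<lambda>d. (w x \<bullet> w' d) / M)"
  have ND: "((\<lambda>x. norm (p x)) has_derivative N') (at x within S)"
    by (rule has_derivative_eq_rhs[OF has_derivative_compose[OF p has_derivative_norm[OF nz(1)]]])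
       (simp add: fun_eq_iff N'_def N_def sgn_div_norm inner_commute divide_inverse)
  have MD: "((\<lambda>x. norm (w x)) has_derivative M') (at x within S)"
    by (rule has_derivative_eq_rhs[OF has_derivative_compose[OF w has_derivative_norm[OF nz(2)]]])
       (simp add: fun_eq_iff M'_def M_def sgn_div_norm inner_commute divide_inverse)
  have quot: "((\<lambda>x. g x / (norm (f x))\<^sup>2) has_derivative (\<lambda>d. (p x \<bullet> snd d) / F^2 - 2 * g x * F' d / F^3)) (at x within S)"
    if "((\<lambda>x. norm (f x)) has_derivative F') (at x within S)" "F = norm (f x)" "0 < F" for f :: "real \<times> 'a \<Rightarrow> 'a" and F F'
    using that(2,3)
    by (auto intro!: derivative_eq_intros g that(1) simp: fun_eq_iff field_simps power2_eq_square power3_eq_cube)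
  define \<eta>' where "\<eta>' = (\<lambda>d. snd d - ((g x / N^2) *\<^sub>R p' d + ((p x \<bullet> snd d) / N^2 - 2 * g x * N' d / N^3) *\<^sub>R p x))"
  have \<eta>D: "(\<eta> has_derivative \<eta>') (at x within S)"
    unfolding \<eta>_def \<eta>'_def N_def
    by (intro has_derivative_diff has_derivative_snd has_derivative_ident has_derivative_scaleR
        quot[OF ND, unfolded N_def] p) (use pos in \<open>simp_all add: N_def\<close>)
  have yD: "((\<lambda>x. y (fst x, \<eta> x)) has_derivative (\<lambda>d. fst d *\<^sub>R V + A (\<eta>' d))) (at x within S)"
  proof -
    have "((\<lambda>x. (fst x, \<eta> x)) has_derivative (\<lambda>d. (fst d, \<eta>' d))) (at x within S)"
      by (intro has_derivative_Pair has_derivative_fst has_derivative_ident \<eta>D)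
    moreover have "(y has_derivative (\<lambda>(a, k). a *\<^sub>R V + A k)) (at (fst x, \<eta> x) within (\<lambda>x. (fst x, \<eta> x)) ` S)"
      by (rule has_derivative_subset[OF y]) (use ST in auto)
    ultimately show ?thesis
      using has_derivative_in_compose[of "\<lambda>x. (fst x, \<eta> x)" _ x S y] by fastforce
  qed
  define Z' where "Z' = (\<lambda>d. fst d *\<^sub>R V + A (\<eta>' d)
      + ((g x / M^2) *\<^sub>R w' d + ((p x \<bullet> snd d) / M^2 - 2 * g x * M' d / M^3) *\<^sub>R w x))"
  have ZD: "(Z has_derivative Z') (at x within S)"
    unfolding Z_def Z'_def M_def
    by (intro has_derivative_add yD has_derivative_scaleR quot[OF MD, unfolded M_def] w)
       (use pos in \<open>simp_all add: M_def\<close>)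
  define u' where "u' = (\<lambda>d. (p x \<bullet> snd d) * N / M + g x * N' d / M - g x * N * M' d / M^2)"
  have uD: "(u has_derivative u') (at x within S)"
    unfolding u_def u'_def using pos
    by (auto intro!: derivative_eq_intros g ND MD simp: N_def M_def fun_eq_iff field_simps power2_eq_square)
  \<comment> \<open>Only the component of \<open>Z' d\<close> along \<open>w x\<close> enters, and
    there the pairing \<open>w x \<bullet> A k = p x \<bullet> k\<close> eliminates the operator
    \<open>A\<close>. The derivative of \<open>p\<close> survives only through \<open>N'\<close>,
    that of \<open>w\<close> only through \<open>M'\<close>.\<close>
  have identity: "u' d = P x \<bullet> Z' d - fst d * (P x \<bullet> V)" for d
  proof -
    have pp: "p x \<bullet> p x = N^2" "p x \<bullet> p' d = N * N' d" using pos by (simp_all add: N_def N'_def power2_norm_eq_inner)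
    have ww: "w x \<bullet> w x = M^2" "w x \<bullet> w' d = M * M' d" using pos by (simp_all add: M_def M'_def power2_norm_eq_inner)
    have "p x \<bullet> \<eta>' d = g x * N' d / N"
      using pos by (simp add: \<eta>'_def inner_diff_right inner_add_right pp field_simps power2_eq_square power3_eq_cube)
    then have wZ: "w x \<bullet> Z' d = fst d * (w x \<bullet> V) + g x * N' d / N + (p x \<bullet> snd d) - g x * M' d / M"
      using pos by (simp add: Z'_def inner_add_right A ww field_simps power2_eq_square power3_eq_cube)
    have "P x \<bullet> h = N / M * (w x \<bullet> h)" for h by (simp add: P_def N_def M_def)
    then have "P x \<bullet> Z' d - fst d * (P x \<bullet> V) = N / M * (w x \<bullet> Z' d - fst d * (w x \<bullet> V))"
      by (simp add: algebra_simps)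
    also have "\<dots> = N / M * (g x * N' d / N + p x \<bullet> snd d - g x * M' d / M)" by (simp add: wZ)
    also have "\<dots> = u' d" using pos by (simp add: u'_def field_simps power2_eq_square)
    finally show ?thesis ..
  qed
  \<comment> \<open>At a zero of \<open>g\<close>, a vanishing \<open>Z' (0, k)\<close> gives
    \<open>u' (0, k) = 0\<close> by the identity, hence \<open>p x \<bullet> k = 0\<close>. Then all
    correction terms drop out and \<open>Z' (0, k)\<close> is \<open>A k\<close>.\<close>
  have "A k = 0" if "g x = 0" "Z' (0, k) = 0" for k
  proof -
    have "u' (0, k) = 0" using identity[of "(0, k)"] that by simp
    then have "p x \<bullet> k = 0" using that(1) pos by (simp add: u'_def)
    then show ?thesis using that by (simp add: Z'_def \<eta>'_def)
  qed
  then show ?thesis using ZD uD identity by blast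
qed

text \<open>Reflection in time and invariance of domain, now for the flow on all of \<Omega>. The
  continuous inverse \<open>H\<close> later pulls characteristics back to initial points, and the
  open image is the target to which the characteristics are confined.\<close>

lemma openin_time_space_image:
  fixes Y :: "real \<Rightarrow> 'a::euclidean_space \<Rightarrow> 'a"
  assumes \<Omega>: "open \<Omega>" and cont: "continuous_on ({0..} \<times> \<Omega>) (\<lambda>(t, x). Y t x)"
    and inj: "\<And>t. 0 \<le> t \<Longrightarrow> inj_on (Y t) \<Omega>"
  obtains H where "openin (top_of_set ({0..} \<times> UNIV)) ((\<lambda>(t, x). (t, Y t x)) ` ({0..} \<times> \<Omega>))"
    "continuous_on ((\<lambda>(t, x). (t, Y t x)) ` ({0..} \<times> \<Omega>)) H"
    "\<And>t x. 0 \<le> t \<Longrightarrow> x \<in> \<Omega> \<Longrightarrow> H (t, Y t x) = x"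
proof -
  define F where "F = (\<lambda>(t, x). (t, Y \<bar>t\<bar> x))"
  have op: "open ((UNIV :: real set) \<times> \<Omega>)" using \<Omega> by (simp add: open_Times)
  have Fc: "continuous_on (UNIV \<times> \<Omega>) F"
    using continuous_on_abs_time[OF cont]
    unfolding F_def case_prod_unfold by (intro continuous_intros)
  have injF: "inj_on F (UNIV \<times> \<Omega>)"
    by (auto simp: F_def intro!: inj_onI dest: inj_onD[OF inj[OF abs_ge_zero]])
  define Fi where "Fi = inv_into (UNIV \<times> \<Omega>) F"
  have FiF: "Fi (F x) = x" if "x \<in> UNIV \<times> \<Omega>" for x unfolding Fi_def using injF that by (rule inv_into_f_f)
  have Fic: "continuous_on (F ` (UNIV \<times> \<Omega>)) Fi"
    by (rule continuous_on_inverse_open[OF op Fc]) (auto simp: FiF)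
  have img: "(\<lambda>(t, x). (t, Y t x)) ` ({0..} \<times> \<Omega>) = ({0..} \<times> UNIV) \<inter> F ` (UNIV \<times> \<Omega>)"
    by (force simp: F_def)
  show ?thesis
  proof (rule that[of "snd \<circ> Fi"])
    show "openin (top_of_set ({0..} \<times> UNIV)) ((\<lambda>(t, x). (t, Y t x)) ` ({0..} \<times> \<Omega>))"
      unfolding img by (rule openin_open_Int) (rule invariance_of_domain[OF Fc op injF])
    show "continuous_on ((\<lambda>(t, x). (t, Y t x)) ` ({0..} \<times> \<Omega>)) (snd \<circ> Fi)"
      unfolding img o_def by (intro continuous_on_snd continuous_on_subset[OF Fic]) auto
    show "(snd \<circ> Fi) (t, Y t x) = x" if "0 \<le> t" "x \<in> \<Omega>" for t x
      using FiF[of "(t, x)"] that by (simp add: F_def)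
  qed
qed

lemma C2_on_grad:
  fixes f :: "real^3 \<Rightarrow> real"
  assumes "C2_on U f" "open U"
  shows "C1_on U (grad f)" "x \<in> U \<Longrightarrow> (f has_derivative (\<lambda>h. grad f x \<bullet> h)) (at x)"
proof -
  obtain f' where f': "\<And>x. x \<in> U \<Longrightarrow> (f has_derivative blinfun_apply (f' x)) (at x within U)" and C1: "C1_on U f'"
    using assms(1) unfolding C2_on_def by blast
  define p where "p = (\<lambda>x. \<Sum>i\<in>Basis. f' x i *\<^sub>R i)"
  have "f' x h = p x \<bullet> h" for x h
  proof -
    have "f' x h = f' x (\<Sum>i\<in>Basis. (h \<bullet> i) *\<^sub>R i)" by (simp add: euclidean_representation)
    also have "\<dots> = (\<Sum>i\<in>Basis. (h \<bullet> i) * f' x i)" by (simp add: blinfun.sum_right blinfun.scaleR_right)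
    also have "\<dots> = p x \<bullet> h" by (simp add: p_def inner_sum_left inner_commute[of h] mult.commute)
    finally show ?thesis .
  qed
  then have "blinfun_apply (f' x) = (\<lambda>h. p x \<bullet> h)" for x by blast
  then have D: "(f has_derivative (\<lambda>h. p x \<bullet> h)) (at x)" if "x \<in> U" for x
    using f'[OF that] unfolding at_within_open[OF that assms(2)] by simp
  have g: "grad f x = p x" if "x \<in> U" for x by (rule grad_eqI[OF D[OF that]])
  have "bounded_linear (\<lambda>A :: (real^3) \<Rightarrow>\<^sub>L real. \<Sum>i\<in>Basis. A i *\<^sub>R (i :: real^3))"
    by (intro bounded_linear_sum bounded_linear_compose[OF bounded_linear_scaleR_left] blinfun.bounded_linear_left)
  from C1_on_linear_comp[OF this C1] have "C1_on U p" by (simp add: p_def)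
  then show "C1_on U (grad f)" by (rule C1_on_cong) (simp add: g)
  show "x \<in> U \<Longrightarrow> (f has_derivative (\<lambda>h. grad f x \<bullet> h)) (at x)" using D g by simp
qed

text \<open>\<open>U\<close> is cut out by two open conditions: the gradient does not vanish, and
  \<eta> maps into \<Omega>. Both hold on \<open>S\<close>, where \<phi>0 vanishes and \<eta> is the
  identity. The conormal cannot vanish, because its pairing with \<open>DY t \<eta> k\<close> is
  \<open>p \<bullet> k\<close>, which is nonzero for \<open>k = p\<close>; hence the quotients in
  \<open>Z\<close>, \<open>u\<close> and \<open>P\<close> are C1.\<close>

lemma characteristic_map:
  fixes \<Omega> S U0 :: "(real^3) set"
  assumes bdd: "bounded \<Omega>" and op: "open \<Omega>" and H1: "H1 \<Omega> v" and H2: "H2 \<Omega> v"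
    and U0: "open U0" "U0 \<subseteq> \<Omega>" and C2: "C2_on U0 \<phi>0"
    and S: "S \<subseteq> U0" "\<And>x. x \<in> S \<Longrightarrow> \<phi>0 x = 0" "\<And>x. x \<in> S \<Longrightarrow> grad \<phi>0 x \<noteq> 0"
  obtains U and Z :: "real \<Rightarrow> real^3 \<Rightarrow> real^3" and u :: "real \<times> (real^3) \<Rightarrow> real"
    and P Yb :: "real \<times> (real^3) \<Rightarrow> real^3" where
    "open U" "S \<subseteq> U" "U \<subseteq> U0"
    "C1_on ({0..} \<times> U) (\<lambda>(t, \<xi>). Z t \<xi>)" "C1_on ({0..} \<times> U) P" "C1_on ({0..} \<times> U) Yb"
    "\<And>x. x \<in> {0..} \<times> U \<Longrightarrow> Yb x \<in> \<Omega>"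
    "\<And>t \<xi>. 0 \<le> t \<Longrightarrow> \<xi> \<in> U \<Longrightarrow> Z t \<xi> - (u (t, \<xi>) / (norm (P (t, \<xi>)))\<^sup>2) *\<^sub>R P (t, \<xi>) = Yb (t, \<xi>)"
    "\<And>\<xi>. \<xi> \<in> U \<Longrightarrow> Z 0 \<xi> = \<xi>" "\<And>\<xi>. \<xi> \<in> U \<Longrightarrow> u (0, \<xi>) = \<phi>0 \<xi>"
    "\<And>t \<xi>. 0 \<le> t \<Longrightarrow> \<xi> \<in> S \<Longrightarrow> Z t \<xi> = flow \<Omega> v t 0 \<xi>"
    "\<And>t \<xi>. 0 \<le> t \<Longrightarrow> \<xi> \<in> U \<Longrightarrow> norm (P (t, \<xi>)) = norm (grad \<phi>0 \<xi>)"
    "\<And>\<xi>. \<xi> \<in> U \<Longrightarrow> grad \<phi>0 \<xi> \<noteq> 0"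
    "\<And>t \<xi>. 0 \<le> t \<Longrightarrow> \<xi> \<in> U \<Longrightarrow> sgn (u (t, \<xi>)) = sgn (\<phi>0 \<xi>)"
    "\<And>x. x \<in> {0..} \<times> U \<Longrightarrow> \<exists>Z' u'. ((\<lambda>(t, \<xi>). Z t \<xi>) has_derivative Z') (at x within {0..} \<times> U) \<and>
       (u has_derivative u') (at x within {0..} \<times> U) \<and>
       (\<forall>d. u' d = P x \<bullet> Z' d - fst d * (P x \<bullet> v (fst x) (Yb x)))"
    "\<And>t \<xi> D k. 0 \<le> t \<Longrightarrow> \<xi> \<in> S \<Longrightarrow> (Z t has_derivative D) (at \<xi>) \<Longrightarrow> D k = 0 \<Longrightarrow> k = 0"
proof -
  obtain q DY where C1q: "C1_on ({0..} \<times> (\<Omega> \<times> UNIV)) (\<lambda>(t, z). q t z)"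
    and q0: "\<And>\<eta> p. \<eta> \<in> \<Omega> \<Longrightarrow> q 0 (\<eta>, p) = p"
    and qDY: "\<And>t \<eta> p k. 0 \<le> t \<Longrightarrow> \<eta> \<in> \<Omega> \<Longrightarrow> q t (\<eta>, p) \<bullet> blinfun_apply (DY t \<eta>) k = p \<bullet> k"
    and C1Y: "C1_on ({0..} \<times> \<Omega>) (\<lambda>(t, \<eta>). flow \<Omega> v t 0 \<eta>)"
    and YD: "\<And>t \<eta>. 0 \<le> t \<Longrightarrow> \<eta> \<in> \<Omega> \<Longrightarrow> ((\<lambda>(t, \<eta>). flow \<Omega> v t 0 \<eta>) has_derivative
        (\<lambda>(a, k). a *\<^sub>R v t (flow \<Omega> v t 0 \<eta>) + DY t \<eta> k)) (at (t, \<eta>) within {0..} \<times> \<Omega>)"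
    by (rule flow_conormal[OF bdd op H1 H2]) (rule that)
  obtain L where Y\<Omega>: "\<And>t \<xi>. 0 \<le> t \<Longrightarrow> \<xi> \<in> \<Omega> \<Longrightarrow> flow \<Omega> v t 0 \<xi> \<in> \<Omega>"
    and Y0: "\<And>\<xi>. \<xi> \<in> \<Omega> \<Longrightarrow> flow \<Omega> v 0 0 \<xi> = \<xi>" and "0 \<le> (L :: real)"
    by (rule flow_in_domain[OF bdd op H1 H2]) (rule that)
  define p where "p = grad \<phi>0"
  have C1p0: "C1_on U0 p" and gD: "\<And>x. x \<in> U0 \<Longrightarrow> (\<phi>0 has_derivative (\<lambda>h. p x \<bullet> h)) (at x)"
    unfolding p_def by (rule C2_on_grad[OF C2 U0(1)])+
  define \<eta> where "\<eta> = (\<lambda>\<xi>. \<xi> - (\<phi>0 \<xi> / (norm (p \<xi>))\<^sup>2) *\<^sub>R p \<xi>)"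
  define U' where "U' = U0 \<inter> p -` (- {0})"
  have U': "open U'" unfolding U'_def
    using C1_on_continuous_on[OF C1p0] U0 by (intro continuous_open_preimage) auto
  have C1g: "C1_on U0 \<phi>0"
    unfolding C1_on_def
  proof (intro exI[of _ "\<lambda>x. blinfun_inner_right (p x)"] conjI ballI)
    show "(\<phi>0 has_derivative blinfun_apply (blinfun_inner_right (p x))) (at x within U0)" if "x \<in> U0" for x
      using gD[OF that] by (simp add: has_derivative_at_withinI blinfun_inner_right.rep_eq)
    show "continuous_on U0 (\<lambda>x. blinfun_inner_right (p x))"
      using C1_on_continuous_on[OF C1p0]
      by (rule bounded_linear.continuous_on[OF bounded_linear_blinfun_inner_right])
  qed
  have C1\<eta>: "C1_on U' \<eta>"
  proof -
    have "C1_on U' \<phi>0" "C1_on U' p" using C1g C1p0 by (auto intro: C1_on_subset simp: U'_def)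
    moreover have "p x \<noteq> 0" if "x \<in> U'" for x using that by (simp add: U'_def)
    ultimately have "C1_on U' (\<lambda>\<xi>. \<xi> + (-1) *\<^sub>R ((\<phi>0 \<xi> / (norm (p \<xi>) * norm (p \<xi>))) *\<^sub>R p \<xi>))"
      by (intro C1_on_add C1_on_scaleR C1_on_divide C1_on_mult C1_on_norm_compose C1_on_const
          C1_on_bounded_linear[OF bounded_linear_ident]) auto
    then show ?thesis by (rule C1_on_cong) (simp add: \<eta>_def power2_eq_square)
  qed
  define U where "U = U' \<inter> \<eta> -` \<Omega>"
  have U: "open U" unfolding U_def
    using C1_on_continuous_on[OF C1\<eta>] U' op by (intro continuous_open_preimage)
  have UU0: "U \<subseteq> U0" by (auto simp: U_def U'_def)
  have pnz: "p \<xi> \<noteq> 0" and \<eta>\<Omega>: "\<eta> \<xi> \<in> \<Omega>" if "\<xi> \<in> U" for \<xi> using that by (auto simp: U_def U'_def)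
  have SU: "S \<subseteq> U" using S U0 by (auto simp: U_def U'_def \<eta>_def p_def)
  define X where "X = {0::real..} \<times> U"
  define w where "w = (\<lambda>x. q (fst x) (\<eta> (snd x), p (snd x)))"
  have C1_snd: "C1_on X (\<lambda>x. f (snd x))" if "C1_on U f" for f :: "real^3 \<Rightarrow> 'b::real_normed_vector"
    by (rule C1_on_compose[OF that C1_on_bounded_linear[OF bounded_linear_snd]]) (auto simp: X_def)
  have C1_fst: "C1_on X fst" by (rule C1_on_bounded_linear[OF bounded_linear_fst])
  have C1p: "C1_on X (\<lambda>x. p (snd x))" by (intro C1_snd C1_on_subset[OF C1p0 UU0])
  have C1g': "C1_on X (\<lambda>x. \<phi>0 (snd x))" by (intro C1_snd C1_on_subset[OF C1g UU0])
  have C1\<eta>': "C1_on X (\<lambda>x. \<eta> (snd x))" by (intro C1_snd C1_on_subset[OF C1\<eta>]) (auto simp: U_def)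
  have C1w: "C1_on X w"
  proof -
    have "C1_on X (\<lambda>x. (\<lambda>(t, z). q t z) (fst x, (\<eta> (snd x), p (snd x))))"
      by (rule C1_on_compose[OF C1q C1_on_Pair[OF C1_fst C1_on_Pair[OF C1\<eta>' C1p]]]) (auto intro: \<eta>\<Omega> simp: X_def)
    then show ?thesis by (simp add: w_def)
  qed
  define Yb where "Yb = (\<lambda>x. flow \<Omega> v (fst x) 0 (\<eta> (snd x)))"
  have C1Yb: "C1_on X Yb"
  proof -
    have "C1_on X (\<lambda>x. (\<lambda>(t, z). flow \<Omega> v t 0 z) (fst x, \<eta> (snd x)))"
      by (rule C1_on_compose[OF C1Y C1_on_Pair[OF C1_fst C1\<eta>']]) (auto intro: \<eta>\<Omega> simp: X_def)
    then show ?thesis by (simp add: Yb_def)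
  qed
  have qnz: "q t (\<eta> \<xi>, k) \<noteq> 0" if "0 \<le> t" "\<xi> \<in> U" "k \<noteq> 0" for t \<xi> k
    using qDY[OF that(1) \<eta>\<Omega>[OF that(2)], of k k] that(3) by auto
  have wnz: "w x \<noteq> 0" if "x \<in> X" for x using that qnz pnz by (auto simp: w_def X_def)
  have pnz': "p (snd x) \<noteq> 0" if "x \<in> X" for x using that pnz by (auto simp: X_def)
  define Z where "Z = (\<lambda>t \<xi>. Yb (t, \<xi>) + (\<phi>0 \<xi> / (norm (w (t, \<xi>)))\<^sup>2) *\<^sub>R w (t, \<xi>))"
  define u where "u = (\<lambda>x. \<phi>0 (snd x) * norm (p (snd x)) / norm (w x))"
  define P where "P = (\<lambda>x. (norm (p (snd x)) / norm (w x)) *\<^sub>R w x)"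
  have C1Z: "C1_on X (\<lambda>(t, \<xi>). Z t \<xi>)"
  proof -
    have "C1_on X (\<lambda>x. Yb x + (\<phi>0 (snd x) / (norm (w x) * norm (w x))) *\<^sub>R w x)"
      using wnz by (intro C1_on_add C1Yb C1_on_scaleR C1_on_divide C1_on_mult C1_on_norm_compose C1g' C1w) auto
    then show ?thesis by (rule C1_on_cong) (simp add: Z_def power2_eq_square case_prod_unfold)
  qed
  have C1P: "C1_on X P" unfolding P_def
    using wnz pnz' by (intro C1_on_scaleR C1_on_divide C1_on_norm_compose C1p C1w) auto
  have normP: "norm (P (t, \<xi>)) = norm (p \<xi>)" if "0 \<le> t" "\<xi> \<in> U" for t \<xi>
    using wnz[of "(t, \<xi>)"] that by (simp add: P_def X_def)
  have deriv: "\<exists>Z' u'. ((\<lambda>(t, \<xi>). Z t \<xi>) has_derivative Z') (at x within X) \<and>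
       (u has_derivative u') (at x within X) \<and>
       (\<forall>d. u' d = P x \<bullet> Z' d - fst d * (P x \<bullet> v (fst x) (Yb x))) \<and>
       (\<phi>0 (snd x) = 0 \<longrightarrow> (\<forall>k. Z' (0, k) = 0 \<longrightarrow> DY (fst x) (\<eta> (snd x)) k = 0))"
    if x: "x \<in> X" for x
  proof -
    have xX: "0 \<le> fst x" "snd x \<in> U" using x by (auto simp: X_def)
    obtain p' where p': "((\<lambda>x. p (snd x)) has_derivative p') (at x within X)"
      using C1p x unfolding C1_on_def by blast
    obtain w' where w': "(w has_derivative w') (at x within X)"
      using C1w x unfolding C1_on_def by blast
    have "(\<phi>0 has_derivative (\<lambda>h. p (snd x) \<bullet> h)) (at (snd x))" using gD UU0 xX by blast
    then have g': "((\<lambda>x. \<phi>0 (snd x)) has_derivative (\<lambda>d. p (snd x) \<bullet> snd d)) (at x within X)"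
      by (rule has_derivative_compose[OF bounded_linear_imp_has_derivative[OF bounded_linear_snd]])
    have y': "((\<lambda>(t, \<eta>). flow \<Omega> v t 0 \<eta>) has_derivative (\<lambda>(a, k). a *\<^sub>R v (fst x) (Yb x) + DY (fst x) (\<eta> (snd x)) k))
        (at (fst x, snd x - (\<phi>0 (snd x) / (norm (p (snd x)))\<^sup>2) *\<^sub>R p (snd x)) within {0..} \<times> \<Omega>)"
      using YD[OF xX(1) \<eta>\<Omega>[OF xX(2)]] unfolding Yb_def \<eta>_def .
    have dom: "(fst x, snd x - (\<phi>0 (snd x) / (norm (p (snd x)))\<^sup>2) *\<^sub>R p (snd x)) \<in> {0..} \<times> \<Omega>" if "x \<in> X" for x
      using \<eta>\<Omega>[of "snd x"] that unfolding X_def \<eta>_def by auto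
    have A: "w x \<bullet> DY (fst x) (\<eta> (snd x)) k = p (snd x) \<bullet> k" for k
      unfolding w_def by (rule qDY[OF xX(1) \<eta>\<Omega>[OF xX(2)]])
    have Z: "(\<lambda>(t, \<xi>). Z t \<xi>) = (\<lambda>x. (case (fst x, snd x - (\<phi>0 (snd x) / (norm (p (snd x)))\<^sup>2) *\<^sub>R p (snd x)) of (t, \<eta>) \<Rightarrow> flow \<Omega> v t 0 \<eta>)
        + (\<phi>0 (snd x) / (norm (w x))\<^sup>2) *\<^sub>R w x)"
      by (simp add: fun_eq_iff Z_def Yb_def \<eta>_def)
    from characteristic_derivative[OF x g' p' w' pnz'[OF x] wnz[OF x] y' dom A]
    show ?thesis unfolding Z u_def P_def by blast
  qed
  show ?thesis
  proof (rule that[OF U SU UU0 C1Z[unfolded X_def] C1P[unfolded X_def] C1Yb[unfolded X_def]])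
    show "Yb x \<in> \<Omega>" if "x \<in> {0..} \<times> U" for x using that Y\<Omega> \<eta>\<Omega> by (auto simp: Yb_def)
    show "Z t \<xi> - (u (t, \<xi>) / (norm (P (t, \<xi>)))\<^sup>2) *\<^sub>R P (t, \<xi>) = Yb (t, \<xi>)" if "0 \<le> t" "\<xi> \<in> U" for t \<xi>
      using normP[OF that] pnz[OF that(2)] wnz[of "(t, \<xi>)"] that
      by (simp add: Z_def u_def P_def X_def power2_eq_square)
    show "Z 0 \<xi> = \<xi>" "u (0, \<xi>) = \<phi>0 \<xi>" if "\<xi> \<in> U" for \<xi>
      using q0[OF \<eta>\<Omega>[OF that]] Y0[OF \<eta>\<Omega>[OF that]] pnz[OF that] by (simp_all add: Z_def u_def Yb_def w_def \<eta>_def)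
    show "Z t \<xi> = flow \<Omega> v t 0 \<xi>" if "0 \<le> t" "\<xi> \<in> S" for t \<xi>
      using S(2)[OF that(2)] by (simp add: Z_def Yb_def \<eta>_def)
    show "norm (P (t, \<xi>)) = norm (grad \<phi>0 \<xi>)" if "0 \<le> t" "\<xi> \<in> U" for t \<xi> using normP[OF that] by (simp add: p_def)
    show "grad \<phi>0 \<xi> \<noteq> 0" if "\<xi> \<in> U" for \<xi> using pnz[OF that] by (simp add: p_def)
    show "sgn (u (t, \<xi>)) = sgn (\<phi>0 \<xi>)" if "0 \<le> t" "\<xi> \<in> U" for t \<xi>
      using pnz[OF that(2)] wnz[of "(t, \<xi>)"] that by (simp add: u_def X_def sgn_mult sgn_divide)
    show "\<exists>Z' u'. ((\<lambda>(t, \<xi>). Z t \<xi>) has_derivative Z') (at x within {0..} \<times> U) \<and>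
       (u has_derivative u') (at x within {0..} \<times> U) \<and>
       (\<forall>d. u' d = P x \<bullet> Z' d - fst d * (P x \<bullet> v (fst x) (Yb x)))" if "x \<in> {0..} \<times> U" for x
      using deriv[of x] that unfolding X_def by blast
    fix t \<xi> D k assume t: "(0::real) \<le> t" and \<xi>: "\<xi> \<in> S" and D: "(Z t has_derivative D) (at \<xi>)" and 0: "D k = 0"
    have \<xi>U: "\<xi> \<in> U" using \<xi> SU by auto
    obtain Z' where Z': "((\<lambda>(t, \<xi>). Z t \<xi>) has_derivative Z') (at (t, \<xi>) within X)"
      and reg: "\<forall>k. Z' (0, k) = 0 \<longrightarrow> DY t (\<eta> \<xi>) k = 0"
      using deriv[of "(t, \<xi>)"] t \<xi>U S(2)[OF \<xi>] unfolding X_def by fastforce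
    have "((\<lambda>\<xi>. (t, \<xi>)) has_derivative (\<lambda>k. (0, k))) (at \<xi> within U)"
      by (auto intro!: derivative_eq_intros)
    moreover have "((\<lambda>(t, \<xi>). Z t \<xi>) has_derivative Z') (at (t, \<xi>) within (\<lambda>\<xi>. (t, \<xi>)) ` U)"
      by (rule has_derivative_subset[OF Z']) (use t in \<open>auto simp: X_def\<close>)
    ultimately have "((\<lambda>\<xi>. (\<lambda>(t, \<xi>). Z t \<xi>) (t, \<xi>)) has_derivative (\<lambda>k. Z' (0, k))) (at \<xi> within U)"
      by (rule has_derivative_in_compose)
    then have "(Z t has_derivative (\<lambda>k. Z' (0, k))) (at \<xi>)" unfolding at_within_open[OF \<xi>U U] by simp
    then have "D = (\<lambda>k. Z' (0, k))" using D has_derivative_unique by blast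
    then have "DY t (\<eta> \<xi>) k = 0" using reg 0 by simp
    \<comment> \<open>With \<open>k\<close> itself as initial conormal the pairing equals
      \<open>k \<bullet> k\<close>, so \<open>DY\<close> is injective.\<close>
    then show "k = 0" using qDY[OF t \<eta>\<Omega>[OF \<xi>U], of k k] by simp
  qed
qed

section \<open>The level set function\<close>

theorem theorem2p6:
  fixes \<Omega> \<Omega>p \<Omega>m \<Sigma>0 :: "(real^3) set"
    and v :: "real \<Rightarrow> real^3 \<Rightarrow> real^3"
    and \<phi>0 :: "real^3 \<Rightarrow> real"
  assumes "bounded \<Omega>" and "connected \<Omega>" and "open \<Omega>"
    and "H1 \<Omega> v" and "H2 \<Omega> v"
    and "\<Omega>p \<subseteq> \<Omega>" and "open \<Omega>p" and "connected \<Omega>p" and "\<Omega>p \<noteq> {}"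
    and "\<Sigma>0 = frontier \<Omega>p" and "closed_C2_surface \<Sigma>0" and "\<Sigma>0 \<inter> frontier \<Omega> = {}"
    and "\<Omega>m = \<Omega> - (\<Omega>p \<union> \<Sigma>0)"
    and "\<forall>x\<in>\<Omega>p. \<phi>0 x > 0"
    and "\<forall>x\<in>\<Omega>m. \<phi>0 x < 0"
    and "{x\<in>\<Omega>. \<phi>0 x = 0} = \<Sigma>0"
    and "\<forall>x\<in>\<Sigma>0. grad \<phi>0 x \<noteq> 0"
    and "\<exists>U. open U \<and> \<Sigma>0 \<subseteq> U \<and> U \<subseteq> \<Omega> \<and> C2_on U \<phi>0"
  shows "\<exists>(\<Theta> :: (real \<times> (real^3)) set) (\<phi> :: real \<Rightarrow> real^3 \<Rightarrow> real).
     tubular_neighborhood \<Omega> (transported \<Omega> v \<Sigma>0) \<Theta> \<and>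
     C2_on_spacetime \<Theta> \<phi> \<and>
     (\<forall>(t, x)\<in>\<Theta>. t > 0 \<longrightarrow>
        x - (\<phi> t x / (norm (grad (\<phi> t) x))\<^sup>2) *\<^sub>R grad (\<phi> t) x \<in> closure \<Omega> \<and>
        deriv (\<lambda>s. \<phi> s x) t
          + v t (x - (\<phi> t x / (norm (grad (\<phi> t) x))\<^sup>2) *\<^sub>R grad (\<phi> t) x) \<bullet> grad (\<phi> t) x = 0) \<and>
     (\<forall>x. (0, x) \<in> \<Theta> \<longrightarrow> \<phi> 0 x = \<phi>0 x) \<and>
     (\<forall>t\<ge>0. (\<forall>x\<in>transported \<Omega> v \<Omega>p t. (t, x) \<in> \<Theta> \<longrightarrow> \<phi> t x > 0) \<and>
             (\<forall>x\<in>transported \<Omega> v \<Omega>m t. (t, x) \<in> \<Theta> \<longrightarrow> \<phi> t x < 0)) \<and>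
     (\<forall>(t, x)\<in>\<Theta>. \<exists>\<xi>. (0, \<xi>) \<in> \<Theta> \<and>
        norm (grad (\<phi> t) x) = norm (grad \<phi>0 \<xi>) \<and> norm (grad \<phi>0 \<xi>) \<noteq> 0)"
proof -
  obtain U0 where U0: "open U0" "\<Sigma>0 \<subseteq> U0" "U0 \<subseteq> \<Omega>" "C2_on U0 \<phi>0"
    using assms(18) by blast
  have S: "compact \<Sigma>0" "\<Sigma>0 \<subseteq> \<Omega>"
    using assms(11) U0 by (auto simp: closed_C2_surface_def)
  define Y where "Y = (\<lambda>t. flow \<Omega> v t 0)"
  obtain L where "0 \<le> (L :: real)" and Y0: "\<And>\<xi>. \<xi> \<in> \<Omega> \<Longrightarrow> flow \<Omega> v 0 0 \<xi> = \<xi>"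
    and Y\<Omega>: "\<And>t \<xi>. 0 \<le> t \<Longrightarrow> \<xi> \<in> \<Omega> \<Longrightarrow> flow \<Omega> v t 0 \<xi> \<in> \<Omega>"
    and Yinj: "\<And>t. 0 \<le> t \<Longrightarrow> inj_on (flow \<Omega> v t 0) \<Omega>"
    by (rule flow_in_domain[OF assms(1,3,4,5)]) (rule that)
  have Y0: "Y 0 \<xi> = \<xi>" if "\<xi> \<in> \<Omega>" for \<xi> using Y0[OF that] by (simp add: Y_def)
  have Y\<Omega>: "Y t \<xi> \<in> \<Omega>" if "0 \<le> t" "\<xi> \<in> \<Omega>" for t \<xi> using Y\<Omega>[OF that] by (simp add: Y_def)
  have Yinj: "inj_on (Y t) \<Omega>" if "0 \<le> t" for t using Yinj[OF that] by (simp add: Y_def)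
  have C1Y: "C1_on ({0..} \<times> \<Omega>) (\<lambda>(t, \<eta>). Y t \<eta>)"
    unfolding Y_def by (rule flow_conormal[OF assms(1,3,4,5)])
  note Yc = C1_on_continuous_on[OF C1Y]
  have \<Sigma>0_zero: "\<phi>0 x = 0" if "x \<in> \<Sigma>0" for x using that assms(16) by blast
  have \<Sigma>0_grad: "grad \<phi>0 x \<noteq> 0" if "x \<in> \<Sigma>0" for x using that assms(17) by blast
  obtain U and Z :: "real \<Rightarrow> real^3 \<Rightarrow> real^3" and u :: "real \<times> (real^3) \<Rightarrow> real"
    and P Yb :: "real \<times> (real^3) \<Rightarrow> real^3" where
    U: "open U" "\<Sigma>0 \<subseteq> U" "U \<subseteq> U0"
    and C1Z: "C1_on ({0..} \<times> U) (\<lambda>(t, \<xi>). Z t \<xi>)" and C1P: "C1_on ({0..} \<times> U) P" and C1Yb: "C1_on ({0..} \<times> U) Yb"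
    and Yb: "\<And>x. x \<in> {0..} \<times> U \<Longrightarrow> Yb x \<in> \<Omega>"
    and proj: "\<And>t \<xi>. 0 \<le> t \<Longrightarrow> \<xi> \<in> U \<Longrightarrow> Z t \<xi> - (u (t, \<xi>) / (norm (P (t, \<xi>)))\<^sup>2) *\<^sub>R P (t, \<xi>) = Yb (t, \<xi>)"
    and Z0: "\<And>\<xi>. \<xi> \<in> U \<Longrightarrow> Z 0 \<xi> = \<xi>" and u0: "\<And>\<xi>. \<xi> \<in> U \<Longrightarrow> u (0, \<xi>) = \<phi>0 \<xi>"
    and ZS: "\<And>t \<xi>. 0 \<le> t \<Longrightarrow> \<xi> \<in> \<Sigma>0 \<Longrightarrow> Z t \<xi> = flow \<Omega> v t 0 \<xi>"
    and normP: "\<And>t \<xi>. 0 \<le> t \<Longrightarrow> \<xi> \<in> U \<Longrightarrow> norm (P (t, \<xi>)) = norm (grad \<phi>0 \<xi>)"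
    and gradnz: "\<And>\<xi>. \<xi> \<in> U \<Longrightarrow> grad \<phi>0 \<xi> \<noteq> 0"
    and usgn: "\<And>t \<xi>. 0 \<le> t \<Longrightarrow> \<xi> \<in> U \<Longrightarrow> sgn (u (t, \<xi>)) = sgn (\<phi>0 \<xi>)"
    and Zu: "\<And>x. x \<in> {0..} \<times> U \<Longrightarrow> \<exists>Z' u'. ((\<lambda>(t, \<xi>). Z t \<xi>) has_derivative Z') (at x within {0..} \<times> U) \<and>
       (u has_derivative u') (at x within {0..} \<times> U) \<and>
       (\<forall>d. u' d = P x \<bullet> Z' d - fst d * (P x \<bullet> v (fst x) (Yb x)))"
    and reg: "\<And>t \<xi> D k. 0 \<le> t \<Longrightarrow> \<xi> \<in> \<Sigma>0 \<Longrightarrow> (Z t has_derivative D) (at \<xi>) \<Longrightarrow> D k = 0 \<Longrightarrow> k = 0"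
    by (rule characteristic_map[OF assms(1,3,4,5) U0(1,3,4,2) \<Sigma>0_zero \<Sigma>0_grad]) (assumption | rule that)+
  have ZS: "Z t \<xi> = Y t \<xi>" if "0 \<le> t" "\<xi> \<in> \<Sigma>0" for t \<xi> using ZS[OF that] by (simp add: Y_def)
  \<comment> \<open>Staying in \<open>V\<close> keeps \<Theta> inside \<Omega> and makes the
    pullback \<open>H\<close> available on all of \<Theta>.\<close>
  define V where "V = (\<lambda>(t, x). (t, Y t x)) ` ({0..} \<times> \<Omega>)"
  obtain H where V: "openin (top_of_set ({0..} \<times> UNIV)) V" and Hc: "continuous_on V H"
    and H: "\<And>t x. 0 \<le> t \<Longrightarrow> x \<in> \<Omega> \<Longrightarrow> H (t, Y t x) = x"
    by (rule openin_time_space_image[OF assms(3) Yc Yinj, folded V_def]) (assumption | rule that)+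
  have VS: "(t, Z t \<xi>) \<in> V" if "0 \<le> t" "\<xi> \<in> \<Sigma>0" for t \<xi>
    using ZS[OF that] that S(2) by (auto simp: V_def)
  have Zinj: "inj_on (Z t) \<Sigma>0" if "0 \<le> t" for t
    using inj_on_subset[OF Yinj[OF that] S(2)] ZS[OF that] by (simp add: inj_on_def)
  obtain Q G where Q: "Q \<subseteq> {0..} \<times> U" "{0..} \<times> \<Sigma>0 \<subseteq> Q"
    and Qdown: "\<And>s t \<xi>. (t, \<xi>) \<in> Q \<Longrightarrow> 0 \<le> s \<Longrightarrow> s \<le> t \<Longrightarrow> (s, \<xi>) \<in> Q"
    and \<Theta>_open: "openin (top_of_set ({0..} \<times> UNIV)) ((\<lambda>(t, \<xi>). (t, Z t \<xi>)) ` Q)"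
    and \<Theta>V: "(\<lambda>(t, \<xi>). (t, Z t \<xi>)) ` Q \<subseteq> V"
    and G: "\<And>t \<xi>. (t, \<xi>) \<in> Q \<Longrightarrow> G (t, Z t \<xi>) = \<xi>"
    and C1G: "C1_on ((\<lambda>(t, \<xi>). (t, Z t \<xi>)) ` Q) G"
    by (rule time_space_inverse[OF U(1) S(1) U(2) C1Z Zinj reg V VS]) (assumption | rule that)+

  \<comment> \<open>The level set function and its derivatives\<close>
  define \<Theta> where "\<Theta> = (\<lambda>(t, \<xi>). (t, Z t \<xi>)) ` Q"
  note \<Theta>_open = \<Theta>_open[folded \<Theta>_def] and \<Theta>V = \<Theta>V[folded \<Theta>_def] and C1G = C1G[folded \<Theta>_def]
  define \<phi> where "\<phi> = (\<lambda>t x. u (t, G (t, x)))"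
  define K where "K = (\<lambda>y. (fst y, G y))"
  have \<Theta>_cases: "\<exists>\<xi>. (t, \<xi>) \<in> Q \<and> 0 \<le> t \<and> \<xi> \<in> U \<and> x = Z t \<xi> \<and> G (t, x) = \<xi>" if "(t, x) \<in> \<Theta>" for t x
    using that Q G by (auto simp: \<Theta>_def)
  have KQ: "K y \<in> Q" if "y \<in> \<Theta>" for y using that G by (auto simp: \<Theta>_def K_def)
  have C1K: "C1_on \<Theta> K"
    unfolding K_def by (intro C1_on_Pair C1_on_bounded_linear[OF bounded_linear_fst] C1G)
  have \<phi>D: "((\<lambda>(t, x). \<phi> t x) has_derivative (\<lambda>d. P (t, \<xi>) \<bullet> snd d - fst d * (P (t, \<xi>) \<bullet> v t (Yb (t, \<xi>)))))
      (at (t, x) within \<Theta>)" if "(t, \<xi>) \<in> Q" "x = Z t \<xi>" for t x \<xi>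
  proof -
    have y\<Theta>: "(t, x) \<in> \<Theta>" using that by (auto simp: \<Theta>_def)
    have Kx: "K (t, x) = (t, \<xi>)" using G that by (simp add: K_def)
    obtain K' where K': "(K has_derivative K') (at (t, x) within \<Theta>)"
      using C1K y\<Theta> unfolding C1_on_def by blast
    have "(t, \<xi>) \<in> {0..} \<times> U" using Q(1) that(1) by blast
    from Zu[OF this] obtain Z' u' where Z': "((\<lambda>(t, \<xi>). Z t \<xi>) has_derivative Z') (at (t, \<xi>) within {0..} \<times> U)"
      and u': "(u has_derivative u') (at (t, \<xi>) within {0..} \<times> U)"
      and eq: "\<And>d. u' d = P (t, \<xi>) \<bullet> Z' d - fst d * (P (t, \<xi>) \<bullet> v t (Yb (t, \<xi>)))"
      unfolding fst_conv by blast
    have K\<Theta>: "K ` \<Theta> \<subseteq> {0..} \<times> U" using KQ Q by blast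
    have "((\<lambda>(t, \<xi>). Z t \<xi>) has_derivative Z') (at (K (t, x)) within K ` \<Theta>)"
      unfolding Kx by (rule has_derivative_subset[OF Z' K\<Theta>])
    from has_derivative_in_compose[OF K' this]
    have "((\<lambda>y. (\<lambda>(t, \<xi>). Z t \<xi>) (K y)) has_derivative (\<lambda>d. Z' (K' d))) (at (t, x) within \<Theta>)" .
    then have "(snd has_derivative (\<lambda>d. Z' (K' d))) (at (t, x) within \<Theta>)"
      by (rule has_derivative_transform[OF y\<Theta>, rotated]) (auto simp: \<Theta>_def K_def G)
    \<comment> \<open>Differentiating \<open>Z (K y) = snd y\<close>, and below
      \<open>fst (K y) = fst y\<close>, turns \<open>Z' (K' d)\<close> and \<open>fst (K' d)\<close>
      into projections, so the derivative of the inverse drops out of that of \<phi>.\<close>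
    then have ZK: "(\<lambda>d. Z' (K' d)) = snd"
      by (rule has_derivative_unique_time_space[OF \<Theta>_open y\<Theta>])
         (rule bounded_linear_imp_has_derivative[OF bounded_linear_snd])
    have "(fst has_derivative (\<lambda>d. fst (K' d))) (at (t, x) within \<Theta>)"
      using has_derivative_fst[OF K'] by (simp add: K_def)
    then have fK: "(\<lambda>d. fst (K' d)) = fst"
      by (rule has_derivative_unique_time_space[OF \<Theta>_open y\<Theta>])
         (rule bounded_linear_imp_has_derivative[OF bounded_linear_fst])
    have "(u has_derivative u') (at (K (t, x)) within K ` \<Theta>)"
      unfolding Kx by (rule has_derivative_subset[OF u' K\<Theta>])
    from has_derivative_in_compose[OF K' this]
    have "((\<lambda>y. u (K y)) has_derivative (\<lambda>d. u' (K' d))) (at (t, x) within \<Theta>)" .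
    moreover have "(\<lambda>(t, x). \<phi> t x) = (\<lambda>y. u (K y))" by (simp add: \<phi>_def K_def fun_eq_iff)
    moreover have "u' (K' d) = P (t, \<xi>) \<bullet> snd d - fst d * (P (t, \<xi>) \<bullet> v t (Yb (t, \<xi>)))" for d
      using fun_cong[OF ZK, of d] fun_cong[OF fK, of d] by (simp add: eq)
    ultimately show ?thesis by simp
  qed
  obtain \<Theta>' where \<Theta>': "open \<Theta>'" "\<Theta> = ({0..} \<times> UNIV) \<inter> \<Theta>'" using \<Theta>_open by (auto simp: openin_open)
  have slice: "open {x. (t, x) \<in> \<Theta>}" if "0 \<le> t" for t
  proof -
    have "open ((\<lambda>x. (t, x)) -` \<Theta>')" by (intro open_vimage \<Theta>'(1) continuous_intros)
    also have "(\<lambda>x. (t, x)) -` \<Theta>' = {x. (t, x) \<in> \<Theta>}" using that by (auto simp: \<Theta>'(2))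
    finally show ?thesis .
  qed
  have grad\<phi>: "grad (\<phi> t) x = P (t, \<xi>)" if "(t, \<xi>) \<in> Q" "x = Z t \<xi>" for t x \<xi>
  proof (rule grad_eqI)
    have mem: "0 \<le> t" "x \<in> {x. (t, x) \<in> \<Theta>}" using that Q by (auto simp: \<Theta>_def)
    have a: "((\<lambda>x. (t, x)) has_derivative (\<lambda>h. (0, h))) (at x within {x. (t, x) \<in> \<Theta>})"
      by (auto intro!: derivative_eq_intros)
    have b: "((\<lambda>(t, x). \<phi> t x) has_derivative (\<lambda>d. P (t, \<xi>) \<bullet> snd d - fst d * (P (t, \<xi>) \<bullet> v t (Yb (t, \<xi>)))))
        (at (t, x) within (\<lambda>x. (t, x)) ` {x. (t, x) \<in> \<Theta>})"
      by (rule has_derivative_subset[OF \<phi>D[OF that]]) auto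
    from has_derivative_in_compose[OF a b, unfolded at_within_open[OF mem(2) slice[OF mem(1)]]]
    show "(\<phi> t has_derivative (\<lambda>h. P (t, \<xi>) \<bullet> h)) (at x)" by simp
  qed
  have deriv\<phi>: "deriv (\<lambda>s. \<phi> s x) t = - (P (t, \<xi>) \<bullet> v t (Yb (t, \<xi>)))" if "(t, \<xi>) \<in> Q" "x = Z t \<xi>" "0 < t" for t x \<xi>
  proof -
    \<comment> \<open>Positive times only: there the time derivative is two-sided, as
      \<open>deriv\<close> requires.\<close>
    define T where "T = {0<..} \<inter> (\<lambda>s. (s, x)) -` \<Theta>'"
    have T: "open T" unfolding T_def by (intro open_Int open_vimage \<Theta>'(1) open_greaterThan continuous_intros)
    have "(t, x) \<in> \<Theta>" using that by (auto simp: \<Theta>_def)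
    then have tT: "t \<in> T" using that by (simp add: T_def \<Theta>'(2))
    have a: "((\<lambda>s. (s, x)) has_derivative (\<lambda>a. (a, 0))) (at t within T)"
      by (auto intro!: derivative_eq_intros)
    have b: "((\<lambda>(t, x). \<phi> t x) has_derivative (\<lambda>d. P (t, \<xi>) \<bullet> snd d - fst d * (P (t, \<xi>) \<bullet> v t (Yb (t, \<xi>)))))
        (at (t, x) within (\<lambda>s. (s, x)) ` T)"
      by (rule has_derivative_subset[OF \<phi>D[OF that(1,2)]]) (auto simp: T_def \<Theta>'(2))
    from has_derivative_in_compose[OF a b, unfolded at_within_open[OF tT T]]
    have "((\<lambda>s. \<phi> s x) has_derivative (\<lambda>a. a * - (P (t, \<xi>) \<bullet> v t (Yb (t, \<xi>))))) (at t)" by simp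
    then have "((\<lambda>s. \<phi> s x) has_real_derivative - (P (t, \<xi>) \<bullet> v t (Yb (t, \<xi>)))) (at t)"
      unfolding has_field_derivative_def by (rule has_derivative_eq_rhs) (simp add: fun_eq_iff)
    then show ?thesis by (rule DERIV_imp_deriv)
  qed
  \<comment> \<open>The gain of one order: the derivative of \<phi> is composed of \<open>P\<close>,
    \<open>v\<close> and \<open>Yb\<close> along \<open>K\<close>, all of class C1, although \<phi>
    is defined as a composition of maps that are only C1.\<close>
  have C2: "C2_on \<Theta> (\<lambda>(t, x). \<phi> t x)"
    unfolding C2_on_def
  proof (intro exI[of _ "\<lambda>y. blinfun_inner_right (- (P (K y) \<bullet> v (fst y) (Yb (K y))), P (K y))"] conjI ballI)
    fix y assume "y \<in> \<Theta>"
    then obtain t \<xi> where y: "y = (t, Z t \<xi>)" "(t, \<xi>) \<in> Q" by (auto simp: \<Theta>_def)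
    then have K: "K (t, Z t \<xi>) = (t, \<xi>)" using G by (simp add: K_def)
    show "((\<lambda>(t, x). \<phi> t x) has_derivative
        blinfun_apply (blinfun_inner_right (- (P (K y) \<bullet> v (fst y) (Yb (K y))), P (K y)))) (at y within \<Theta>)"
      unfolding y(1) K by (rule has_derivative_eq_rhs[OF \<phi>D[OF y(2) refl]])
        (simp add: fun_eq_iff blinfun_inner_right.rep_eq inner_prod_def mult.commute)
  next
    have KU: "K y \<in> {0..} \<times> U" if "y \<in> \<Theta>" for y using KQ[OF that] Q by blast
    have PK: "C1_on \<Theta> (\<lambda>y. P (K y))" by (rule C1_on_compose[OF C1P C1K KU])
    have YK: "C1_on \<Theta> (\<lambda>y. (fst y, Yb (K y)))"
      by (intro C1_on_Pair C1_on_bounded_linear[OF bounded_linear_fst] C1_on_compose[OF C1Yb C1K KU])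
    have "C1_on ({0..} \<times> \<Omega>) (\<lambda>(t, x). v t x)" using assms(4) by (simp add: H1_def)
    then have "C1_on \<Theta> (\<lambda>y. (\<lambda>(t, x). v t x) (fst y, Yb (K y)))"
    proof (rule C1_on_compose[OF _ YK])
      show "(fst y, Yb (K y)) \<in> {0..} \<times> \<Omega>" if "y \<in> \<Theta>" for y
        using Yb[OF KU[OF that]] KU[OF that] by (auto simp: K_def)
    qed
    then have vK: "C1_on \<Theta> (\<lambda>y. v (fst y) (Yb (K y)))" by simp
    have "C1_on \<Theta> (\<lambda>y. ((-1) *\<^sub>R (P (K y) \<bullet> v (fst y) (Yb (K y))), P (K y)))"
      by (intro C1_on_Pair C1_on_scaleR C1_on_const C1_on_inner PK vK)
    from C1_on_linear_comp[OF bounded_linear_blinfun_inner_right this]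
    show "C1_on \<Theta> (\<lambda>y. blinfun_inner_right (- (P (K y) \<bullet> v (fst y) (Yb (K y))), P (K y)))" by simp
  qed

  \<comment> \<open>The tubular neighborhood\<close>
  have tube: "tubular_neighborhood \<Omega> (transported \<Omega> v \<Sigma>0) \<Theta>"
  proof -
    have tr: "transported \<Omega> v \<Sigma>0 t = Y t ` \<Sigma>0" for t by (simp add: transported_def Y_def)
    have \<Theta>\<Omega>: "\<Theta> \<subseteq> {0..} \<times> \<Omega>"
      by (rule order_trans[OF \<Theta>V]) (use Y\<Omega> in \<open>auto simp: V_def\<close>)
    have on\<Theta>: "(t, Y t \<xi>) \<in> \<Theta>" if "0 \<le> t" "\<xi> \<in> \<Sigma>0" for t \<xi>
      using Q(2) ZS[OF that] that unfolding \<Theta>_def by force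
    \<comment> \<open>Demanding the radius for all times up to \<open>T\<close> at once makes
      \<open>R\<close> monotone in the way that \<open>antimono_selection\<close> wants.\<close>
    define R where "R = (\<lambda>T e. \<forall>t\<in>{0..T}. {t} \<times> (\<Union>x\<in>Y t ` \<Sigma>0. ball x e) \<subseteq> \<Theta>)"
    have "\<exists>e>0. \<forall>t\<in>{0..T}. {t} \<times> (\<Union>x\<in>Y t ` \<Sigma>0. ball x e) \<subseteq> \<Theta>" if T: "0 \<le> T" for T
    proof -
      \<comment> \<open>The interface swept out up to time \<open>T\<close> is compact in space-time
        and lies in the open set \<Theta>', which gives one radius for all these times.\<close>
      have "compact ((\<lambda>(t, \<xi>). (t, Y t \<xi>)) ` ({0..T} \<times> \<Sigma>0))"
      proof (rule compact_continuous_image)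
        have "continuous_on ({0..T} \<times> \<Sigma>0) (\<lambda>(t, \<xi>). Y t \<xi>)"
          by (rule continuous_on_subset[OF Yc]) (use S in auto)
        then show "continuous_on ({0..T} \<times> \<Sigma>0) (\<lambda>(t, \<xi>). (t, Y t \<xi>))"
          unfolding case_prod_unfold by (intro continuous_intros)
      qed (intro compact_Times S compact_Icc)
      moreover have "(\<lambda>(t, \<xi>). (t, Y t \<xi>)) ` ({0..T} \<times> \<Sigma>0) \<subseteq> \<Theta>'" using on\<Theta> \<Theta>'(2) by auto
      ultimately obtain e where e: "0 < e" "(\<Union>x\<in>(\<lambda>(t, \<xi>). (t, Y t \<xi>)) ` ({0..T} \<times> \<Sigma>0). ball x e) \<subseteq> \<Theta>'"
        using compact_subset_open_imp_ball_epsilon_subset \<Theta>'(1) by blast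
      have "(t, y) \<in> \<Theta>" if "t \<in> {0..T}" "\<xi> \<in> \<Sigma>0" "y \<in> ball (Y t \<xi>) e" for t \<xi> y
      proof -
        have "(t, y) \<in> ball (t, Y t \<xi>) e" using that by (simp add: dist_Pair_Pair)
        then have "(t, y) \<in> \<Theta>'" using e(2) that by fastforce
        then show ?thesis using that by (simp add: \<Theta>'(2))
      qed
      then show ?thesis using e(1) by (intro exI[of _ e]) auto
    qed
    then have ex: "\<exists>e>0. R T e" if "0 \<le> T" for T using that by (simp add: R_def)
    have time: "R S e" if "0 \<le> S" "S \<le> T" "R T e" for S T e using that by (auto simp: R_def)
    have down: "R T e'" if "0 < e'" "e' \<le> e" "R T e" for T e e'
      using that(3) subset_ball[OF that(2)] unfolding R_def by blast
    obtain \<epsilon> where \<epsilon>: "antimono_on {0..} \<epsilon>" "\<And>T. 0 \<le> T \<Longrightarrow> 0 < \<epsilon> T" "\<And>T. 0 \<le> T \<Longrightarrow> R T (\<epsilon> T)"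
      by (rule antimono_selection[of R, OF ex time down]) (assumption | rule that)+
    have "{x \<in> \<Omega>. (t, x) \<in> \<Theta>} = {x. (t, x) \<in> \<Theta>}" for t using \<Theta>\<Omega> by auto
    then have "\<forall>t\<ge>0. open {x \<in> \<Omega>. (t, x) \<in> \<Theta>}" using slice by simp
    moreover have "(\<Union>t\<in>{0..}. {t} \<times> Y t ` \<Sigma>0) \<subseteq> \<Theta>" using on\<Theta> by auto
    moreover have "\<forall>t\<ge>0. {t} \<times> (\<Union>x\<in>Y t ` \<Sigma>0. ball x (\<epsilon> t)) \<subseteq> \<Theta>" 
      using \<epsilon>(3) unfolding R_def by (meson atLeastAtMost_iff order_refl)
    ultimately show ?thesis
      unfolding tubular_neighborhood_def tr using \<Theta>\<Omega> \<epsilon>(1,2) by blast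
  qed

  \<comment> \<open>Signs on the two sides of the interface\<close>
  have clos: "closure \<Omega>p = \<Omega>p \<union> \<Sigma>0"
    using assms(10) closure_Un_frontier by blast
  have \<Omega>m: "open \<Omega>m"
    unfolding assms(13) clos[symmetric] by (intro open_Diff assms(3) closed_closure)
  have disj: "\<Omega>p \<inter> \<Sigma>0 = {}" "\<Omega>p \<inter> \<Omega>m = {}" "\<Omega>m \<inter> \<Sigma>0 = {}"
    using assms(7,10,13) by (auto simp: frontier_def interior_open)
  have cover: "\<Omega> - \<Sigma>0 = \<Omega>p \<union> \<Omega>m" using assms(6,13) disj by blast
  text \<open>The pullback of a characteristic by the flow is a path that never meets the interface.\<close>
  have side: "\<xi> \<in> \<Omega>p \<longleftrightarrow> \<xi>0 \<in> \<Omega>p" "\<xi> \<in> \<Omega> - \<Sigma>0"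
    if \<xi>: "(t, \<xi>) \<in> Q" and \<xi>0: "\<xi>0 \<in> \<Omega> - \<Sigma>0" and eq: "Z t \<xi> = Y t \<xi>0" for t \<xi> \<xi>0
  proof -
    have t: "0 \<le> t" and \<xi>U: "\<xi> \<in> U" using \<xi> Q by auto
    have Zin: "(s, Z s \<xi>) \<in> V" if "s \<in> {0..t}" for s
      using Qdown[OF \<xi>, of s] that \<Theta>V by (auto simp: \<Theta>_def)
    \<comment> \<open>The path starts at \<xi>, because \<open>Z\<close> and \<open>Y\<close> are
      both the identity at time 0, and ends at \<xi>0 by \<open>eq\<close>.\<close>
    define \<zeta> where "\<zeta> = (\<lambda>s. H (s, Z s \<xi>))"
    have \<zeta>: "\<zeta> s \<in> \<Omega>" "Y s (\<zeta> s) = Z s \<xi>" if "s \<in> {0..t}" for s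
      using Zin[OF that] H that by (auto simp: V_def \<zeta>_def)
    have "continuous_on {0..t} (\<lambda>s. Z s \<xi>)"
      by (rule continuous_on_compose_Pair[OF C1_on_continuous_on[OF C1Z]])
         (use \<xi>U in \<open>auto intro!: continuous_intros\<close>)
    then have \<zeta>c: "continuous_on {0..t} \<zeta>"
      unfolding \<zeta>_def by (intro continuous_on_compose2[OF Hc] continuous_intros) (use Zin in auto)
    have \<zeta>0: "\<zeta> 0 = \<xi>"
    proof -
      have "Y 0 (\<zeta> 0) = \<xi>" using \<zeta>(2)[of 0] t Z0[OF \<xi>U] by simp
      then show ?thesis using Y0[OF \<zeta>(1)[of 0]] t by simp
    qed
    have \<zeta>t: "\<zeta> t = \<xi>0"
      using inj_onD[OF Yinj[OF t], of "\<zeta> t" \<xi>0] \<zeta>[of t] t \<xi>0 eq by auto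
    \<comment> \<open>\<open>Z\<close> and the flow agree on the initial interface, so a contact at
      time \<open>s\<close> gives \<open>\<zeta> s\<close> and \<xi> the same image under
      \<open>Z s\<close>, and \<xi> itself is an interface point. Then \<open>Z t \<xi>\<close> is
      also the flow image of \<xi>, whence \<open>\<xi> = \<xi>0\<close>, which lies off the
      interface.\<close>
    have avoid: "\<zeta> s \<notin> \<Sigma>0" if s: "s \<in> {0..t}" for s
    proof
      assume "\<zeta> s \<in> \<Sigma>0"
      then have "Z s (\<zeta> s) = Z s \<xi>" using ZS[of s "\<zeta> s"] \<zeta>[OF s] s by simp
      moreover have "(s, \<zeta> s) \<in> Q" "(s, \<xi>) \<in> Q" using Q(2) \<open>\<zeta> s \<in> \<Sigma>0\<close> s Qdown[OF \<xi>, of s] by auto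
      ultimately have "\<zeta> s = \<xi>" using G by metis
      then have "Z t \<xi> = Y t \<xi>" using \<open>\<zeta> s \<in> \<Sigma>0\<close> ZS t by simp
      then have "\<xi> = \<xi>0" using inj_onD[OF Yinj[OF t], of \<xi> \<xi>0] eq \<xi>0 \<xi>U U(3) U0(3) by auto
      then show False using \<open>\<zeta> s = \<xi>\<close> \<open>\<zeta> s \<in> \<Sigma>0\<close> \<xi>0 by simp
    qed
    have conn: "connected (\<zeta> ` {0..t})" by (rule connected_continuous_image[OF \<zeta>c connected_Icc])
    have sub: "\<zeta> ` {0..t} \<subseteq> \<Omega>p \<union> \<Omega>m" using \<zeta>(1) avoid cover by blast
    have ends: "\<xi> \<in> \<zeta> ` {0..t}" "\<xi>0 \<in> \<zeta> ` {0..t}" using t \<zeta>0 \<zeta>t by force+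
    \<comment> \<open>The connected path lies in the union of two disjoint open phases, so it misses
      one of them.\<close>
    have "\<Omega>p \<inter> \<zeta> ` {0..t} = {} \<or> \<Omega>m \<inter> \<zeta> ` {0..t} = {}"
      using connectedD[OF conn assms(7) \<Omega>m _ sub] disj(2) by blast
    then show "\<xi> \<in> \<Omega>p \<longleftrightarrow> \<xi>0 \<in> \<Omega>p" using ends sub by blast
    show "\<xi> \<in> \<Omega> - \<Sigma>0" using ends sub cover by blast
  qed
  have signs: "(x \<in> Y t ` \<Omega>p \<longrightarrow> \<phi> t x > 0) \<and> (x \<in> Y t ` \<Omega>m \<longrightarrow> \<phi> t x < 0)" if t: "0 \<le> t" and x: "(t, x) \<in> \<Theta>" for t x
  proof -
    obtain \<xi> where \<xi>: "(t, \<xi>) \<in> Q" "\<xi> \<in> U" "x = Z t \<xi>" "G (t, x) = \<xi>" using \<Theta>_cases[OF x] by blast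
    have \<phi>: "sgn (\<phi> t x) = sgn (\<phi>0 \<xi>)" using usgn[OF t \<xi>(2)] by (simp add: \<phi>_def \<xi>(4))
    show ?thesis
    proof (intro conjI impI)
      assume "x \<in> Y t ` \<Omega>p"
      then obtain \<xi>0 where "\<xi>0 \<in> \<Omega>p" "x = Y t \<xi>0" by blast
      then have "\<xi> \<in> \<Omega>p" using side(1)[OF \<xi>(1), of \<xi>0] \<xi>(3) cover by auto
      then have "sgn (\<phi> t x) = 1" using assms(14) \<phi> by simp
      then show "\<phi> t x > 0" by (simp add: sgn_1_pos)
    next
      assume "x \<in> Y t ` \<Omega>m"
      then obtain \<xi>0 where "\<xi>0 \<in> \<Omega>m" "x = Y t \<xi>0" by blast
      then have "\<xi> \<notin> \<Omega>p" "\<xi> \<in> \<Omega> - \<Sigma>0"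
        using side[OF \<xi>(1), of \<xi>0] \<xi>(3) cover disj(2) by auto
      then have "\<xi> \<in> \<Omega>m" unfolding cover by simp
      then have "sgn (\<phi> t x) = - 1" using assms(15) \<phi> by simp
      then show "\<phi> t x < 0" by (simp add: sgn_1_neg)
    qed
  qed
  show ?thesis
  proof (intro exI[of _ \<Theta>] exI[of _ \<phi>] conjI)
    \<comment> \<open>\<Theta> is relatively open and serves as its own superset.\<close>
    show "C2_on_spacetime \<Theta> \<phi>" unfolding C2_on_spacetime_def using C2 \<Theta>_open by blast
    show "\<forall>(t, x)\<in>\<Theta>. t > 0 \<longrightarrow>
        x - (\<phi> t x / (norm (grad (\<phi> t) x))\<^sup>2) *\<^sub>R grad (\<phi> t) x \<in> closure \<Omega> \<and>
        deriv (\<lambda>s. \<phi> s x) t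
          + v t (x - (\<phi> t x / (norm (grad (\<phi> t) x))\<^sup>2) *\<^sub>R grad (\<phi> t) x) \<bullet> grad (\<phi> t) x = 0"
    proof (clarify)
      fix t x assume "(t, x) \<in> \<Theta>" "0 < t"
      then obtain \<xi> where \<xi>: "(t, \<xi>) \<in> Q" "0 \<le> t" "\<xi> \<in> U" "x = Z t \<xi>" "G (t, x) = \<xi>" using \<Theta>_cases by blast
      have \<phi>x: "\<phi> t x = u (t, \<xi>)" by (simp add: \<phi>_def \<xi>(5))
      have "x - (\<phi> t x / (norm (grad (\<phi> t) x))\<^sup>2) *\<^sub>R grad (\<phi> t) x = Yb (t, \<xi>)"
        unfolding grad\<phi>[OF \<xi>(1,4)] \<phi>x using proj[OF \<xi>(2,3)] \<xi>(4) by simp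
      moreover have "Yb (t, \<xi>) \<in> closure \<Omega>" using Yb[of "(t, \<xi>)"] \<xi> closure_subset by auto
      ultimately show "x - (\<phi> t x / (norm (grad (\<phi> t) x))\<^sup>2) *\<^sub>R grad (\<phi> t) x \<in> closure \<Omega> \<and>
        deriv (\<lambda>s. \<phi> s x) t
          + v t (x - (\<phi> t x / (norm (grad (\<phi> t) x))\<^sup>2) *\<^sub>R grad (\<phi> t) x) \<bullet> grad (\<phi> t) x = 0"
        using grad\<phi>[OF \<xi>(1,4)] deriv\<phi>[OF \<xi>(1,4) \<open>0 < t\<close>] by (simp add: inner_commute)
    qed
    show "\<forall>x. (0, x) \<in> \<Theta> \<longrightarrow> \<phi> 0 x = \<phi>0 x"
      using \<Theta>_cases Z0 u0 unfolding \<phi>_def by metis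
    show "\<forall>t\<ge>0. (\<forall>x\<in>transported \<Omega> v \<Omega>p t. (t, x) \<in> \<Theta> \<longrightarrow> \<phi> t x > 0) \<and>
             (\<forall>x\<in>transported \<Omega> v \<Omega>m t. (t, x) \<in> \<Theta> \<longrightarrow> \<phi> t x < 0)"
      using signs unfolding transported_def Y_def by blast
    show "\<forall>(t, x)\<in>\<Theta>. \<exists>\<xi>. (0, \<xi>) \<in> \<Theta> \<and>
        norm (grad (\<phi> t) x) = norm (grad \<phi>0 \<xi>) \<and> norm (grad \<phi>0 \<xi>) \<noteq> 0"
    proof (clarify)
      fix t x assume "(t, x) \<in> \<Theta>"
      then obtain \<xi> where \<xi>: "(t, \<xi>) \<in> Q" "0 \<le> t" "\<xi> \<in> U" "x = Z t \<xi>" using \<Theta>_cases by blast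
      \<comment> \<open>The witness is the foot point of the characteristic; downward closedness of
        \<open>Q\<close> in time places it in the initial slice of \<Theta>.\<close>
      have "(0, \<xi>) \<in> Q" using Qdown[OF \<xi>(1)] \<xi>(2) by simp
      then have "(0, Z 0 \<xi>) \<in> \<Theta>" unfolding \<Theta>_def by (rule rev_image_eqI) simp
      then have "(0, \<xi>) \<in> \<Theta>" using Z0[OF \<xi>(3)] by simp
      then show "\<exists>\<xi>. (0, \<xi>) \<in> \<Theta> \<and> norm (grad (\<phi> t) x) = norm (grad \<phi>0 \<xi>) \<and> norm (grad \<phi>0 \<xi>) \<noteq> 0"
        using grad\<phi>[OF \<xi>(1,4)] normP[OF \<xi>(2,3)] gradnz[OF \<xi>(3)] by auto
    qed
  qed (rule tube)
qed

end
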